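(* Let $K$ be a field of characteristic zero, $n\ge1$, and let $\mathbb{I}_n$ be the algebra of polynomial integro-differential operators. With the notation of the context: 1. ${}'\Delta_n\in\mathrm{Den}_l(\mathbb{I}_n,\mathfrak{a}_n)$ and ${}'\Delta_n^{-1}\mathbb{I}_n\simeq{}'Q(\mathbb{I}_n)$. Furthermore, ${}'\Delta_n$ is a left denominator set of $\mathbb{I}_n$ which is the largest left denominator set of $\mathbb{I}_n$ contained in the multiplicative set ${}'\mathcal{C}_{\mathbb{I}_n}\cap\Delta_n$. 2. ${}'\Delta_n+\mathfrak{a}_n,\ {}'S(\mathbb{I}_n)+\mathfrak{a}_n\in\mathrm{Den}_l(\mathbb{I}_n,\mathfrak{a}_n)$ and $({}'\Delta_n+\mathfrak{a}_n)^{-1}\mathbb{I}_n\simeq({}'S(\mathbb{I}_n)+\mathfrak{a}_n)^{-1}\mathbb{I}_n\simeq{}'Q(\mathbb{I}_n)$. 3. ${}'\Delta_n=\overline{{}'\Delta_n},\ \overline{{}'\Delta_n+\mathfrak{a}_n},\ \overline{{}'S(\mathbb{I}_n)+\mathfrak{a}_n}\in\mathrm{Den}_l(B_n,0)$ and ${}'\Delta_n^{-1}B_n\simeq\overline{{}'\Delta_n+\mathfrak{a}_n}^{\,-1}B_n\simeq\overline{{}'S(\mathbb{I}_n)+\mathfrak{a}_n}^{\,-1}B_n\simeq{}'Q(\mathbb{I}_n)$. 4. $\widetilde{{}'\Delta_n}\in\mathrm{Den}_l(\mathbb{I}_n,\mathfrak{a}_n)$ and $\widetilde{{}'\Delta_n}^{-1}\mathbb{I}_n\simeq{}'Q(\mathbb{I}_n)$;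 also $\overline{\widetilde{{}'\Delta_n}}\in\mathrm{Den}_l(B_n,0)$ and $\overline{\widetilde{{}'\Delta_n}}^{\,-1}B_n\simeq{}'Q(\mathbb{I}_n)$. 5. $\widetilde{{}'\Delta_n}+\mathfrak{a}_n\in\mathrm{Den}_l(\mathbb{I}_n,\mathfrak{a}_n)$ and $(\widetilde{{}'\Delta_n}+\mathfrak{a}_n)^{-1}\mathbb{I}_n\simeq{}'Q(\mathbb{I}_n)$. 6. ${}'\Delta_n\in\mathrm{Den}_l(\Delta_n,0)$ and ${}'\Delta_n^{-1}\Delta_n\simeq{}'Q(\mathbb{I}_n)$. 7. ${}''\Delta_n:=\big({}'S(\mathbb{I}_n)\cap({}'\mathcal{C}_{\Delta_n+\mathfrak{a}_n}+\mathfrak{a}_n)\big)+\mathfrak{a}_n\in\mathrm{Den}_l(\mathbb{I}_n,\mathfrak{a}_n)$, ${}'\Delta_n\subseteq{}''\Delta_n$ and ${}''\Delta_n^{-1}\mathbb{I}_n\simeq{}'Q(\mathbb{I}_n)$.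
   Context: Localization. All rings are unital. A subset $S$ of a ring $R$ is multiplicative if $1\in S$, $SS\subseteq S$, $0\notin S$. A multiplicative set $S$ is a left Ore set if $Sr\cap Rs\neq\emptyset$ for all $r\in R$, $s\in S$; put $\mathrm{ass}_l(S)=\{r\in R\mid sr=0\text{ for some }s\in S\}$. A left Ore set $S$ is a left denominator set if $rs=0$ with $r\in R$, $s\in S$ implies $tr=0$ for some $t\in S$. $\mathrm{Den}_l(R,\mathfrak{a})$ is the set of left denominator sets $S$ of $R$ with $\mathrm{ass}_l(S)=\mathfrak{a}$, and $S^{-1}R$ is the left localization. ${}'\mathcal{C}_R=\{c\in R\mid rc=0\Rightarrow r=0\}$ is the set of left regular elements of $R$; it contains a largest left denominator set of $R$, denoted ${}'S(R)$, and ${}'Q(R):={}'S(R)^{-1}R$. The symbol $\simeq$ denotes isomorphism of $K$-algebras. The algebra $\mathbb{I}_n$. Let $P_n=K[x_1,\ldots,x_n]$. $\mathbb{I}_n$ is the subalgebra of $\mathrm{End}_K(P_n)$ generated by the multiplications by $x_i$, the derivatives $\partial_i=\frac{\partial}{\partial x_i}$ and the integrations $\int_i:x^\alpha\mapsto(\alpha_i+1)^{-1}x_ix^\alpha$, $i=1,\ldots,n$. Put $H_i=\partial_ix_i$. Let $\mathfrak{p}_i$ be the ideal of $\mathbb{I}_n$ generated by $1-\int_i\partial_i$ and $\mathfrak{a}_n=\mathfrak{p}_1+\cdots+\mathfrak{p}_n$ (the unique maximal ideal of $\mathbb{I}_n$). The factor algebra $B_n:=\mathbb{I}_n/\mathfrak{a}_n$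 is the skew Laurent polynomial algebra $K[H_1,\ldots,H_n][\partial_1^{\pm1},\ldots,\partial_n^{\pm1};\tau_1,\ldots,\tau_n]$, with $\tau_i(H_j)=H_j+\delta_{ij}$ and $\partial_ih=\tau_i(h)\partial_i$ (with $\int_i\mapsto\partial_i^{-1}$). $\Delta_n$ is the subalgebra of $\mathbb{I}_n$ generated by all $H_i,\partial_i$; it is the skew polynomial ring $K[H_1,\ldots,H_n][\partial_1,\ldots,\partial_n;\tau_1,\ldots,\tau_n]$, it meets $\mathfrak{a}_n$ only in $0$, and it is identified with its image in $B_n$. For a subset $S\subseteq\mathbb{I}_n$, $\overline{S}$ is its image under $\pi_{\mathfrak{a}_n}:\mathbb{I}_n\to B_n$. Sets: ${}'\Delta_n:=\Delta_n\cap{}'S(\mathbb{I}_n)$ and $\widetilde{{}'\Delta_n}:=\{c\in\Delta_n\mid\partial^\alpha c\in{}'S(\mathbb{I}_n)\text{ for some }\alpha\in\mathbb{N}^n\}$, where $\partial^\alpha=\partial_1^{\alpha_1}\cdots\partial_n^{\alpha_n}$. ${}'\mathcal{C}_{\Delta_n+\mathfrak{a}_n}$ is the set of left regular elements of the ring $\Delta_n+\mathfrak{a}_n$. For subsets, $S+\mathfrak{a}_n=\{s+a\mid s\in S,a\in\mathfrak{a}_n\}$. *)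

theory Defs
  imports "HOL-Algebra.QuotRing" "HOL-Algebra.Subrings" "HOL-Library.Poly_Mapping"
begin

section \<open>Localization at left denominator sets\<close>

definition multiplicative_set :: "('a, 'm) ring_scheme \<Rightarrow> 'a set \<Rightarrow> bool" where
  "multiplicative_set R S \<longleftrightarrow>
     S \<subseteq> carrier R \<and> \<one>\<^bsub>R\<^esub> \<in> S \<and> (\<forall>s\<in>S. \<forall>t\<in>S. s \<otimes>\<^bsub>R\<^esub> t \<in> S) \<and> \<zero>\<^bsub>R\<^esub> \<notin> S"

definition left_ore_set :: "('a, 'm) ring_scheme \<Rightarrow> 'a set \<Rightarrow> bool" where
  "left_ore_set R S \<longleftrightarrow>
     multiplicative_set R S \<and>
     (\<forall>r\<in>carrier R. \<forall>s\<in>S. (S #>\<^bsub>R\<^esub> r) \<inter> (carrier R #>\<^bsub>R\<^esub> s) \<noteq> {})"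

definition ass_l :: "('a, 'm) ring_scheme \<Rightarrow> 'a set \<Rightarrow> 'a set" where
  "ass_l R S = {r \<in> carrier R. \<exists>s\<in>S. s \<otimes>\<^bsub>R\<^esub> r = \<zero>\<^bsub>R\<^esub>}"

definition left_denominator_set :: "('a, 'm) ring_scheme \<Rightarrow> 'a set \<Rightarrow> bool" where
  "left_denominator_set R S \<longleftrightarrow>
     left_ore_set R S \<and>
     (\<forall>r\<in>carrier R. \<forall>s\<in>S. r \<otimes>\<^bsub>R\<^esub> s = \<zero>\<^bsub>R\<^esub> \<longrightarrow> (\<exists>t\<in>S. t \<otimes>\<^bsub>R\<^esub> r = \<zero>\<^bsub>R\<^esub>))"

definition Den_l :: "('a, 'm) ring_scheme \<Rightarrow> 'a set \<Rightarrow> 'a set set" where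
  "Den_l R I = {S. left_denominator_set R S \<and> ass_l R S = I}"

definition left_regular :: "('a, 'm) ring_scheme \<Rightarrow> 'a set" where
  "left_regular R =
     {c \<in> carrier R. \<forall>r\<in>carrier R. r \<otimes>\<^bsub>R\<^esub> c = \<zero>\<^bsub>R\<^esub> \<longrightarrow> r = \<zero>\<^bsub>R\<^esub>}"

text \<open>
  The largest element exists in every nonzero ring; see
  \<open>left_regular_den_is_largest\<close> below.
\<close>

definition left_regular_den :: "('a, 'm) ring_scheme \<Rightarrow> 'a set" where
  "left_regular_den R = (GREATEST S. left_denominator_set R S \<and> S \<subseteq> left_regular R)"

text \<open>
  Algebras over a field type are records of type \<open>('k, 'a) module\<close>, that is, rings with a
  scalar multiplication by all of \<open>'k\<close>. (The library locale \<open>algebra\<close> is not used because it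
  requires a commutative ring.)

  The pair \<open>(s, r)\<close> represents the left fraction \<open>s\<^sup>-\<^sup>1 r\<close>.
\<close>

definition frac_rel :: "('a, 'm) ring_scheme \<Rightarrow> 'a set \<Rightarrow> (('a \<times> 'a) \<times> ('a \<times> 'a)) set" where
  "frac_rel R S =
     {((s, r), (s', r')). s \<in> S \<and> r \<in> carrier R \<and> s' \<in> S \<and> r' \<in> carrier R \<and>
        (\<exists>a\<in>carrier R. \<exists>b\<in>carrier R. a \<otimes>\<^bsub>R\<^esub> s = b \<otimes>\<^bsub>R\<^esub> s' \<and> a \<otimes>\<^bsub>R\<^esub> s \<in> S \<and>
           a \<otimes>\<^bsub>R\<^esub> r = b \<otimes>\<^bsub>R\<^esub> r')}"

definition frac :: "('a, 'm) ring_scheme \<Rightarrow> 'a set \<Rightarrow> 'a \<Rightarrow> 'a \<Rightarrow> ('a \<times> 'a) set" where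
  "frac R S s r = frac_rel R S `` {(s, r)}"

text \<open>
  The operations on fractions are
  \<open>s\<^sup>-\<^sup>1 r \<cdot> t\<^sup>-\<^sup>1 q = (u s)\<^sup>-\<^sup>1 (a q)\<close> where \<open>u r = a t\<close> with \<open>u \<in> S\<close>, and
  \<open>s\<^sup>-\<^sup>1 r + t\<^sup>-\<^sup>1 q = (a s)\<^sup>-\<^sup>1 (a r + b q)\<close> where \<open>a s = b t \<in> S\<close>.
  For a left denominator set, all admissible choices lead to the same class, so each of the unions
  below is the union of a single class.
\<close>

definition localization :: "('k, 'a) module \<Rightarrow> 'a set \<Rightarrow> ('k, ('a \<times> 'a) set) module" where
  "localization R S =
     \<lparr> carrier = (S \<times> carrier R) // frac_rel R S,
       mult = (\<lambda>X Y. \<Union> {frac R S (u \<otimes>\<^bsub>R\<^esub> s) (a \<otimes>\<^bsub>R\<^esub> q) | s r t q u a.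
                 (s, r) \<in> X \<and> (t, q) \<in> Y \<and> u \<in> S \<and> a \<in> carrier R \<and>
                 u \<otimes>\<^bsub>R\<^esub> r = a \<otimes>\<^bsub>R\<^esub> t}),
       one = frac R S \<one>\<^bsub>R\<^esub> \<one>\<^bsub>R\<^esub>,
       zero = frac R S \<one>\<^bsub>R\<^esub> \<zero>\<^bsub>R\<^esub>,
       add = (\<lambda>X Y. \<Union> {frac R S (a \<otimes>\<^bsub>R\<^esub> s) (a \<otimes>\<^bsub>R\<^esub> r \<oplus>\<^bsub>R\<^esub> b \<otimes>\<^bsub>R\<^esub> q) | s r t q a b.
                (s, r) \<in> X \<and> (t, q) \<in> Y \<and> a \<in> carrier R \<and> b \<in> carrier R \<and>
                a \<otimes>\<^bsub>R\<^esub> s = b \<otimes>\<^bsub>R\<^esub> t \<and> a \<otimes>\<^bsub>R\<^esub> s \<in> S}),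
       smult = (\<lambda>c X. \<Union> {frac R S s (c \<odot>\<^bsub>R\<^esub> r) | s r. (s, r) \<in> X}) \<rparr>"

definition algebra_iso :: "('k, 'a) module \<Rightarrow> ('k, 'b) module \<Rightarrow> bool" (infix \<open>\<simeq>\<^sub>K\<close> 50) where
  "A \<simeq>\<^sub>K B \<longleftrightarrow>
     (\<exists>f \<in> ring_iso A B. \<forall>c. \<forall>x\<in>carrier A. f (c \<odot>\<^bsub>A\<^esub> x) = c \<odot>\<^bsub>B\<^esub> f x)"

definition factor_algebra :: "('k, 'a) module \<Rightarrow> 'a set \<Rightarrow> ('k, 'a set) module" where
  "factor_algebra A I =
     ring.extend (A Quot I) (module.fields (\<lambda>c X. \<Union>x\<in>X. I +>\<^bsub>A\<^esub> (c \<odot>\<^bsub>A\<^esub> x)))"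

definition generated_subalgebra :: "('k, 'a) module \<Rightarrow> 'a set \<Rightarrow> 'a set" where
  "generated_subalgebra A X =
     \<Inter> {U. subring U A \<and> (\<forall>c. \<forall>u\<in>U. c \<odot>\<^bsub>A\<^esub> u \<in> U) \<and> X \<subseteq> U}"


section \<open>Polynomial integro-differential operators\<close>

text \<open>
  The variables are indexed by \<open>'n\<close>, so the number of variables is \<open>CARD('n) \<ge> 1\<close>. A polynomial
  maps exponent vectors to coefficients.
\<close>

type_synonym ('n, 'k) polys = "('n \<Rightarrow>\<^sub>0 nat) \<Rightarrow>\<^sub>0 'k"
type_synonym ('n, 'k) operator = "('n, 'k) polys \<Rightarrow> ('n, 'k) polys"

definition scale_poly :: "'k::field \<Rightarrow> ('n, 'k) polys \<Rightarrow> ('n, 'k) polys" where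
  "scale_poly c p = Poly_Mapping.map ((*) c) p"

definition x_pow :: "('n \<Rightarrow>\<^sub>0 nat) \<Rightarrow> ('n, 'k::field) polys" where
  "x_pow \<alpha> = Poly_Mapping.single \<alpha> 1"

abbreviation unit_exp :: "'n \<Rightarrow> 'n \<Rightarrow>\<^sub>0 nat" where
  "unit_exp i \<equiv> Poly_Mapping.single i 1"

definition linear_ext :: "(('n \<Rightarrow>\<^sub>0 nat) \<Rightarrow> ('n, 'k::field) polys) \<Rightarrow> ('n, 'k) operator" where
  "linear_ext g p = (\<Sum>\<alpha>\<in>Poly_Mapping.keys p. scale_poly (Poly_Mapping.lookup p \<alpha>) (g \<alpha>))"

definition x_op :: "'n \<Rightarrow> ('n, 'k::field) operator" where
  "x_op i p = x_pow (unit_exp i) * p"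

text \<open>
  If \<open>\<alpha>\<^sub>i = 0\<close>, the truncated subtraction in the exponent is harmless since the
  coefficient vanishes.
\<close>

definition partial_op :: "'n \<Rightarrow> ('n, 'k::field) operator" where
  "partial_op i =
     linear_ext (\<lambda>\<alpha>. scale_poly (of_nat (Poly_Mapping.lookup \<alpha> i)) (x_pow (\<alpha> - unit_exp i)))"

definition int_op :: "'n \<Rightarrow> ('n, 'k::field) operator" where
  "int_op i =
     linear_ext (\<lambda>\<alpha>. scale_poly (inverse (of_nat (Poly_Mapping.lookup \<alpha> i + 1)))
       (x_pow (unit_exp i) * x_pow \<alpha>))"

definition H_op :: "'n \<Rightarrow> ('n, 'k::field) operator" where
  "H_op i = partial_op i \<circ> x_op i"

text \<open>The factors commute (see \<open>partial_op_pow_commute\<close> below), so the fold is independent of the order.\<close>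

definition partial_pow :: "('n::finite \<Rightarrow> nat) \<Rightarrow> ('n, 'k::field) operator" where
  "partial_pow \<alpha> = Finite_Set.fold (\<lambda>i f. (partial_op i ^^ \<alpha> i) \<circ> f) id UNIV"

definition End_alg :: "('k::field, ('n, 'k) operator) module" where
  "End_alg =
     \<lparr> carrier = {f. Vector_Spaces.linear scale_poly scale_poly f},
       mult = (\<circ>),
       one = id,
       zero = (\<lambda>_. 0),
       add = (\<lambda>f g p. f p + g p),
       smult = (\<lambda>c f p. scale_poly c (f p)) \<rparr>"

definition int_diff_alg :: "('k::field_char_0, ('n::finite, 'k) operator) module" where
  "int_diff_alg = End_alg
     \<lparr> carrier := generated_subalgebra End_alg (range x_op \<union> range partial_op \<union> range int_op) \<rparr>"

definition p_ideal :: "'n::finite \<Rightarrow> ('n, 'k::field_char_0) operator set" where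
  "p_ideal i = genideal int_diff_alg {\<lambda>p. p - int_op i (partial_op i p)}"

definition a_ideal :: "('n::finite, 'k::field_char_0) operator set" where
  "a_ideal = {\<Oplus>\<^bsub>int_diff_alg\<^esub>i\<in>UNIV. f i | f. \<forall>i. f i \<in> p_ideal i}"

definition Delta :: "('n::finite, 'k::field_char_0) operator set" where
  "Delta = generated_subalgebra int_diff_alg (range H_op \<union> range partial_op)"


section \<open>Well-definedness\<close>

inductive_set den_products :: "('a, 'm) ring_scheme \<Rightarrow> 'a set" for R where
  one: "\<one>\<^bsub>R\<^esub> \<in> den_products R"
| mult: "\<lbrakk>m \<in> den_products R; left_denominator_set R T; T \<subseteq> left_regular R; t \<in> T\<rbrakk>
    \<Longrightarrow> m \<otimes>\<^bsub>R\<^esub> t \<in> den_products R"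

lemma left_ore_setD:
  assumes "left_ore_set R S" "r \<in> carrier R" "s \<in> S"
  shows "\<exists>u\<in>S. \<exists>a\<in>carrier R. u \<otimes>\<^bsub>R\<^esub> r = a \<otimes>\<^bsub>R\<^esub> s"
proof -
  from assms have "(S #>\<^bsub>R\<^esub> r) \<inter> (carrier R #>\<^bsub>R\<^esub> s) \<noteq> {}"
    unfolding left_ore_set_def by blast
  then show ?thesis unfolding r_coset_def by auto
qed

lemma (in ring) den_products_den:
  assumes "\<one> \<noteq> \<zero>"
  shows "left_denominator_set R (den_products R)" "den_products R \<subseteq> left_regular R"
proof -
  show reg: "den_products R \<subseteq> left_regular R"
  proof
    fix x assume "x \<in> den_products R"
    then show "x \<in> left_regular R"
    proof induction
      case one
      show ?case by (simp add: left_regular_def)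
    next
      case (mult m T t)
      then have m: "m \<in> left_regular R" and t: "t \<in> left_regular R" by auto
      then have c: "m \<in> carrier R" "t \<in> carrier R" by (auto simp: left_regular_def)
      have "r = \<zero>" if "r \<in> carrier R" "r \<otimes> (m \<otimes> t) = \<zero>" for r
      proof -
        from that c have "(r \<otimes> m) \<otimes> t = \<zero>" by (simp add: m_assoc)
        with that c t have "r \<otimes> m = \<zero>" by (auto simp: left_regular_def)
        with that m show ?thesis by (auto simp: left_regular_def)
      qed
      with c show ?case by (auto simp: left_regular_def)
    qed
  qed
  have sub: "den_products R \<subseteq> carrier R" using reg by (auto simp: left_regular_def)
  have closed: "x \<otimes> y \<in> den_products R" if x: "x \<in> den_products R" and "y \<in> den_products R" for x y
    using that(2)
  proof induction
    case one
    show ?case using x sub by auto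
  next
    case (mult m T t)
    have "t \<in> carrier R" using mult.hyps by (auto simp: left_regular_def)
    moreover have "x \<in> carrier R" "m \<in> carrier R" using x mult.hyps sub by auto
    ultimately have "x \<otimes> (m \<otimes> t) = (x \<otimes> m) \<otimes> t" by (simp add: m_assoc)
    then show ?case using den_products.mult[OF mult.IH mult.hyps(2-4)] by simp
  qed
  have zero: "\<zero> \<notin> left_regular R" using assms by (auto simp: left_regular_def)
  have ore: "\<exists>u\<in>den_products R. \<exists>a\<in>carrier R. u \<otimes> r = a \<otimes> y"
    if "r \<in> carrier R" "y \<in> den_products R" for r y
    using that(2,1)
  proof (induction arbitrary: r)
    case one
    then show ?case by (intro bexI[of _ \<one>] bexI[of _ r] den_products.one) auto
  next
    case (mult m T t)
    from mult.hyps have "left_ore_set R T" by (simp add: left_denominator_set_def)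
    from left_ore_setD[OF this mult.prems mult.hyps(4)]
    obtain u a where ua: "u \<in> T" "a \<in> carrier R" "u \<otimes> r = a \<otimes> t" by blast
    from mult.IH[OF ua(2)]
    obtain v b where vb: "v \<in> den_products R" "b \<in> carrier R" "v \<otimes> a = b \<otimes> m" by blast
    have c: "u \<in> carrier R" "t \<in> carrier R" "v \<in> carrier R" "m \<in> carrier R"
      using ua(1) vb(1) mult.hyps sub by (auto simp: left_regular_def)
    have "(v \<otimes> u) \<otimes> r = v \<otimes> (a \<otimes> t)" using c mult.prems ua by (simp add: m_assoc)
    also have "\<dots> = (b \<otimes> m) \<otimes> t" using c ua vb by (simp add: m_assoc[symmetric])
    also have "\<dots> = b \<otimes> (m \<otimes> t)" using c vb by (simp add: m_assoc)
    finally show ?case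
      using den_products.mult[OF vb(1) mult.hyps(2,3) ua(1)] vb(2) by blast
  qed
  have "left_ore_set R (den_products R)"
    unfolding left_ore_set_def multiplicative_set_def
  proof (intro conjI ballI)
    fix r s assume "r \<in> carrier R" "s \<in> den_products R"
    from ore[OF this] show "(den_products R #> r) \<inter> (carrier R #> s) \<noteq> {}"
      unfolding r_coset_def by blast
  qed (use sub closed zero reg den_products.one in auto)
  then show "left_denominator_set R (den_products R)"
    unfolding left_denominator_set_def
  proof (intro conjI ballI impI)
    fix r s assume rs: "r \<in> carrier R" "s \<in> den_products R" "r \<otimes> s = \<zero>"
    then have "r = \<zero>" using reg by (auto simp: left_regular_def)
    then show "\<exists>t\<in>den_products R. t \<otimes> r = \<zero>"
      by (intro bexI[of _ \<one>] den_products.one) auto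
  qed
qed

lemma (in ring) left_regular_den_is_largest:
  assumes "\<one> \<noteq> \<zero>"
  shows "left_denominator_set R (left_regular_den R)"
    and "left_regular_den R \<subseteq> left_regular R"
    and "\<lbrakk>left_denominator_set R T; T \<subseteq> left_regular R\<rbrakk> \<Longrightarrow> T \<subseteq> left_regular_den R"
proof -
  have max: "T \<subseteq> den_products R" if T: "left_denominator_set R T" "T \<subseteq> left_regular R" for T
  proof
    fix t assume t: "t \<in> T"
    then have "t \<in> carrier R" using T by (auto simp: left_regular_def)
    then show "t \<in> den_products R" using den_products.mult[OF den_products.one T t] by simp
  qed
  have eq: "left_regular_den R = den_products R"
    unfolding left_regular_den_def
    by (rule Greatest_equality) (use den_products_den[OF assms] max in auto)
  show "left_denominator_set R (left_regular_den R)" "left_regular_den R \<subseteq> left_regular R"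
    using den_products_den[OF assms] by (simp_all add: eq)
  show "T \<subseteq> left_regular_den R" if "left_denominator_set R T" "T \<subseteq> left_regular R"
    using max[OF that] by (simp add: eq)
qed

lemma lookup_scale_poly [simp]:
  "Poly_Mapping.lookup (scale_poly c p) \<alpha> = c * Poly_Mapping.lookup p \<alpha>"
  by (simp add: scale_poly_def Poly_Mapping.map.rep_eq when_def)

lemma lookup_partial_op:
  fixes i :: 'n and p :: "('n, 'k::field) polys"
  shows "Poly_Mapping.lookup (partial_op i p) \<beta> =
     of_nat (Poly_Mapping.lookup \<beta> i + 1) * Poly_Mapping.lookup p (\<beta> + unit_exp i)"
proof -
  have shift: "\<alpha> = \<beta> + unit_exp i"
    if "\<alpha> - unit_exp i = \<beta>" "Poly_Mapping.lookup \<alpha> i \<noteq> 0" for \<alpha> :: "'n \<Rightarrow>\<^sub>0 nat"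
    by (rule poly_mapping_eqI)
      (use that in \<open>auto simp: lookup_add lookup_minus lookup_single when_def\<close>)
  have "Poly_Mapping.lookup (partial_op i p) \<beta> =
      (\<Sum>\<alpha>\<in>Poly_Mapping.keys p. Poly_Mapping.lookup p \<alpha> *
         (of_nat (Poly_Mapping.lookup \<alpha> i) * (if \<alpha> - unit_exp i = \<beta> then 1 else 0)))"
    by (auto simp: partial_op_def linear_ext_def lookup_sum x_pow_def lookup_single when_def intro!: sum.cong)
  also have "\<dots> = (\<Sum>\<alpha>\<in>Poly_Mapping.keys p. if \<alpha> = \<beta> + unit_exp i
      then Poly_Mapping.lookup p \<alpha> * of_nat (Poly_Mapping.lookup \<alpha> i) else 0)"
  proof (rule sum.cong[OF refl])
    fix \<alpha>
    show "Poly_Mapping.lookup p \<alpha> *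
        (of_nat (Poly_Mapping.lookup \<alpha> i) * (if \<alpha> - unit_exp i = \<beta> then 1 else 0)) =
      (if \<alpha> = \<beta> + unit_exp i
        then Poly_Mapping.lookup p \<alpha> * of_nat (Poly_Mapping.lookup \<alpha> i) else 0)"
    proof (cases "Poly_Mapping.lookup \<alpha> i = 0")
      case False
      then have "\<alpha> - unit_exp i = \<beta> \<longleftrightarrow> \<alpha> = \<beta> + unit_exp i"
        using shift by (metis add_diff_cancel_right')
      then show ?thesis by simp
    qed auto
  qed
  also have "\<dots> = of_nat (Poly_Mapping.lookup \<beta> i + 1) * Poly_Mapping.lookup p (\<beta> + unit_exp i)"
    by (auto simp: sum.delta lookup_add in_keys_iff)
  finally show ?thesis .
qed

lemma partial_op_commute: "partial_op i \<circ> partial_op j = partial_op j \<circ> partial_op i"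
  by (intro ext poly_mapping_eqI)
    (auto simp: lookup_partial_op lookup_add lookup_single when_def ac_simps)

lemma partial_op_pow_commute:
  "comp_fun_commute (\<lambda>i f. ((partial_op i :: ('n, 'k::field) operator) ^^ \<alpha> i) \<circ> f)"
proof -
  have "comp_fun_commute (partial_op :: 'n \<Rightarrow> ('n, 'k) operator)"
    by unfold_locales (rule partial_op_commute)
  then have "comp_fun_commute (\<lambda>i. (partial_op i :: ('n, 'k) operator) ^^ \<alpha> i)"
    by (rule comp_fun_commute.comp_fun_commute_funpow)
  then show ?thesis
    by (auto simp: comp_fun_commute_def fun_eq_iff)
qed

interpretation scale_poly: vector_space "scale_poly :: 'k::field \<Rightarrow> ('n, 'k) polys \<Rightarrow> ('n, 'k) polys"
  by unfold_locales (rule poly_mapping_eqI; simp add: lookup_add algebra_simps)+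

lemma linear_scale_poly_iff:
  "Vector_Spaces.linear scale_poly scale_poly f \<longleftrightarrow>
     (\<forall>p q. f (p + q) = f p + f q) \<and> (\<forall>c p. f (scale_poly c p) = scale_poly c (f p))"
  by (auto simp: Vector_Spaces.linear_iff scale_poly.vector_space_axioms)

lemma linear_ext_linear: "Vector_Spaces.linear scale_poly scale_poly (linear_ext g)"
proof -
  have ext: "linear_ext g p = (\<Sum>\<alpha>\<in>A. scale_poly (Poly_Mapping.lookup p \<alpha>) (g \<alpha>))"
    if "finite A" "Poly_Mapping.keys p \<subseteq> A" for p A
    unfolding linear_ext_def using that
    by (intro sum.mono_neutral_left) (auto simp: in_keys_iff)
  have "linear_ext g (p + q) = linear_ext g p + linear_ext g q" for p q
    using ext[of "Poly_Mapping.keys p \<union> Poly_Mapping.keys q" "p + q"]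
      ext[of "Poly_Mapping.keys p \<union> Poly_Mapping.keys q" p]
      ext[of "Poly_Mapping.keys p \<union> Poly_Mapping.keys q" q]
    by (simp add: Poly_Mapping.keys_add lookup_add scale_poly.scale_left_distrib sum.distrib)
  moreover have "linear_ext g (scale_poly c p) = scale_poly c (linear_ext g p)" for c p
    using ext[of "Poly_Mapping.keys p" "scale_poly c p"] ext[of "Poly_Mapping.keys p" p]
    by (simp add: scale_poly.scale_sum_right subset_iff in_keys_iff)
  ultimately show ?thesis by (simp add: linear_scale_poly_iff)
qed

lemma x_op_linear:
  "Vector_Spaces.linear scale_poly scale_poly (x_op i :: ('n, 'k::field) operator)"
  by (auto simp: linear_scale_poly_iff x_op_def scale_poly_def mult_map_scale_conv_mult
      distrib_left mult.left_commute)

lemma End_alg_ring: "ring (End_alg :: ('k::field, ('n, 'k) operator) module)"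
proof (rule ringI)
  show "abelian_group (End_alg :: ('k, ('n, 'k) operator) module)"
  proof (rule abelian_groupI)
    fix f :: "('n, 'k) operator" assume "f \<in> carrier End_alg"
    then show "\<exists>g\<in>carrier End_alg. g \<oplus>\<^bsub>End_alg\<^esub> f = \<zero>\<^bsub>End_alg\<^esub>"
      by (intro bexI[of _ "\<lambda>p. - f p"])
        (auto simp: End_alg_def linear_scale_poly_iff scale_poly.scale_minus_right)
  qed (auto simp: End_alg_def linear_scale_poly_iff scale_poly.scale_right_distrib fun_eq_iff)
  show "monoid (End_alg :: ('k, ('n, 'k) operator) module)"
    by (rule monoidI) (auto simp: End_alg_def linear_scale_poly_iff)
qed (auto simp: End_alg_def linear_scale_poly_iff fun_eq_iff)

lemma int_diff_alg_subring:
  "subring (carrier int_diff_alg) (End_alg :: ('k::field_char_0, ('n::finite, 'k) operator) module)"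
proof -
  interpret E: ring "End_alg :: ('k, ('n, 'k) operator) module" by (rule End_alg_ring)
  let ?X = "range x_op \<union> range partial_op \<union> range int_op :: ('n, 'k) operator set"
  let ?F = "{U. subring U End_alg \<and> (\<forall>c. \<forall>u\<in>U. c \<odot>\<^bsub>End_alg\<^esub> u \<in> U) \<and> ?X \<subseteq> U}"
  have "?X \<subseteq> carrier End_alg"
    by (auto simp: End_alg_def partial_op_def int_op_def linear_ext_linear x_op_linear)
  then have top: "carrier End_alg \<in> ?F"
    using E.carrier_is_subring
    by (auto simp: End_alg_def linear_scale_poly_iff scale_poly.scale_right_distrib mult.commute)
  have "subring (\<Inter> ?F) End_alg"
  proof (rule E.subringI)
    show "\<Inter> ?F \<subseteq> carrier End_alg" using top by (rule Inter_lower)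
    show "\<one>\<^bsub>End_alg\<^esub> \<in> \<Inter> ?F" by (auto intro: subringE(3))
    show "\<ominus>\<^bsub>End_alg\<^esub> h \<in> \<Inter> ?F" if "h \<in> \<Inter> ?F" for h
      using that by (intro InterI) (simp add: subringE(5))
    show "h \<otimes>\<^bsub>End_alg\<^esub> k \<in> \<Inter> ?F" "h \<oplus>\<^bsub>End_alg\<^esub> k \<in> \<Inter> ?F"
      if "h \<in> \<Inter> ?F" "k \<in> \<Inter> ?F" for h k
      using that by (intro InterI; simp add: subringE(6,7))+
  qed
  then show ?thesis by (simp add: int_diff_alg_def generated_subalgebra_def)
qed

lemma int_diff_alg_ring: "ring (int_diff_alg :: ('k::field_char_0, ('n::finite, 'k) operator) module)"
  using ring.subring_is_ring[OF End_alg_ring int_diff_alg_subring]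
  by (simp add: int_diff_alg_def)

end

theory Submission
  imports Defs "HOL-Computational_Algebra.Polynomial"
begin

text \<open>
  Write \<open>T\<close> for the set of all \<open>\<partial>\<^sup>\<alpha>\<close>. It is a left Ore set of left regular elements, hence
  contained in \<open>'S(\<I>\<^sub>n)\<close>, its annihilator \<open>ass\<^sub>l(T)\<close> is \<open>\<aa>\<^sub>n\<close>, and every element of \<open>\<I>\<^sub>n\<close> is
  moved into \<open>\<Delta>\<^sub>n\<close> by left multiplication with some element of \<open>T\<close>. Since \<open>\<Delta>\<^sub>n\<close> is a domain, so
  is \<open>B\<^sub>n\<close>, and \<open>\<Delta>\<^sub>n\<close> meets \<open>\<aa>\<^sub>n\<close> in \<open>0\<close>. Consequently every multiplicative set
  \<open>X \<supseteq> '\<Delta>\<^sub>n\<close> each element of which is moved into \<open>'\<Delta>\<^sub>n\<close> by an element of \<open>T\<close> is a left denominator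
  set with annihilator \<open>\<aa>\<^sub>n\<close>, and all these sets have the same localization. Every set in the theorem
  is of this kind. For \<open>\<Delta>\<^sub>n\<close> with a tilde, closure under products needs that \<open>'S(\<I>\<^sub>n)\<close> contains
  \<open>v\<close> whenever it contains \<open>w\<close> and \<open>v w\<close>; this holds because adjoining \<open>v\<close> preserves the left
  Ore condition.
\<close>

section \<open>Localization at a left denominator set\<close>

text \<open>The set \<open>left_regular_den\<close> is given only as a greatest element, so its
  members have no explicit description. Everything about it must come from maximality, applied to a
  suitable auxiliary denominator set, and from the elements of T that it contains. The abstract part
  therefore works with S only through these two sources, and with B_n only through the complete
  primeness of the annihilator. On the concrete side, \<partial>^\<alpha> is left regular because it
  is surjective on polynomials: each \<partial>_i has the right inverse \<integral>_i. The
  annihilator of T is a_n because \<partial>_i kills 1 - \<integral>_i \<partial>_i from the left,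
  while the identity 1 = (1 - \<integral>_i \<partial>_i) + \<integral>_i \<partial>_i lets
  \<partial>_i be cancelled modulo a_n. That Delta is a domain is read off from its action on
  divided power coefficients: every element is a finite sum of shifts whose coefficients are
  polynomial in each exponent separately, and this normal form replaces the construction of a skew
  polynomial ring.\<close>

text \<open>The scalar laws are those that fractions and cosets call for: \<open>mult_smult\<close>
  lets scalars act on numerators, and \<open>smult_add\<close> lets them act on cosets.\<close>

locale scaled_ring = ring R for R :: "('k, 'a) module" (structure) +
  assumes smult_closed [simp, intro]: "x \<in> carrier R \<Longrightarrow> c \<odot> x \<in> carrier R"
    and mult_smult: "\<lbrakk>a \<in> carrier R; x \<in> carrier R\<rbrakk> \<Longrightarrow> a \<otimes> (c \<odot> x) = c \<odot> (a \<otimes> x)"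
    and smult_add: "\<lbrakk>x \<in> carrier R; y \<in> carrier R\<rbrakk> \<Longrightarrow> c \<odot> (x \<oplus> y) = c \<odot> x \<oplus> c \<odot> y"

locale left_localization = scaled_ring R for R :: "('k, 'a) module" (structure) +
  fixes S :: "'a set"
  assumes den: "left_denominator_set R S"
begin

section \<open>Common multiples and equality of fractions\<close>

lemma S_carrier [simp, dest]: "s \<in> S \<Longrightarrow> s \<in> carrier R"
  and one_S [simp]: "\<one> \<in> S"
  and S_mult [simp]: "\<lbrakk>s \<in> S; t \<in> S\<rbrakk> \<Longrightarrow> s \<otimes> t \<in> S"
  and zero_notin_S: "\<zero> \<notin> S"
  using den unfolding left_denominator_set_def left_ore_set_def multiplicative_set_def by auto

lemma ore:
  assumes "r \<in> carrier R" "s \<in> S"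
  obtains u a where "u \<in> S" "a \<in> carrier R" "u \<otimes> r = a \<otimes> s"
  using left_ore_setD[of R S r s] den assms unfolding left_denominator_set_def by blast

lemma common_multiple:
  assumes "s \<in> S" "t \<in> S"
  obtains p q where "p \<in> carrier R" "q \<in> carrier R" "p \<otimes> s \<in> S" "p \<otimes> s = q \<otimes> t"
  by (metis S_carrier S_mult assms ore)

lemma right_cancel:
  assumes "x \<in> carrier R" "y \<in> carrier R" "s \<in> S" "x \<otimes> s = y \<otimes> s"
  obtains w where "w \<in> S" "w \<otimes> x = w \<otimes> y"
proof -
  have "(x \<ominus> y) \<otimes> s = \<zero>"
    using assms by (simp add: minus_eq l_distr l_minus r_neg)
  then obtain w where w: "w \<in> S" "w \<otimes> (x \<ominus> y) = \<zero>"
    using den assms unfolding left_denominator_set_def by (meson minus_closed)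
  then have "w \<otimes> x \<ominus> w \<otimes> y = \<zero>"
    using assms by (simp add: minus_eq r_distr r_minus)
  then show ?thesis using that w assms by (metis S_carrier m_closed r_right_minus_eq)
qed

lemma frac_relI:
  assumes "s \<in> S" "r \<in> carrier R" "s' \<in> S" "r' \<in> carrier R" "a \<in> carrier R" "b \<in> carrier R"
    "a \<otimes> s = b \<otimes> s'" "a \<otimes> s \<in> S" "a \<otimes> r = b \<otimes> r'"
  shows "((s, r), (s', r')) \<in> frac_rel R S"
  using assms unfolding frac_rel_def by blast

text \<open>
  The witnesses in \<^const>\<open>frac_rel\<close> may be replaced by an arbitrary common multiple of the
  denominators. All well-definedness statements reduce to this fact.
\<close>

lemma frac_relD:
  assumes rel: "((s, r), (s', r')) \<in> frac_rel R S"
    and ab: "a \<in> carrier R" "b \<in> carrier R" "a \<otimes> s = b \<otimes> s'"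
  obtains w where "w \<in> S" "w \<otimes> (a \<otimes> r) = w \<otimes> (b \<otimes> r')"
proof -
  from rel obtain a0 b0 where 0: "s \<in> S" "r \<in> carrier R" "s' \<in> S" "r' \<in> carrier R"
    "a0 \<in> carrier R" "b0 \<in> carrier R" "a0 \<otimes> s = b0 \<otimes> s'" "a0 \<otimes> s \<in> S" "a0 \<otimes> r = b0 \<otimes> r'"
    unfolding frac_rel_def by blast
  \<comment> \<open>The given common multiple is compared with the one in the witness. Cancelling
    \<open>s\<close> and \<open>s'\<close> on the right then costs two left factors
    \<open>t1\<close> and \<open>t2\<close>, which a common left multiple merges into one.\<close>
  obtain v c where vc: "v \<in> S" "c \<in> carrier R" "v \<otimes> (a \<otimes> s) = c \<otimes> (a0 \<otimes> s)"
    using ore[of "a \<otimes> s" "a0 \<otimes> s"] 0 ab by auto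
  have "(v \<otimes> a) \<otimes> s = (c \<otimes> a0) \<otimes> s" using vc 0 ab by (simp add: m_assoc)
  then obtain t1 where t1: "t1 \<in> S" "t1 \<otimes> (v \<otimes> a) = t1 \<otimes> (c \<otimes> a0)"
    using right_cancel[of "v \<otimes> a" "c \<otimes> a0" s] vc 0 ab by auto
  have "(v \<otimes> b) \<otimes> s' = (c \<otimes> b0) \<otimes> s'" using vc 0 ab by (simp add: m_assoc)
  then obtain t2 where t2: "t2 \<in> S" "t2 \<otimes> (v \<otimes> b) = t2 \<otimes> (c \<otimes> b0)"
    using right_cancel[of "v \<otimes> b" "c \<otimes> b0" s'] vc 0 ab by auto
  obtain p q where pq: "p \<in> carrier R" "q \<in> carrier R" "p \<otimes> t1 \<in> S" "p \<otimes> t1 = q \<otimes> t2"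
    using common_multiple t1 t2 by metis
  have "(p \<otimes> t1) \<otimes> v \<otimes> (a \<otimes> r) = p \<otimes> (t1 \<otimes> (v \<otimes> a)) \<otimes> r"
    using pq(1,2) t1(1) vc ab 0(1-6) by (simp add: m_assoc)
  also have "\<dots> = (p \<otimes> t1) \<otimes> c \<otimes> (a0 \<otimes> r)"
    using pq(1,2) t1 vc ab 0(1-6) by (simp add: m_assoc)
  also have "\<dots> = q \<otimes> (t2 \<otimes> (c \<otimes> b0)) \<otimes> r'"
    using pq(1,2) t1(1) t2(1) vc ab 0(1-6) unfolding pq(4) 0(9) by (simp add: m_assoc)
  also have "\<dots> = (p \<otimes> t1) \<otimes> v \<otimes> (b \<otimes> r')"
    using pq(1,2) t1(1) t2(1) vc ab 0(1-6) unfolding pq(4) t2(2)[symmetric] by (simp add: m_assoc)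
  finally show ?thesis using that[of "p \<otimes> t1 \<otimes> v"] pq vc by auto
qed

text \<open>The numerators only have to agree after multiplication by some \<open>w\<close> in S,
  because \<open>w\<close> can be absorbed into both multipliers.\<close>

lemma frac_relI':
  assumes "s \<in> S" "r \<in> carrier R" "s' \<in> S" "r' \<in> carrier R" "a \<in> carrier R" "b \<in> carrier R"
    "a \<otimes> s = b \<otimes> s'" "a \<otimes> s \<in> S" "w \<in> S" "w \<otimes> (a \<otimes> r) = w \<otimes> (b \<otimes> r')"
  shows "((s, r), (s', r')) \<in> frac_rel R S"
proof (rule frac_relI[of _ _ _ _ "w \<otimes> a" "w \<otimes> b"])
  show "w \<otimes> a \<otimes> s = w \<otimes> b \<otimes> s'" "w \<otimes> a \<otimes> r = w \<otimes> b \<otimes> r'"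
    using assms by (simp_all add: m_assoc)
  show "w \<otimes> a \<otimes> s \<in> S" using S_mult[OF assms(9,8)] assms by (simp add: m_assoc)
qed (use assms in auto)

lemma frac_rel_multiple:
  assumes "s \<in> S" "r \<in> carrier R" "v \<in> carrier R" "v \<otimes> s \<in> S"
  shows "((s, r), (v \<otimes> s, v \<otimes> r)) \<in> frac_rel R S"
  by (rule frac_relI[of _ _ _ _ v \<one>]) (use assms in auto)

lemma frac_rel_carrier:
  assumes "((s, r), (s', r')) \<in> frac_rel R S"
  shows "s \<in> S" "r \<in> carrier R" "s' \<in> S" "r' \<in> carrier R"
  using assms unfolding frac_rel_def by auto

text \<open>A common left multiple of \<open>w\<close> and \<open>w'\<close> serves for both
  equalities, since left multiplication preserves each of them.\<close>

lemma common_witness: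
  assumes "w \<in> S" "w' \<in> S" "x \<in> carrier R" "y \<in> carrier R" "x' \<in> carrier R" "y' \<in> carrier R"
    "w \<otimes> x = w \<otimes> y" "w' \<otimes> x' = w' \<otimes> y'"
  obtains v where "v \<in> S" "v \<otimes> x = v \<otimes> y" "v \<otimes> x' = v \<otimes> y'"
proof -
  obtain p q where pq: "p \<in> carrier R" "q \<in> carrier R" "p \<otimes> w \<in> S" "p \<otimes> w = q \<otimes> w'"
    using common_multiple assms by metis
  show ?thesis
  proof (rule that[of "p \<otimes> w"])
    show "p \<otimes> w \<otimes> x = p \<otimes> w \<otimes> y" using pq(1,2) assms by (simp add: m_assoc)
    show "p \<otimes> w \<otimes> x' = p \<otimes> w \<otimes> y'" unfolding pq(4) using pq(1,2) assms by (simp add: m_assoc)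
  qed (fact pq(3))
qed

lemma equiv_frac_rel: "equiv (S \<times> carrier R) (frac_rel R S)"
proof (rule equivI)
  show "frac_rel R S \<subseteq> (S \<times> carrier R) \<times> S \<times> carrier R"
    unfolding frac_rel_def by auto
  show "refl_on (S \<times> carrier R) (frac_rel R S)"
    by (rule refl_onI) (auto intro: frac_relI[of _ _ _ _ \<one> \<one>])
  show "sym (frac_rel R S)"
    unfolding sym_def frac_rel_def by force
  show "trans (frac_rel R S)"
  proof (rule transI, clarify)
    fix s r s' r' s'' r''
    assume rel: "((s, r), (s', r')) \<in> frac_rel R S" "((s', r'), (s'', r'')) \<in> frac_rel R S"
    note c = frac_rel_carrier[OF rel(1)] frac_rel_carrier(3,4)[OF rel(2)]
    \<comment> \<open>Transitivity is tested on one common left multiple of all three denominators,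
      so that both relations speak about the same multiple of the middle fraction.\<close>
    obtain a b where ab: "a \<in> carrier R" "b \<in> carrier R" "a \<otimes> s \<in> S" "a \<otimes> s = b \<otimes> s'"
      using common_multiple c by metis
    obtain p q where pq: "p \<in> carrier R" "q \<in> carrier R" "p \<otimes> (a \<otimes> s) \<in> S" "p \<otimes> (a \<otimes> s) = q \<otimes> s''"
      using common_multiple[OF ab(3) c(5)] by metis
    have e: "(p \<otimes> a) \<otimes> s = (p \<otimes> b) \<otimes> s'" using ab pq(1,2) c by (simp add: m_assoc)
    have e': "(p \<otimes> b) \<otimes> s' = q \<otimes> s''" using ab pq c by (simp add: m_assoc)
    obtain w where w: "w \<in> S" "w \<otimes> ((p \<otimes> a) \<otimes> r) = w \<otimes> ((p \<otimes> b) \<otimes> r')"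
      using frac_relD[OF rel(1) _ _ e] ab pq by auto
    obtain w' where w': "w' \<in> S" "w' \<otimes> ((p \<otimes> b) \<otimes> r') = w' \<otimes> (q \<otimes> r'')"
      using frac_relD[OF rel(2) _ _ e'] ab pq by auto
    obtain v where v: "v \<in> S" "v \<otimes> ((p \<otimes> a) \<otimes> r) = v \<otimes> ((p \<otimes> b) \<otimes> r')"
      "v \<otimes> ((p \<otimes> b) \<otimes> r') = v \<otimes> (q \<otimes> r'')"
      by (rule common_witness[OF w(1) w'(1) _ _ _ _ w(2) w'(2)]) (use ab pq c in auto)
    show "((s, r), (s'', r'')) \<in> frac_rel R S"
      by (rule frac_relI'[of _ _ _ _ "p \<otimes> a" q v]) (use ab pq c v in \<open>simp_all add: m_assoc\<close>)
  qed
qed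

section \<open>Arithmetic of fractions\<close>

lemma frac_eq_iff:
  assumes "s \<in> S" "r \<in> carrier R" "s' \<in> S" "r' \<in> carrier R"
  shows "frac R S s r = frac R S s' r' \<longleftrightarrow> ((s, r), (s', r')) \<in> frac_rel R S"
  unfolding frac_def using eq_equiv_class_iff[OF equiv_frac_rel] assms by auto

lemma frac_in_carrier [simp]:
  "\<lbrakk>s \<in> S; r \<in> carrier R\<rbrakk> \<Longrightarrow> frac R S s r \<in> carrier (localization R S)"
  unfolding localization_def frac_def by (simp add: quotientI)

lemma localization_cases:
  assumes "X \<in> carrier (localization R S)"
  obtains s r where "s \<in> S" "r \<in> carrier R" "X = frac R S s r"
  using assms unfolding localization_def frac_def by (auto elim!: quotientE)

lemma mem_frac_iff: "(s', r') \<in> frac R S s r \<longleftrightarrow> ((s, r), (s', r')) \<in> frac_rel R S"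
  by (simp add: frac_def)

lemma frac_rel_refl: "\<lbrakk>s \<in> S; r \<in> carrier R\<rbrakk> \<Longrightarrow> ((s, r), (s, r)) \<in> frac_rel R S"
  by (rule frac_relI[of _ _ _ _ \<one> \<one>]) auto

lemma mult_well_defined:
  assumes rel: "((s, r), (s1, r1)) \<in> frac_rel R S" "((t, q), (t1, q1)) \<in> frac_rel R S"
    and ua: "u \<in> S" "a \<in> carrier R" "u \<otimes> r = a \<otimes> t"
    and ua1: "u1 \<in> S" "a1 \<in> carrier R" "u1 \<otimes> r1 = a1 \<otimes> t1"
  shows "frac R S (u \<otimes> s) (a \<otimes> q) = frac R S (u1 \<otimes> s1) (a1 \<otimes> q1)"
proof -
  note c = frac_rel_carrier[OF rel(1)] frac_rel_carrier[OF rel(2)]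
  obtain p d where pd: "p \<in> carrier R" "d \<in> carrier R" "p \<otimes> (u \<otimes> s) \<in> S"
    "p \<otimes> (u \<otimes> s) = d \<otimes> (u1 \<otimes> s1)"
    using common_multiple[of "u \<otimes> s" "u1 \<otimes> s1"] c ua ua1 by (metis S_mult)
  have "(p \<otimes> u) \<otimes> s = (d \<otimes> u1) \<otimes> s1" using pd c ua ua1 by (simp add: m_assoc)
  then obtain w where w: "w \<in> S" "w \<otimes> ((p \<otimes> u) \<otimes> r) = w \<otimes> ((d \<otimes> u1) \<otimes> r1)"
    using frac_relD[OF rel(1)] pd ua ua1 by (metis S_carrier m_closed)
  \<comment> \<open>Because of \<open>u \<otimes> r = a \<otimes> t\<close> and its counterpart, the
    equality of numerators just obtained is a common multiple of \<open>t\<close> and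
    \<open>t1\<close>, and the second relation can be tested on it.\<close>
  have "(w \<otimes> p \<otimes> a) \<otimes> t = (w \<otimes> d \<otimes> a1) \<otimes> t1"
    using w pd(1,2) c ua ua1 by (simp add: m_assoc)
  then obtain w' where w': "w' \<in> S" "w' \<otimes> ((w \<otimes> p \<otimes> a) \<otimes> q) = w' \<otimes> ((w \<otimes> d \<otimes> a1) \<otimes> q1)"
    using frac_relD[OF rel(2)] pd ua ua1 w by (metis S_carrier m_closed)
  have "((u \<otimes> s, a \<otimes> q), (u1 \<otimes> s1, a1 \<otimes> q1)) \<in> frac_rel R S"
    by (rule frac_relI'[of _ _ _ _ p d "w' \<otimes> w"])
      (use pd c ua ua1 w' w in \<open>simp_all add: m_assoc\<close>)
  then show ?thesis using c ua ua1 by (simp add: frac_eq_iff)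
qed

lemma mult_frac:
  assumes "s \<in> S" "r \<in> carrier R" "t \<in> S" "q \<in> carrier R" "u \<in> S" "a \<in> carrier R" "u \<otimes> r = a \<otimes> t"
  shows "frac R S s r \<otimes>\<^bsub>localization R S\<^esub> frac R S t q = frac R S (u \<otimes> s) (a \<otimes> q)"
proof -
  have "{frac R S (u1 \<otimes> s1) (a1 \<otimes> q1) | s1 r1 t1 q1 u1 a1.
      (s1, r1) \<in> frac R S s r \<and> (t1, q1) \<in> frac R S t q \<and> u1 \<in> S \<and> a1 \<in> carrier R \<and>
      u1 \<otimes> r1 = a1 \<otimes> t1} = {frac R S (u \<otimes> s) (a \<otimes> q)}" (is "?L = _")
  proof (intro equalityI subsetI)
    fix X assume "X \<in> ?L"
    then show "X \<in> {frac R S (u \<otimes> s) (a \<otimes> q)}"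
      using mult_well_defined[OF _ _ assms(5-7)] unfolding mem_frac_iff by blast
  next
    fix X assume "X \<in> {frac R S (u \<otimes> s) (a \<otimes> q)}"
    then show "X \<in> ?L" using assms frac_rel_refl unfolding mem_frac_iff by blast
  qed
  then show ?thesis unfolding localization_def by simp
qed

lemma add_well_defined:
  assumes rel: "((s, r), (s1, r1)) \<in> frac_rel R S" "((t, q), (t1, q1)) \<in> frac_rel R S"
    and ab: "a \<in> carrier R" "b \<in> carrier R" "a \<otimes> s = b \<otimes> t" "a \<otimes> s \<in> S"
    and ab1: "a1 \<in> carrier R" "b1 \<in> carrier R" "a1 \<otimes> s1 = b1 \<otimes> t1" "a1 \<otimes> s1 \<in> S"
  shows "frac R S (a \<otimes> s) (a \<otimes> r \<oplus> b \<otimes> q) = frac R S (a1 \<otimes> s1) (a1 \<otimes> r1 \<oplus> b1 \<otimes> q1)"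
proof -
  note c = frac_rel_carrier[OF rel(1)] frac_rel_carrier[OF rel(2)]
  obtain p d where pd: "p \<in> carrier R" "d \<in> carrier R" "p \<otimes> (a \<otimes> s) \<in> S"
    "p \<otimes> (a \<otimes> s) = d \<otimes> (a1 \<otimes> s1)"
    using common_multiple[of "a \<otimes> s" "a1 \<otimes> s1"] ab ab1 by metis
  have "(p \<otimes> a) \<otimes> s = (d \<otimes> a1) \<otimes> s1" using pd c ab(1,2) ab1(1,2) by (simp add: m_assoc)
  then obtain w where w: "w \<in> S" "w \<otimes> ((p \<otimes> a) \<otimes> r) = w \<otimes> ((d \<otimes> a1) \<otimes> r1)"
    using frac_relD[OF rel(1)] pd ab ab1 by (metis m_closed)
  \<comment> \<open>Since \<open>a \<otimes> s = b \<otimes> t\<close>, the pair \<open>p\<close>,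
    \<open>d\<close> chosen for the first summand also equalizes the denominators of the
    second.\<close>
  have "p \<otimes> (b \<otimes> t) = d \<otimes> (b1 \<otimes> t1)" using pd(4) ab(3) ab1(3) by simp
  then have "(p \<otimes> b) \<otimes> t = (d \<otimes> b1) \<otimes> t1"
    using pd(1,2) c ab(1,2) ab1(1,2) by (simp add: m_assoc)
  then obtain w' where w': "w' \<in> S" "w' \<otimes> ((p \<otimes> b) \<otimes> q) = w' \<otimes> ((d \<otimes> b1) \<otimes> q1)"
    using frac_relD[OF rel(2)] pd ab ab1 by (metis m_closed)
  obtain v where v: "v \<in> S" "v \<otimes> ((p \<otimes> a) \<otimes> r) = v \<otimes> ((d \<otimes> a1) \<otimes> r1)"
    "v \<otimes> ((p \<otimes> b) \<otimes> q) = v \<otimes> ((d \<otimes> b1) \<otimes> q1)"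
    by (rule common_witness[OF w(1) w'(1) _ _ _ _ w(2) w'(2)]) (use ab ab1 pd c in auto)
  have "((a \<otimes> s, a \<otimes> r \<oplus> b \<otimes> q), (a1 \<otimes> s1, a1 \<otimes> r1 \<oplus> b1 \<otimes> q1)) \<in> frac_rel R S"
    by (rule frac_relI'[of _ _ _ _ p d v])
      (use pd c ab(1,2,4) ab1(1,2,4) v in \<open>simp_all add: m_assoc r_distr\<close>)
  then show ?thesis using c ab(1,2,4) ab1(1,2,4) by (simp add: frac_eq_iff)
qed

lemma add_frac:
  assumes "s \<in> S" "r \<in> carrier R" "t \<in> S" "q \<in> carrier R" "a \<in> carrier R" "b \<in> carrier R"
    "a \<otimes> s = b \<otimes> t" "a \<otimes> s \<in> S"
  shows "frac R S s r \<oplus>\<^bsub>localization R S\<^esub> frac R S t q = frac R S (a \<otimes> s) (a \<otimes> r \<oplus> b \<otimes> q)"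
proof -
  have "{frac R S (a1 \<otimes> s1) (a1 \<otimes> r1 \<oplus> b1 \<otimes> q1) | s1 r1 t1 q1 a1 b1.
      (s1, r1) \<in> frac R S s r \<and> (t1, q1) \<in> frac R S t q \<and> a1 \<in> carrier R \<and> b1 \<in> carrier R \<and>
      a1 \<otimes> s1 = b1 \<otimes> t1 \<and> a1 \<otimes> s1 \<in> S} = {frac R S (a \<otimes> s) (a \<otimes> r \<oplus> b \<otimes> q)}" (is "?L = _")
  proof (intro equalityI subsetI)
    fix X assume "X \<in> ?L"
    then show "X \<in> {frac R S (a \<otimes> s) (a \<otimes> r \<oplus> b \<otimes> q)}"
      using add_well_defined[OF _ _ assms(5-8)] unfolding mem_frac_iff by blast
  next
    fix X assume "X \<in> {frac R S (a \<otimes> s) (a \<otimes> r \<oplus> b \<otimes> q)}"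
    then show "X \<in> ?L" using assms frac_rel_refl unfolding mem_frac_iff by blast
  qed
  then show ?thesis unfolding localization_def by simp
qed

lemma smult_well_defined:
  assumes "((s, r), (s1, r1)) \<in> frac_rel R S"
  shows "frac R S s (c \<odot> r) = frac R S s1 (c \<odot> r1)"
proof -
  note c = frac_rel_carrier[OF assms]
  obtain a b where ab: "a \<in> carrier R" "b \<in> carrier R" "a \<otimes> s = b \<otimes> s1" "a \<otimes> s \<in> S" "a \<otimes> r = b \<otimes> r1"
    using assms unfolding frac_rel_def by blast
  have "((s, c \<odot> r), (s1, c \<odot> r1)) \<in> frac_rel R S"
    by (rule frac_relI[of _ _ _ _ a b]) (use c ab in \<open>simp_all add: mult_smult\<close>)
  then show ?thesis using c by (simp add: frac_eq_iff)
qed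

lemma smult_frac:
  assumes "s \<in> S" "r \<in> carrier R"
  shows "c \<odot>\<^bsub>localization R S\<^esub> frac R S s r = frac R S s (c \<odot> r)"
proof -
  have "{frac R S s1 (c \<odot> r1) | s1 r1. (s1, r1) \<in> frac R S s r} = {frac R S s (c \<odot> r)}" (is "?L = _")
  proof (intro equalityI subsetI)
    fix X assume "X \<in> ?L"
    then show "X \<in> {frac R S s (c \<odot> r)}"
      using smult_well_defined unfolding mem_frac_iff by blast
  next
    fix X assume "X \<in> {frac R S s (c \<odot> r)}"
    then show "X \<in> ?L" using assms frac_rel_refl unfolding mem_frac_iff by blast
  qed
  then show ?thesis unfolding localization_def by simp
qed

lemma localization_closed:
  assumes "X \<in> carrier (localization R S)" "Y \<in> carrier (localization R S)"
  shows "X \<otimes>\<^bsub>localization R S\<^esub> Y \<in> carrier (localization R S)"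
    and "X \<oplus>\<^bsub>localization R S\<^esub> Y \<in> carrier (localization R S)"
    and "c \<odot>\<^bsub>localization R S\<^esub> X \<in> carrier (localization R S)"
proof -
  from assms obtain s r t q where *: "s \<in> S" "r \<in> carrier R" "X = frac R S s r"
    "t \<in> S" "q \<in> carrier R" "Y = frac R S t q" by (metis localization_cases)
  obtain u a where ua: "u \<in> S" "a \<in> carrier R" "u \<otimes> r = a \<otimes> t" using ore * by metis
  show "X \<otimes>\<^bsub>localization R S\<^esub> Y \<in> carrier (localization R S)"
    using * ua mult_frac[of s r t q u a] by simp
  obtain a b where ab: "a \<in> carrier R" "b \<in> carrier R" "a \<otimes> s \<in> S" "a \<otimes> s = b \<otimes> t"
    using common_multiple * by metis
  show "X \<oplus>\<^bsub>localization R S\<^esub> Y \<in> carrier (localization R S)"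
    using * ab(1-3) add_frac[of s r t q a b, OF _ _ _ _ _ _ ab(4)] by simp
  show "c \<odot>\<^bsub>localization R S\<^esub> X \<in> carrier (localization R S)"
    using * by (simp add: smult_frac)
qed

lemma one_localization: "\<one>\<^bsub>localization R S\<^esub> = frac R S \<one> \<one>"
  by (simp add: localization_def)

text \<open>Inverting an isomorphism relies only on closure of its source under the operations, so
  the ring axioms of a localization do not enter.\<close>

lemma algebra_iso_localization_sym:
  assumes "localization R S \<simeq>\<^sub>K A"
  shows "A \<simeq>\<^sub>K localization R S"
proof -
  let ?L = "localization R S"
  from assms obtain f where f: "f \<in> ring_hom ?L A" "bij_betw f (carrier ?L) (carrier A)"
    and sm: "\<And>c x. x \<in> carrier ?L \<Longrightarrow> f (c \<odot>\<^bsub>?L\<^esub> x) = c \<odot>\<^bsub>A\<^esub> f x"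
    unfolding algebra_iso_def ring_iso_def by blast
  define g where "g = inv_into (carrier ?L) f"
  have g: "g y \<in> carrier ?L" "f (g y) = y" if "y \<in> carrier A" for y
    using that f(2) by (auto simp: g_def bij_betw_def inv_into_into f_inv_into_f)
  have gf: "g (f x) = x" if "x \<in> carrier ?L" for x
    using that f(2) by (simp add: g_def bij_betw_def)
  have "g \<in> ring_hom A ?L"
  proof (rule ring_hom_memI)
    fix x y assume xy: "x \<in> carrier A" "y \<in> carrier A"
    have "f (g x \<otimes>\<^bsub>?L\<^esub> g y) = x \<otimes>\<^bsub>A\<^esub> y" "f (g x \<oplus>\<^bsub>?L\<^esub> g y) = x \<oplus>\<^bsub>A\<^esub> y"
      using f(1) g xy by (simp_all add: ring_hom_mult ring_hom_add)
    then show "g (x \<otimes>\<^bsub>A\<^esub> y) = g x \<otimes>\<^bsub>?L\<^esub> g y" "g (x \<oplus>\<^bsub>A\<^esub> y) = g x \<oplus>\<^bsub>?L\<^esub> g y"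
      using gf g xy localization_closed by metis+
  next
    have "\<one>\<^bsub>?L\<^esub> \<in> carrier ?L" by (simp add: one_localization)
    then show "g \<one>\<^bsub>A\<^esub> = \<one>\<^bsub>?L\<^esub>" using gf f(1) by (metis ring_hom_one)
  qed (use g in auto)
  moreover have "bij_betw g (carrier A) (carrier ?L)"
    unfolding g_def by (rule bij_betw_inv_into[OF f(2)])
  moreover have "g (c \<odot>\<^bsub>A\<^esub> x) = c \<odot>\<^bsub>?L\<^esub> g x" if "x \<in> carrier A" for c x
    using gf sm g that localization_closed(3) by metis
  ultimately show ?thesis unfolding algebra_iso_def ring_iso_def by blast
qed

end

section \<open>Isomorphisms between localizations\<close>

lemma algebra_iso_trans:
  assumes "A \<simeq>\<^sub>K B" "B \<simeq>\<^sub>K C"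
  shows "A \<simeq>\<^sub>K C"
proof -
  from assms obtain f g where f: "f \<in> ring_iso A B" "\<forall>c. \<forall>x\<in>carrier A. f (c \<odot>\<^bsub>A\<^esub> x) = c \<odot>\<^bsub>B\<^esub> f x"
    and g: "g \<in> ring_iso B C" "\<forall>c. \<forall>x\<in>carrier B. g (c \<odot>\<^bsub>B\<^esub> x) = c \<odot>\<^bsub>C\<^esub> g x"
    unfolding algebra_iso_def by blast
  have "\<forall>x\<in>carrier A. f x \<in> carrier B" using f(1) by (auto simp: ring_iso_def ring_hom_def)
  with f g show ?thesis
    unfolding algebra_iso_def by (intro bexI[of _ "g \<circ> f"] ring_iso_set_trans) auto
qed

text \<open>The single source of isomorphisms here, applied to an identity map, a quotient map and
  an inclusion. Reflecting annihilators makes the induced map on fractions injective; expanding each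
  fraction by some \<open>v\<close> into the image of \<open>\<phi>\<close> makes it
  surjective.\<close>

lemma localization_iso:
  fixes R :: "('k, 'a) module" and R' :: "('k, 'b) module"
  assumes "left_localization R S" "left_localization R' S'"
    and \<phi>: "\<phi> \<in> ring_hom R R'"
    and \<phi>_smult: "\<And>c x. x \<in> carrier R \<Longrightarrow> \<phi> (c \<odot>\<^bsub>R\<^esub> x) = c \<odot>\<^bsub>R'\<^esub> \<phi> x"
    and \<phi>_S: "\<And>s. s \<in> S \<Longrightarrow> \<phi> s \<in> S'"
    and \<phi>_ass: "\<And>r. \<lbrakk>r \<in> carrier R; \<phi> r \<in> ass_l R' S'\<rbrakk> \<Longrightarrow> r \<in> ass_l R S"
    and surj: "\<And>s' r'. \<lbrakk>s' \<in> S'; r' \<in> carrier R'\<rbrakk> \<Longrightarrow>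
      \<exists>v\<in>carrier R'. \<exists>s\<in>S. \<exists>r\<in>carrier R. v \<otimes>\<^bsub>R'\<^esub> s' = \<phi> s \<and> v \<otimes>\<^bsub>R'\<^esub> r' = \<phi> r"
  shows "localization R S \<simeq>\<^sub>K localization R' S'"
proof -
  interpret L: left_localization R S by fact
  interpret L': left_localization R' S' by fact
  interpret h: ring_hom_ring R R' \<phi>
    by (rule ring_hom_ringI2) (use L.ring_axioms L'.ring_axioms \<phi> in auto)
  have rel: "((s, r), (s', r')) \<in> frac_rel R S \<longleftrightarrow> ((\<phi> s, \<phi> r), (\<phi> s', \<phi> r')) \<in> frac_rel R' S'"
    if c: "s \<in> S" "r \<in> carrier R" "s' \<in> S" "r' \<in> carrier R" for s r s' r'
  proof
    assume "((s, r), (s', r')) \<in> frac_rel R S"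
    then obtain a b where ab: "a \<in> carrier R" "b \<in> carrier R" "a \<otimes>\<^bsub>R\<^esub> s = b \<otimes>\<^bsub>R\<^esub> s'" "a \<otimes>\<^bsub>R\<^esub> s \<in> S"
      "a \<otimes>\<^bsub>R\<^esub> r = b \<otimes>\<^bsub>R\<^esub> r'" unfolding frac_rel_def by blast
    show "((\<phi> s, \<phi> r), (\<phi> s', \<phi> r')) \<in> frac_rel R' S'"
      by (rule L'.frac_relI[of _ _ _ _ "\<phi> a" "\<phi> b"])
        (use ab(1,2) c \<phi>_S[OF ab(4)] in \<open>auto simp: \<phi>_S ab(3,5) h.hom_mult[symmetric] simp del: h.hom_mult\<close>)
  next
    assume rel: "((\<phi> s, \<phi> r), (\<phi> s', \<phi> r')) \<in> frac_rel R' S'"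
    obtain a b where ab: "a \<in> carrier R" "b \<in> carrier R" "a \<otimes>\<^bsub>R\<^esub> s \<in> S" "a \<otimes>\<^bsub>R\<^esub> s = b \<otimes>\<^bsub>R\<^esub> s'"
      using L.common_multiple c by metis
    have "\<phi> a \<otimes>\<^bsub>R'\<^esub> \<phi> s = \<phi> b \<otimes>\<^bsub>R'\<^esub> \<phi> s'"
      using arg_cong[OF ab(4), of \<phi>] ab(1,2) c by simp
    then obtain w where w: "w \<in> S'" "w \<otimes>\<^bsub>R'\<^esub> (\<phi> a \<otimes>\<^bsub>R'\<^esub> \<phi> r) = w \<otimes>\<^bsub>R'\<^esub> (\<phi> b \<otimes>\<^bsub>R'\<^esub> \<phi> r')"
      using L'.frac_relD[OF rel] ab by (metis h.hom_closed)
    \<comment> \<open>Equality of the image numerators up to \<open>w\<close> says that their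
      difference lies in the annihilator of \<open>S'\<close>. This can be pulled back along
      \<open>\<phi>\<close>.\<close>
    let ?x = "a \<otimes>\<^bsub>R\<^esub> r \<ominus>\<^bsub>R\<^esub> b \<otimes>\<^bsub>R\<^esub> r'"
    have "w \<otimes>\<^bsub>R'\<^esub> \<phi> ?x = \<zero>\<^bsub>R'\<^esub>"
      using w ab(1,2) c
      by (simp add: L.minus_eq L'.r_distr L'.r_minus L'.r_neg)
    then have "\<phi> ?x \<in> ass_l R' S'" using w ab(1,2) c unfolding ass_l_def by auto
    then have "?x \<in> ass_l R S" using \<phi>_ass ab(1,2) c by auto
    then obtain v where v: "v \<in> S" "v \<otimes>\<^bsub>R\<^esub> ?x = \<zero>\<^bsub>R\<^esub>" unfolding ass_l_def by auto
    then have "v \<otimes>\<^bsub>R\<^esub> (a \<otimes>\<^bsub>R\<^esub> r) \<ominus>\<^bsub>R\<^esub> v \<otimes>\<^bsub>R\<^esub> (b \<otimes>\<^bsub>R\<^esub> r') = \<zero>\<^bsub>R\<^esub>"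
      using ab(1,2) c by (simp add: L.minus_eq L.r_distr L.r_minus)
    then have "v \<otimes>\<^bsub>R\<^esub> (a \<otimes>\<^bsub>R\<^esub> r) = v \<otimes>\<^bsub>R\<^esub> (b \<otimes>\<^bsub>R\<^esub> r')"
      using v ab(1,2) c by (metis L.S_carrier L.m_closed L.r_right_minus_eq)
    then show "((s, r), (s', r')) \<in> frac_rel R S"
      using L.frac_relI'[OF c ab(1,2,4,3) v(1)] by blast
  qed
  \<comment> \<open>A union over all representatives avoids choosing one; by the equivalence just
    shown all of them contribute the same class.\<close>
  define f where "f X = (\<Union>(s, r)\<in>X. frac R' S' (\<phi> s) (\<phi> r))" for X
  have f_frac: "f (frac R S s r) = frac R' S' (\<phi> s) (\<phi> r)" if "s \<in> S" "r \<in> carrier R" for s r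
  proof -
    have "frac R' S' (\<phi> s1) (\<phi> r1) = frac R' S' (\<phi> s) (\<phi> r)" if r1: "(s1, r1) \<in> frac R S s r" for s1 r1
    proof -
      note r1 = r1[unfolded L.mem_frac_iff]
      have "((\<phi> s, \<phi> r), (\<phi> s1, \<phi> r1)) \<in> frac_rel R' S'"
        using r1 rel L.frac_rel_carrier[OF r1] by blast
      then show ?thesis
        using L.frac_rel_carrier[OF r1] \<phi>_S
        by (intro L'.frac_eq_iff[THEN iffD2, symmetric]) simp_all
    qed
    moreover have "(s, r) \<in> frac R S s r" using that L.frac_rel_refl by (simp add: L.mem_frac_iff)
    ultimately show ?thesis unfolding f_def by blast
  qed
  have hom: "f \<in> ring_hom (localization R S) (localization R' S')"
  proof (rule ring_hom_memI)
    fix X assume "X \<in> carrier (localization R S)"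
    then show "f X \<in> carrier (localization R' S')"
      by (rule L.localization_cases) (simp add: f_frac \<phi>_S)
  next
    fix X Y assume "X \<in> carrier (localization R S)" "Y \<in> carrier (localization R S)"
    then obtain s r t q where *: "s \<in> S" "r \<in> carrier R" "X = frac R S s r"
      "t \<in> S" "q \<in> carrier R" "Y = frac R S t q" by (metis L.localization_cases)
    obtain u a where ua: "u \<in> S" "a \<in> carrier R" "u \<otimes>\<^bsub>R\<^esub> r = a \<otimes>\<^bsub>R\<^esub> t" using L.ore * by metis
    have "\<phi> u \<otimes>\<^bsub>R'\<^esub> \<phi> r = \<phi> a \<otimes>\<^bsub>R'\<^esub> \<phi> t" using arg_cong[OF ua(3), of \<phi>] ua(1,2) * by simp
    then show "f (X \<otimes>\<^bsub>localization R S\<^esub> Y) = f X \<otimes>\<^bsub>localization R' S'\<^esub> f Y"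
      using * ua by (simp add: f_frac \<phi>_S L.mult_frac[of s r t q u a]
        L'.mult_frac[of "\<phi> s" "\<phi> r" "\<phi> t" "\<phi> q" "\<phi> u" "\<phi> a"])
    obtain a b where ab: "a \<in> carrier R" "b \<in> carrier R" "a \<otimes>\<^bsub>R\<^esub> s \<in> S" "a \<otimes>\<^bsub>R\<^esub> s = b \<otimes>\<^bsub>R\<^esub> t"
      using L.common_multiple * by metis
    have "\<phi> a \<otimes>\<^bsub>R'\<^esub> \<phi> s = \<phi> b \<otimes>\<^bsub>R'\<^esub> \<phi> t" using arg_cong[OF ab(4), of \<phi>] ab(1,2) * by simp
    moreover have "\<phi> a \<otimes>\<^bsub>R'\<^esub> \<phi> s \<in> S'" using \<phi>_S[OF ab(3)] ab(1,2) * by simp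
    ultimately show "f (X \<oplus>\<^bsub>localization R S\<^esub> Y) = f X \<oplus>\<^bsub>localization R' S'\<^esub> f Y"
      using * ab(1-3) L.add_frac[of s r t q a b, OF _ _ _ _ _ _ ab(4)]
      by (simp add: f_frac \<phi>_S L'.add_frac[of "\<phi> s" "\<phi> r" "\<phi> t" "\<phi> q" "\<phi> a" "\<phi> b"])
  next
    show "f \<one>\<^bsub>localization R S\<^esub> = \<one>\<^bsub>localization R' S'\<^esub>"
      by (simp add: L.one_localization L'.one_localization f_frac)
  qed
  have "inj_on f (carrier (localization R S))"
  proof (rule inj_onI)
    fix X Y assume "X \<in> carrier (localization R S)" "Y \<in> carrier (localization R S)" and e: "f X = f Y"
    then obtain s r t q where *: "s \<in> S" "r \<in> carrier R" "X = frac R S s r"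
      "t \<in> S" "q \<in> carrier R" "Y = frac R S t q" by (metis L.localization_cases)
    with e show "X = Y" by (simp add: f_frac L.frac_eq_iff L'.frac_eq_iff \<phi>_S rel)
  qed
  moreover have "f ` carrier (localization R S) = carrier (localization R' S')"
  proof (intro equalityI subsetI)
    fix X assume "X \<in> carrier (localization R' S')"
    then obtain s' r' where X: "s' \<in> S'" "r' \<in> carrier R'" "X = frac R' S' s' r'"
      by (metis L'.localization_cases)
    then obtain v s r where v: "v \<in> carrier R'" "s \<in> S" "r \<in> carrier R"
      "v \<otimes>\<^bsub>R'\<^esub> s' = \<phi> s" "v \<otimes>\<^bsub>R'\<^esub> r' = \<phi> r" using surj by meson
    have "X = f (frac R S s r)"
      using L'.frac_rel_multiple[OF X(1,2) v(1)] v X by (simp add: f_frac L'.frac_eq_iff \<phi>_S)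
    then show "X \<in> f ` carrier (localization R S)" using v by simp
  qed (use hom in \<open>auto simp: ring_hom_def\<close>)
  ultimately have "f \<in> ring_iso (localization R S) (localization R' S')"
    using hom by (simp add: ring_iso_def bij_betw_def)
  moreover have "f (c \<odot>\<^bsub>localization R S\<^esub> X) = c \<odot>\<^bsub>localization R' S'\<^esub> f X"
    if "X \<in> carrier (localization R S)" for c X
    using that by (rule L.localization_cases)
      (simp add: L.smult_frac L'.smult_frac f_frac \<phi>_S \<phi>_smult)
  ultimately show ?thesis unfolding algebra_iso_def by blast
qed

section \<open>Annihilator ideals, generated subalgebras and factor algebras\<close>

lemma left_denominator_setI:
  assumes "X \<subseteq> carrier R" "\<one>\<^bsub>R\<^esub> \<in> X" "\<And>x y. \<lbrakk>x \<in> X; y \<in> X\<rbrakk> \<Longrightarrow> x \<otimes>\<^bsub>R\<^esub> y \<in> X" "\<zero>\<^bsub>R\<^esub> \<notin> X"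
    and "\<And>r x. \<lbrakk>r \<in> carrier R; x \<in> X\<rbrakk> \<Longrightarrow> \<exists>u\<in>X. \<exists>a\<in>carrier R. u \<otimes>\<^bsub>R\<^esub> r = a \<otimes>\<^bsub>R\<^esub> x"
    and "\<And>r x. \<lbrakk>r \<in> carrier R; x \<in> X; r \<otimes>\<^bsub>R\<^esub> x = \<zero>\<^bsub>R\<^esub>\<rbrakk> \<Longrightarrow> \<exists>t\<in>X. t \<otimes>\<^bsub>R\<^esub> r = \<zero>\<^bsub>R\<^esub>"
  shows "left_denominator_set R X"
  unfolding left_denominator_set_def left_ore_set_def multiplicative_set_def
proof (intro conjI ballI impI)
  fix r x assume "r \<in> carrier R" "x \<in> X"
  with assms(5) obtain u a where "u \<in> X" "a \<in> carrier R" "u \<otimes>\<^bsub>R\<^esub> r = a \<otimes>\<^bsub>R\<^esub> x" by blast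
  then have "u \<otimes>\<^bsub>R\<^esub> r \<in> (X #>\<^bsub>R\<^esub> r) \<inter> (carrier R #>\<^bsub>R\<^esub> x)"
    unfolding r_coset_def by blast
  then show "(X #>\<^bsub>R\<^esub> r) \<inter> (carrier R #>\<^bsub>R\<^esub> x) \<noteq> {}" by blast
qed (use assms in auto)

lemma set_add_iff: "x \<in> A <+>\<^bsub>R\<^esub> B \<longleftrightarrow> (\<exists>a\<in>A. \<exists>b\<in>B. x = a \<oplus>\<^bsub>R\<^esub> b)"
  by (auto simp: set_add_def set_mult_def)

lemma (in ring) left_regular_mult:
  assumes "x \<in> left_regular R" "y \<in> left_regular R"
  shows "x \<otimes> y \<in> left_regular R"
proof -
  have c: "x \<in> carrier R" "y \<in> carrier R" using assms by (auto simp: left_regular_def)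
  have "r = \<zero>" if "r \<in> carrier R" "r \<otimes> (x \<otimes> y) = \<zero>" for r
  proof -
    have "(r \<otimes> x) \<otimes> y = \<zero>" using that c by (simp add: m_assoc)
    then have "r \<otimes> x = \<zero>" using assms that c unfolding left_regular_def by blast
    then show ?thesis using assms that unfolding left_regular_def by blast
  qed
  then show ?thesis using c unfolding left_regular_def by blast
qed

text \<open>Left multiples stay inside by the Ore condition: if \<open>s\<close> kills
  \<open>a\<close> and \<open>u \<otimes> x = b \<otimes> s\<close>, then \<open>u\<close> kills
  \<open>x \<otimes> a\<close>. For sums, a common left multiple of the two killers is
  taken.\<close>

lemma (in left_localization) ass_ideal: "ideal (ass_l R S) R"
proof (rule idealI)
  have memI: "r \<in> ass_l R S" if "s \<in> S" "r \<in> carrier R" "s \<otimes> r = \<zero>" for s r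
    using that by (auto simp: ass_l_def)
  show "ring R" by (rule ring_axioms)
  show left: "x \<otimes> a \<in> ass_l R S" if a: "a \<in> ass_l R S" and x: "x \<in> carrier R" for a x
  proof -
    from a obtain s where s: "s \<in> S" "a \<in> carrier R" "s \<otimes> a = \<zero>" by (auto simp: ass_l_def)
    obtain u b where ub: "u \<in> S" "b \<in> carrier R" "u \<otimes> x = b \<otimes> s" using ore x s by metis
    have "u \<otimes> (x \<otimes> a) = (u \<otimes> x) \<otimes> a" using ub(1) s x by (simp add: m_assoc)
    also have "\<dots> = b \<otimes> (s \<otimes> a)" unfolding ub(3) using ub(2) s(1,2) by (simp add: m_assoc)
    finally have "u \<otimes> (x \<otimes> a) = b \<otimes> (s \<otimes> a)" .
    with ub s x show ?thesis by (intro memI[of u]) auto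
  qed
  show "a \<otimes> x \<in> ass_l R S" if "a \<in> ass_l R S" "x \<in> carrier R" for a x
  proof -
    from that obtain s where s: "s \<in> S" "a \<in> carrier R" "s \<otimes> a = \<zero>" by (auto simp: ass_l_def)
    have "s \<otimes> (a \<otimes> x) = \<zero>" using s that m_assoc[of s a x] by simp
    with s that show ?thesis by (intro memI[of s]) auto
  qed
  show "subgroup (ass_l R S) (add_monoid R)"
  proof (rule add.subgroupI)
    show "ass_l R S \<subseteq> carrier R" by (auto simp: ass_l_def)
    have "\<zero> \<in> ass_l R S" by (rule memI[of \<one>]) auto
    then show "ass_l R S \<noteq> {}" by blast
    show "\<ominus> a \<in> ass_l R S" if "a \<in> ass_l R S" for a
      using that by (auto simp: ass_l_def r_minus)
    show "a \<oplus> b \<in> ass_l R S" if "a \<in> ass_l R S" "b \<in> ass_l R S" for a b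
    proof -
      from that obtain s t where s: "s \<in> S" "a \<in> carrier R" "s \<otimes> a = \<zero>"
        and t: "t \<in> S" "b \<in> carrier R" "t \<otimes> b = \<zero>" by (auto simp: ass_l_def)
      obtain v where v: "v \<in> S" "v \<otimes> a = v \<otimes> \<zero>" "v \<otimes> b = v \<otimes> \<zero>"
        by (rule common_witness[of s t a \<zero> b \<zero>]) (use s t in auto)
      with s t show ?thesis by (intro memI[of v]) (auto simp: r_distr)
    qed
  qed
qed

lemma factor_algebra_simps:
  "carrier (factor_algebra R J) = a_rcosets\<^bsub>R\<^esub> J"
  "monoid.mult (factor_algebra R J) = rcoset_mult R J"
  "monoid.one (factor_algebra R J) = J +>\<^bsub>R\<^esub> \<one>\<^bsub>R\<^esub>"
  "ring.zero (factor_algebra R J) = J"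
  "ring.add (factor_algebra R J) = set_add R"
  "module.smult (factor_algebra R J) = (\<lambda>c X. \<Union>x\<in>X. J +>\<^bsub>R\<^esub> (c \<odot>\<^bsub>R\<^esub> x))"
  by (simp_all add: factor_algebra_def ring.extend_def module.fields_def FactRing_def)

text \<open>Adding a scalar multiplication field changes the record, so the ring axioms of the
  quotient have to be carried over to the extended record.\<close>

lemma ring_extend:
  assumes "ring R"
  shows "ring (ring.extend R m)"
proof -
  interpret ring R by fact
  have simps: "carrier (ring.extend R m) = carrier R" "ring.add (ring.extend R m) = ring.add R"
    "monoid.mult (ring.extend R m) = monoid.mult R" "\<one>\<^bsub>ring.extend R m\<^esub> = \<one>\<^bsub>R\<^esub>"
    "\<zero>\<^bsub>ring.extend R m\<^esub> = \<zero>\<^bsub>R\<^esub>"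
    by (simp_all add: ring.extend_def)
  show ?thesis
  proof (rule ringI)
    show "abelian_group (ring.extend R m)"
      by (rule abelian_groupI)
        (auto simp: simps a_assoc intro: a_comm bexI[of _ "\<ominus>\<^bsub>R\<^esub> x" for x] l_neg)
    show "monoid (ring.extend R m)" by (rule monoidI) (auto simp: simps m_assoc)
  qed (simp_all add: simps l_distr r_distr)
qed

context scaled_ring
begin

lemma subalgebra_scaled_ring:
  assumes "subring U R" "\<And>c u. u \<in> U \<Longrightarrow> c \<odot> u \<in> U"
  shows "scaled_ring (R\<lparr>carrier := U\<rparr>)"
  by (intro scaled_ring.intro subring_is_ring[OF assms(1)] scaled_ring_axioms.intro)
    (use subringE(1)[OF assms(1)] assms(2) in \<open>auto simp: mult_smult smult_add subset_iff\<close>)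

lemma generated_subalgebra:
  assumes X: "X \<subseteq> carrier R"
  shows "subring (generated_subalgebra R X) R"
    and "u \<in> generated_subalgebra R X \<Longrightarrow> c \<odot> u \<in> generated_subalgebra R X"
    and "X \<subseteq> generated_subalgebra R X"
proof -
  let ?F = "{U. subring U R \<and> (\<forall>c. \<forall>u\<in>U. c \<odot> u \<in> U) \<and> X \<subseteq> U}"
  have "carrier R \<in> ?F" using carrier_is_subring X by auto
  then have "subring (\<Inter> ?F) R" using subring_Inter[of ?F] by blast
  then show "subring (generated_subalgebra R X) R" by (simp add: generated_subalgebra_def)
qed (auto simp: generated_subalgebra_def)

text \<open>The elements satisfying P form one of the subalgebras over which the defining
  intersection ranges.\<close>

lemma generated_subalgebra_induct [consumes 2, case_names gen one add minus mult smult]: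
  assumes u: "u \<in> generated_subalgebra R X" and X: "X \<subseteq> carrier R"
    and gen: "\<And>u. u \<in> X \<Longrightarrow> P u" and one: "P \<one>"
    and add: "\<And>u v. \<lbrakk>u \<in> generated_subalgebra R X; v \<in> generated_subalgebra R X; P u; P v\<rbrakk> \<Longrightarrow> P (u \<oplus> v)"
    and minus: "\<And>u. \<lbrakk>u \<in> generated_subalgebra R X; P u\<rbrakk> \<Longrightarrow> P (\<ominus> u)"
    and mult: "\<And>u v. \<lbrakk>u \<in> generated_subalgebra R X; v \<in> generated_subalgebra R X; P u; P v\<rbrakk> \<Longrightarrow> P (u \<otimes> v)"
    and smult: "\<And>c u. \<lbrakk>u \<in> generated_subalgebra R X; P u\<rbrakk> \<Longrightarrow> P (c \<odot> u)"
  shows "P u"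
proof -
  let ?G = "generated_subalgebra R X"
  let ?U = "{u \<in> ?G. P u}"
  note G = generated_subalgebra[OF X]
  note GE = subringE[OF G(1)]
  have "subring ?U R"
    by (rule subringI) (use GE gen one add minus mult in auto)
  moreover have "\<forall>c. \<forall>u\<in>?U. c \<odot> u \<in> ?U" "X \<subseteq> ?U" using G smult gen by auto
  ultimately have "?G \<subseteq> ?U" unfolding generated_subalgebra_def[of R X] by blast
  then show ?thesis using u by blast
qed

text \<open>Scalars act as right multiplications, which makes every two-sided ideal stable under
  them.\<close>

lemma smult_eq_mult: "x \<in> carrier R \<Longrightarrow> c \<odot> x = x \<otimes> (c \<odot> \<one>)"
  by (simp add: mult_smult)

context
  fixes J
  assumes J: "ideal J R"
begin

interpretation J: ideal J R by (rule J)

lemma factor_algebra_smult: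
  assumes x: "x \<in> carrier R"
  shows "c \<odot>\<^bsub>factor_algebra R J\<^esub> (J +> x) = J +> (c \<odot> x)"
proof -
  \<comment> \<open>Scaling is defined as a union over the coset. Two representatives differ by an
    element of J, and so do their scalar multiples, so the union is one coset.\<close>
  have const: "J +> (c \<odot> y) = J +> (c \<odot> x)" if y: "y \<in> J +> x" for y
  proof -
    from y obtain j where j: "j \<in> J" "y = j \<oplus> x" by (auto simp: a_r_coset_def')
    have "c \<odot> j = j \<otimes> (c \<odot> \<one>)" using smult_eq_mult[of j c] J.Icarr[OF j(1)] by blast
    then have "c \<odot> j \<in> J" using j J.I_r_closed by simp
    moreover have "c \<odot> y = c \<odot> j \<oplus> c \<odot> x" using j x J.Icarr by (simp add: smult_add)
    ultimately have "c \<odot> y \<in> J +> (c \<odot> x)" by (auto simp: a_r_coset_def')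
    then show ?thesis
      using a_repr_independence[of "c \<odot> y" J "c \<odot> x"] x J.a_subgroup by simp
  qed
  have "x \<in> J +> x" using x J.a_rcos_self by blast
  then show ?thesis unfolding factor_algebra_simps using const by (intro UN_constant_eq ballI)
qed

lemma factor_algebra_ring: "ring (factor_algebra R J)"
  unfolding factor_algebra_def by (intro ring_extend J.quotient_is_ring)

lemma factor_algebra_hom: "(+>) J \<in> ring_hom R (factor_algebra R J)"
  using J.rcos_ring_hom by (simp add: ring_hom_def factor_algebra_simps FactRing_def)

lemma factor_algebra_cases:
  assumes "X \<in> carrier (factor_algebra R J)"
  obtains x where "x \<in> carrier R" "X = J +> x"
  using assms by (auto simp: factor_algebra_simps A_RCOSETS_def')

lemma factor_algebra_eq_zero: "x \<in> carrier R \<Longrightarrow> J +> x = \<zero>\<^bsub>factor_algebra R J\<^esub> \<longleftrightarrow> x \<in> J"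
  using quotient_eq_iff_same_a_r_cos[OF J, of x \<zero>]
  by (simp add: factor_algebra_simps minus_eq J.a_subset)

lemma factor_algebra_scaled_ring: "scaled_ring (factor_algebra R J)"
proof -
  interpret B: ring "factor_algebra R J" by (rule factor_algebra_ring)
  interpret h: ring_hom_ring R "factor_algebra R J" "(+>) J"
    by (rule ring_hom_ringI2) (use ring_axioms B.ring_axioms factor_algebra_hom in auto)
  show ?thesis
  proof
    fix c X assume "X \<in> carrier (factor_algebra R J)"
    then show "c \<odot>\<^bsub>factor_algebra R J\<^esub> X \<in> carrier (factor_algebra R J)"
      by (rule factor_algebra_cases) (simp add: factor_algebra_smult)
  next
    fix c X Y assume "X \<in> carrier (factor_algebra R J)" "Y \<in> carrier (factor_algebra R J)"
    then obtain x y where "x \<in> carrier R" "X = J +> x" "y \<in> carrier R" "Y = J +> y"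
      by (metis factor_algebra_cases)
    then show
      "X \<otimes>\<^bsub>factor_algebra R J\<^esub> (c \<odot>\<^bsub>factor_algebra R J\<^esub> Y) =
        c \<odot>\<^bsub>factor_algebra R J\<^esub> (X \<otimes>\<^bsub>factor_algebra R J\<^esub> Y)"
      "c \<odot>\<^bsub>factor_algebra R J\<^esub> (X \<oplus>\<^bsub>factor_algebra R J\<^esub> Y) =
        c \<odot>\<^bsub>factor_algebra R J\<^esub> X \<oplus>\<^bsub>factor_algebra R J\<^esub> c \<odot>\<^bsub>factor_algebra R J\<^esub> Y"
      by (simp_all add: factor_algebra_smult h.hom_mult[symmetric] h.hom_add[symmetric]
          mult_smult smult_add del: h.hom_mult h.hom_add)
  qed
qed

end

end

section \<open>Denominator sets between a regular Ore set and the largest one\<close>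

text \<open>
  Abstract form of the situation of the theorem: \<open>T\<close> stands for the monoid of the
  \<open>\<partial>\<^sup>\<alpha>\<close>, and the ideal \<open>\<aa>\<^sub>n\<close> is the annihilator \<^term>\<open>ass_l R T\<close>.
\<close>

locale regular_ore_extension = left_localization R T
  for R :: "('k, 'a) module" (structure) and T :: "'a set" +
  fixes D :: "'a set"
  assumes T_regular: "T \<subseteq> left_regular R"
    and D_subring: "subring D R"
    and D_smult: "x \<in> D \<Longrightarrow> c \<odot> x \<in> D"
    and T_sub_D: "T \<subseteq> D"
    and reduce: "r \<in> carrier R \<Longrightarrow> \<exists>t\<in>T. t \<otimes> r \<in> D"
    and D_domain: "\<lbrakk>x \<in> D; y \<in> D; x \<otimes> y = \<zero>\<rbrakk> \<Longrightarrow> x = \<zero> \<or> y = \<zero>"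
begin

abbreviation \<aa> where "\<aa> \<equiv> ass_l R T"
abbreviation S where "S \<equiv> left_regular_den R"
abbreviation D' where "D' \<equiv> D \<inter> S"
abbreviation B where "B \<equiv> factor_algebra R \<aa>"
abbreviation Q where "Q \<equiv> localization R S"

sublocale \<aa>: ideal \<aa> R by (rule ass_ideal)

section \<open>The largest denominator set of left regular elements\<close>

lemma D_carrier [simp]: "x \<in> D \<Longrightarrow> x \<in> carrier R"
  and D_mult: "\<lbrakk>x \<in> D; y \<in> D\<rbrakk> \<Longrightarrow> x \<otimes> y \<in> D"
  and one_D: "\<one> \<in> D"
  using subringE[OF D_subring] by auto

lemma
  shows S_den: "left_denominator_set R S"
    and S_regular: "S \<subseteq> left_regular R"
    and S_max: "\<lbrakk>left_denominator_set R X; X \<subseteq> left_regular R\<rbrakk> \<Longrightarrow> X \<subseteq> S"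
  using left_regular_den_is_largest zero_notin_S one_S by metis+

sublocale S: left_localization R S
  by unfold_locales (rule S_den)

lemma T_sub_S: "T \<subseteq> S"
  by (rule S_max[OF den T_regular])

lemma T_S [simp]: "t \<in> T \<Longrightarrow> t \<in> S"
  using T_sub_S by blast

text \<open>All left regular elements satisfying the Ore condition with multipliers from S form a
  denominator set that contains S; by maximality it is S itself.\<close>

lemma S_memI:
  assumes v: "v \<in> left_regular R"
    and v_ore: "\<And>r. r \<in> carrier R \<Longrightarrow> \<exists>u\<in>S. \<exists>a\<in>carrier R. u \<otimes> r = a \<otimes> v"
  shows "v \<in> S"
proof -
  define X where "X = {v \<in> left_regular R. \<forall>r\<in>carrier R. \<exists>u\<in>S. \<exists>a\<in>carrier R. u \<otimes> r = a \<otimes> v}"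
  have X_carrier: "X \<subseteq> carrier R" by (auto simp: X_def left_regular_def)
  have S_X: "S \<subseteq> X"
    using S_regular S.ore unfolding X_def by blast
  have "left_denominator_set R X"
  proof (rule left_denominator_setI)
    show "\<one> \<in> X" using S_X S.one_S by blast
    have "\<one> \<noteq> \<zero>" using zero_notin_S one_S by metis
    then show "\<zero> \<notin> X" by (auto simp: X_def left_regular_def intro!: bexI[of _ \<one>])
    show "\<exists>u\<in>X. \<exists>a\<in>carrier R. u \<otimes> r = a \<otimes> x" if "r \<in> carrier R" "x \<in> X" for r x
      using that S_X unfolding X_def by blast
    show "\<exists>t\<in>X. t \<otimes> r = \<zero>" if "r \<in> carrier R" "x \<in> X" "r \<otimes> x = \<zero>" for r x
    proof -
      have "r = \<zero>" using that unfolding X_def left_regular_def by blast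
      then show ?thesis using S_X by (intro bexI[of _ \<one>]) auto
    qed
    show "x \<otimes> y \<in> X" if x: "x \<in> X" and y: "y \<in> X" for x y
    proof -
      have c: "x \<in> carrier R" "y \<in> carrier R" using x y X_carrier by auto
      have "\<exists>u\<in>S. \<exists>a\<in>carrier R. u \<otimes> r = a \<otimes> (x \<otimes> y)" if r: "r \<in> carrier R" for r
      proof -
        obtain u a where ua: "u \<in> S" "a \<in> carrier R" "u \<otimes> r = a \<otimes> y" using y r unfolding X_def by blast
        obtain v b where vb: "v \<in> S" "b \<in> carrier R" "v \<otimes> a = b \<otimes> x" using x ua unfolding X_def by blast
        have "(v \<otimes> u) \<otimes> r = (v \<otimes> a) \<otimes> y" using ua vb(1) r c by (simp add: m_assoc)
        also have "\<dots> = b \<otimes> (x \<otimes> y)" using vb c by (simp add: m_assoc)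
        finally show ?thesis using ua vb by (intro bexI[of _ "v \<otimes> u"] bexI[of _ b]) auto
      qed
      then show ?thesis using x y left_regular_mult unfolding X_def by blast
    qed
  qed (fact X_carrier)
  then have "X \<subseteq> S" by (rule S_max) (auto simp: X_def)
  then show ?thesis using v v_ore unfolding X_def by blast
qed

text \<open>Elements of S can be cancelled on the right. The Ore condition for
  \<open>r \<otimes> w\<close> against \<open>v \<otimes> w\<close> therefore turns into one for
  \<open>r\<close> against \<open>v\<close>, and regularity of \<open>v\<close> is inherited from
  \<open>v \<otimes> w\<close>.\<close>

lemma S_left_factor:
  assumes v: "v \<in> carrier R" and w: "w \<in> S" and vw: "v \<otimes> w \<in> S"
  shows "v \<in> S"
proof (rule S_memI)
  have cancel: "x = \<zero>" if "x \<in> carrier R" "x \<otimes> y = \<zero>" "y \<in> S" for x y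
    using that S_regular unfolding left_regular_def by blast
  have "r = \<zero>" if r: "r \<in> carrier R" "r \<otimes> v = \<zero>" for r
  proof (rule cancel[OF r(1) _ vw])
    show "r \<otimes> (v \<otimes> w) = \<zero>" using r v w m_assoc[of r v w] by simp
  qed
  then show "v \<in> left_regular R" using v unfolding left_regular_def by blast
  fix r assume r: "r \<in> carrier R"
  obtain u a where ua: "u \<in> S" "a \<in> carrier R" "u \<otimes> (r \<otimes> w) = a \<otimes> (v \<otimes> w)"
    using S.ore[of "r \<otimes> w" "v \<otimes> w"] r w vw by auto
  have "(u \<otimes> r \<ominus> a \<otimes> v) \<otimes> w = \<zero>"
    using ua r w v by (simp add: minus_eq l_distr l_minus m_assoc r_neg)
  then have "u \<otimes> r \<ominus> a \<otimes> v = \<zero>"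
    using cancel[of "u \<otimes> r \<ominus> a \<otimes> v" w] ua(1,2) r w v by simp
  then have "u \<otimes> r = a \<otimes> v" using ua r v by (metis S.S_carrier m_closed r_right_minus_eq)
  then show "\<exists>u\<in>S. \<exists>a\<in>carrier R. u \<otimes> r = a \<otimes> v" using ua by blast
qed

section \<open>Complete primeness of the annihilator\<close>

lemma ass_memI: "\<lbrakk>t \<in> T; r \<in> carrier R; t \<otimes> r = \<zero>\<rbrakk> \<Longrightarrow> r \<in> \<aa>"
  unfolding ass_l_def by blast

lemma ass_memE:
  assumes "r \<in> \<aa>"
  obtains t where "t \<in> T" "r \<in> carrier R" "t \<otimes> r = \<zero>"
  using assms unfolding ass_l_def by blast

lemma S_disjoint: "s \<in> S \<Longrightarrow> s \<notin> \<aa>"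
  by (metis S.S_mult S.zero_notin_S T_S ass_memE)

lemma D_cap_ass:
  assumes "x \<in> D" "x \<in> \<aa>"
  shows "x = \<zero>"
proof -
  obtain t where "t \<in> T" "t \<otimes> x = \<zero>" using assms by (auto elim: ass_memE)
  then show ?thesis using D_domain[of t x] assms T_sub_D zero_notin_S by auto
qed

text \<open>This is the statement that the factor ring is a domain, obtained from D: first
  \<open>s\<close> is moved into D by \<open>t\<close>, then \<open>r\<close> is carried past
  \<open>t\<close> by the Ore condition, and the resulting \<open>r'\<close> is moved into D by
  \<open>v\<close>. The product of the two elements of D lies in the annihilator and hence
  vanishes.\<close>

lemma ass_prime:
  assumes r: "r \<in> carrier R" and s: "s \<in> carrier R" and rs: "r \<otimes> s \<in> \<aa>"
  shows "r \<in> \<aa> \<or> s \<in> \<aa>"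
proof -
  obtain t where t: "t \<in> T" "t \<otimes> s \<in> D" using reduce s by blast
  obtain u r' where u: "u \<in> T" "r' \<in> carrier R" "u \<otimes> r = r' \<otimes> t" using ore r t by metis
  obtain v where v: "v \<in> T" "v \<otimes> r' \<in> D" using reduce u by blast
  have "(v \<otimes> r') \<otimes> (t \<otimes> s) = v \<otimes> (r' \<otimes> t) \<otimes> s" using t u v s by (simp add: m_assoc)
  also have "\<dots> = (v \<otimes> u) \<otimes> (r \<otimes> s)" unfolding u(3)[symmetric] using u(1) v r s by (simp add: m_assoc)
  finally have "(v \<otimes> r') \<otimes> (t \<otimes> s) \<in> \<aa>" using \<aa>.I_l_closed rs u v by simp
  then have "v \<otimes> r' = \<zero> \<or> t \<otimes> s = \<zero>" using D_domain D_cap_ass D_mult t v by blast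
  then show ?thesis
  proof
    assume "v \<otimes> r' = \<zero>"
    then have "v \<otimes> (u \<otimes> r) = \<zero>"
      using u(2,3) v(1) t(1) m_assoc[of v r' t] by simp
    then have "(v \<otimes> u) \<otimes> r = \<zero>" using u(1) v(1) r by (simp add: m_assoc)
    then show ?thesis using ass_memI[of "v \<otimes> u" r] u v r by auto
  next
    assume "t \<otimes> s = \<zero>"
    then show ?thesis using ass_memI t s by auto
  qed
qed

section \<open>Saturated sets\<close>

lemma T_D': "t \<in> T \<Longrightarrow> t \<in> D'"
  using T_sub_D T_S by auto

lemma S_reduce:
  assumes "s \<in> S"
  obtains t where "t \<in> T" "t \<otimes> s \<in> D'"
  by (metis IntI S.S_carrier S.S_mult T_S assms reduce)

text \<open>Some element of T kills the summand \<open>a\<close>, after which only a multiple of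
  \<open>s\<close> remains to be reduced.\<close>

lemma S_add_reduce:
  assumes "s \<in> S" "a \<in> \<aa>"
  obtains t where "t \<in> T" "t \<otimes> (s \<oplus> a) \<in> D'"
proof -
  obtain t where t: "t \<in> T" "a \<in> carrier R" "t \<otimes> a = \<zero>" using assms ass_memE by metis
  then have "t \<otimes> (s \<oplus> a) = t \<otimes> s" using assms by (simp add: r_distr)
  moreover obtain u where u: "u \<in> T" "u \<otimes> (t \<otimes> s) \<in> D'" using S_reduce assms t by (metis S.S_mult T_S)
  ultimately show ?thesis using that[of "u \<otimes> t"] t assms(1) by (simp add: m_assoc)
qed

text \<open>The unit of X comes from \<open>D' \<subseteq> X\<close>. That X avoids zero comes from
  the reduction condition, since S is disjoint from the annihilator.\<close>

definition saturated :: "'a set \<Rightarrow> bool" where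
  "saturated X \<longleftrightarrow> X \<subseteq> carrier R \<and> D' \<subseteq> X \<and> (\<forall>x\<in>X. \<forall>y\<in>X. x \<otimes> y \<in> X) \<and>
    (\<forall>x\<in>X. \<exists>t\<in>T. t \<otimes> x \<in> D')"

lemma saturatedD:
  assumes "saturated X"
  shows "X \<subseteq> carrier R" "D' \<subseteq> X" "\<lbrakk>x \<in> X; y \<in> X\<rbrakk> \<Longrightarrow> x \<otimes> y \<in> X"
  using assms by (simp_all add: saturated_def)

lemma saturated_reduce:
  assumes "saturated X" "x \<in> X"
  obtains t where "t \<in> T" "t \<otimes> x \<in> D'" "t \<otimes> x \<in> S"
  using assms by (auto simp: saturated_def)

text \<open>X is disjoint from the annihilator because its elements have multiples in S. Complete
  primeness then settles both the denominator condition and the computation of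
  \<open>ass_l R X\<close>; the Ore condition is borrowed from S.\<close>

lemma saturated_den:
  assumes X: "saturated X"
  shows "left_denominator_set R X" "ass_l R X = \<aa>"
    and "x \<in> X \<Longrightarrow> x \<notin> \<aa>"
proof -
  have T_X: "T \<subseteq> X" using saturatedD(2)[OF X] T_D' by (meson subset_iff)
  have X_carrier: "x \<in> carrier R" if "x \<in> X" for x using saturatedD(1)[OF X] that by (rule subsetD)
  show disj: "x \<notin> \<aa>" if x: "x \<in> X" for x
  proof
    assume "x \<in> \<aa>"
    obtain t where "t \<in> T" "t \<otimes> x \<in> S" using saturated_reduce[OF X x] .
    then show False
      using S_disjoint \<aa>.I_l_closed[OF \<open>x \<in> \<aa>\<close>, of t] by simp
  qed
  show "left_denominator_set R X"
  proof (rule left_denominator_setI)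
    show "\<one> \<in> X" using T_X by auto
    show "\<zero> \<notin> X" using disj \<aa>.zero_closed by blast
    show "\<exists>u\<in>X. \<exists>a\<in>carrier R. u \<otimes> r = a \<otimes> x" if r: "r \<in> carrier R" and x: "x \<in> X" for r x
    proof -
      obtain t where t: "t \<in> T" "t \<otimes> x \<in> S" using saturated_reduce[OF X x] .
      \<comment> \<open>The Ore condition of S is used for the denominator
        \<open>t \<otimes> x\<close>. The resulting \<open>u\<close> need not lie in X, so it is
        moved into \<open>D'\<close> by one more element of T.\<close>
      obtain u a where ua: "u \<in> S" "a \<in> carrier R" "u \<otimes> r = a \<otimes> (t \<otimes> x)" using S.ore r t by metis
      obtain v where v: "v \<in> T" "v \<otimes> u \<in> D'" using S_reduce ua by metis
      then have "v \<otimes> u \<in> X" using saturatedD(2)[OF X] by (meson subset_iff)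
      moreover have "v \<otimes> u \<otimes> r = (v \<otimes> a \<otimes> t) \<otimes> x" using v(1) ua t(1) r x X_carrier by (simp add: m_assoc)
      ultimately show ?thesis using v ua t by (intro bexI[of _ "v \<otimes> u"] bexI[of _ "v \<otimes> a \<otimes> t"]) auto
    qed
    show "\<exists>t\<in>X. t \<otimes> r = \<zero>" if "r \<in> carrier R" "x \<in> X" "r \<otimes> x = \<zero>" for r x
    proof -
      have "r \<in> \<aa>" using ass_prime[of r x] that disj X_carrier \<aa>.zero_closed by auto
      then show ?thesis using T_X by (auto elim: ass_memE)
    qed
  qed (use X in \<open>auto simp: saturated_def\<close>)
  show "ass_l R X = \<aa>"
  proof
    have "r \<in> \<aa>" if "r \<in> carrier R" "x \<in> X" "x \<otimes> r = \<zero>" for r x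
      using ass_prime[of x r] that disj X_carrier \<aa>.zero_closed by auto
    then show "ass_l R X \<subseteq> \<aa>" unfolding ass_l_def[of R X] by blast
    show "\<aa> \<subseteq> ass_l R X" using T_X unfolding ass_l_def by blast
  qed
qed

lemma saturated_localization: "saturated X \<Longrightarrow> left_localization R X"
  by unfold_locales (rule saturated_den)

lemma saturated_D': "saturated D'"
  unfolding saturated_def
proof (intro conjI ballI)
  fix x y assume "x \<in> D'" "y \<in> D'"
  then show "x \<otimes> y \<in> D'" by (auto intro: D_mult)
  show "\<exists>t\<in>T. t \<otimes> x \<in> D'" using \<open>x \<in> D'\<close> by (intro bexI[of _ \<one>]) auto
qed auto

lemma saturated_S: "saturated S"
  unfolding saturated_def
proof (intro conjI ballI)
  fix x assume "x \<in> S"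
  then show "\<exists>t\<in>T. t \<otimes> x \<in> D'" using S_reduce by metis
qed auto

text \<open>The identity of R induces the map: both sets have the same annihilator, and expanding a
  fraction over X by the reducing element of T puts its denominator into \<open>D'\<close>.\<close>

lemma saturated_iso_D':
  assumes X: "saturated X"
  shows "localization R D' \<simeq>\<^sub>K localization R X"
proof (rule localization_iso[where \<phi> = "\<lambda>x. x"])
  show "left_localization R D'" "left_localization R X"
    using saturated_localization saturated_D' X by blast+
  show "(\<lambda>x. x) \<in> ring_hom R R" by (auto simp: ring_hom_def)
  show "x \<in> X" if "x \<in> D'" for x using X that unfolding saturated_def by blast
  show "r \<in> ass_l R D'" if "r \<in> ass_l R X" for r
    using that saturated_den(2) saturated_D' X by simp
  show "\<exists>v\<in>carrier R. \<exists>s\<in>D'. \<exists>r\<in>carrier R. v \<otimes> s' = s \<and> v \<otimes> r' = r"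
    if s': "s' \<in> X" and r': "r' \<in> carrier R" for s' r'
  proof -
    obtain t where t: "t \<in> T" "t \<otimes> s' \<in> D'" using saturated_reduce[OF X s'] .
    then have "t \<in> carrier R" "t \<otimes> r' \<in> carrier R" using r' by simp_all
    then show ?thesis using t(2) by blast
  qed
qed simp

lemma saturated_iso:
  assumes "saturated X" "saturated Y"
  shows "localization R X \<simeq>\<^sub>K localization R Y"
proof -
  interpret D': left_localization R D' by (rule saturated_localization[OF saturated_D'])
  show ?thesis
    using algebra_iso_trans D'.algebra_iso_localization_sym saturated_iso_D' assms by blast
qed

lemma saturated_Den:
  assumes "saturated X"
  shows "X \<in> Den_l R \<aa>" "localization R X \<simeq>\<^sub>K Q"
  using saturated_den[OF assms] saturated_iso[OF assms saturated_S] by (auto simp: Den_l_def)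

section \<open>Saturated sets modulo the annihilator\<close>

lemma B_hom: "ring_hom_ring R B ((+>) \<aa>)"
  by (rule ring_hom_ringI2)
    (use ring_axioms factor_algebra_ring factor_algebra_hom \<aa>.ideal_axioms in auto)

lemmas B_eq_zero = factor_algebra_eq_zero[OF \<aa>.ideal_axioms]

text \<open>The image of X avoids zero and the factor ring is a domain, so only the Ore condition
  has to be transported; it passes to images of representatives.\<close>

lemma saturated_B_Den:
  assumes X: "saturated X"
  shows "(+>) \<aa> ` X \<in> Den_l B {\<zero>\<^bsub>B\<^esub>}"
proof -
  interpret h: ring_hom_ring R B "(+>) \<aa>" by (rule B_hom)
  interpret X: left_localization R X by (rule saturated_localization[OF X])
  note disj = saturated_den(3)[OF X]
  have "left_denominator_set B ((+>) \<aa> ` X)"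
  proof (rule left_denominator_setI)
    show "(+>) \<aa> ` X \<subseteq> carrier B" by auto
    show "\<one>\<^bsub>B\<^esub> \<in> (+>) \<aa> ` X" using X.one_S h.hom_one by (metis imageI)
    show "\<zero>\<^bsub>B\<^esub> \<notin> (+>) \<aa> ` X" using disj B_eq_zero[OF X.S_carrier] by (metis imageE)
    show "x \<otimes>\<^bsub>B\<^esub> y \<in> (+>) \<aa> ` X" if "x \<in> (+>) \<aa> ` X" "y \<in> (+>) \<aa> ` X" for x y
      using that by (auto simp: h.hom_mult[symmetric] simp del: h.hom_mult)
    show "\<exists>u\<in>(+>) \<aa> ` X. \<exists>a\<in>carrier B. u \<otimes>\<^bsub>B\<^esub> r = a \<otimes>\<^bsub>B\<^esub> x"
      if r: "r \<in> carrier B" and x: "x \<in> (+>) \<aa> ` X" for r x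
    proof -
      obtain r' x' where r': "r' \<in> carrier R" "r = \<aa> +> r'" and x': "x' \<in> X" "x = \<aa> +> x'"
        using r x factor_algebra_cases[OF \<aa>.ideal_axioms] by blast
      obtain u a where ua: "u \<in> X" "a \<in> carrier R" "u \<otimes> r' = a \<otimes> x'" using X.ore r' x' by metis
      have "(\<aa> +> u) \<otimes>\<^bsub>B\<^esub> r = (\<aa> +> a) \<otimes>\<^bsub>B\<^esub> x"
        using ua r' x' h.hom_mult by (metis X.S_carrier)
      moreover have "\<aa> +> u \<in> (+>) \<aa> ` X" "\<aa> +> a \<in> carrier B" using ua by auto
      ultimately show ?thesis by blast
    qed
    show "\<exists>t\<in>(+>) \<aa> ` X. t \<otimes>\<^bsub>B\<^esub> r = \<zero>\<^bsub>B\<^esub>"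
      if r: "r \<in> carrier B" and x: "x \<in> (+>) \<aa> ` X" and rx: "r \<otimes>\<^bsub>B\<^esub> x = \<zero>\<^bsub>B\<^esub>" for r x
    proof -
      obtain r' x' where r': "r' \<in> carrier R" "r = \<aa> +> r'" and x': "x' \<in> X" "x = \<aa> +> x'"
        using r x factor_algebra_cases[OF \<aa>.ideal_axioms] by blast
      have "\<aa> +> (r' \<otimes> x') = \<zero>\<^bsub>B\<^esub>" using rx r' x' by simp
      then have "r' \<in> \<aa>" using B_eq_zero ass_prime disj r' x' by (metis X.S_carrier m_closed)
      then have "r = \<zero>\<^bsub>B\<^esub>" using B_eq_zero r' by simp
      then have "(\<aa> +> \<one>) \<otimes>\<^bsub>B\<^esub> r = \<zero>\<^bsub>B\<^esub>" by simp
      then show ?thesis using X.one_S by blast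
    qed
  qed
  moreover have "r = \<zero>\<^bsub>B\<^esub>"
    if r: "r \<in> carrier B" and x: "x \<in> (+>) \<aa> ` X" and rx: "x \<otimes>\<^bsub>B\<^esub> r = \<zero>\<^bsub>B\<^esub>" for r x
  proof -
    obtain r' x' where r': "r' \<in> carrier R" "r = \<aa> +> r'" and x': "x' \<in> X" "x = \<aa> +> x'"
      using r x factor_algebra_cases[OF \<aa>.ideal_axioms] by blast
    have "\<aa> +> (x' \<otimes> r') = \<zero>\<^bsub>B\<^esub>" using rx r' x' by simp
    then have "r' \<in> \<aa>" using B_eq_zero ass_prime disj r' x' by (metis X.S_carrier m_closed)
    then show ?thesis using B_eq_zero r' by simp
  qed
  then have "ass_l B ((+>) \<aa> ` X) \<subseteq> {\<zero>\<^bsub>B\<^esub>}" unfolding ass_l_def[of B] by blast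
  moreover have "(\<aa> +> \<one>) \<otimes>\<^bsub>B\<^esub> \<zero>\<^bsub>B\<^esub> = \<zero>\<^bsub>B\<^esub>" "\<aa> +> \<one> \<in> (+>) \<aa> ` X" by (simp_all del: h.hom_one)
  then have "\<zero>\<^bsub>B\<^esub> \<in> ass_l B ((+>) \<aa> ` X)"
    unfolding ass_l_def[of B] using h.S.zero_closed by blast
  ultimately show ?thesis unfolding Den_l_def by blast
qed

lemma saturated_B_localization:
  assumes "saturated X"
  shows "left_localization B ((+>) \<aa> ` X)"
  using saturated_B_Den[OF assms] factor_algebra_scaled_ring[OF \<aa>.ideal_axioms]
  by (simp add: left_localization_def left_localization_axioms_def Den_l_def)

text \<open>The kernel of the quotient map is exactly the annihilator of X, which becomes zero in
  every localization at X. The quotient map is onto, so fractions lift with expansion factor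
  one.\<close>

lemma saturated_B_iso:
  assumes X: "saturated X"
  shows "localization R X \<simeq>\<^sub>K localization B ((+>) \<aa> ` X)"
proof (rule localization_iso[where \<phi> = "(+>) \<aa>"])
  interpret h: ring_hom_ring R B "(+>) \<aa>" by (rule B_hom)
  show "left_localization R X" "left_localization B ((+>) \<aa> ` X)"
    using saturated_localization saturated_B_localization X by blast+
  show "(+>) \<aa> \<in> ring_hom R B" by (rule h.homh)
  show "\<aa> +> (c \<odot> x) = c \<odot>\<^bsub>B\<^esub> (\<aa> +> x)" if "x \<in> carrier R" for c x
    using factor_algebra_smult[OF \<aa>.ideal_axioms] that by simp
  show "r \<in> ass_l R X" if "r \<in> carrier R" "\<aa> +> r \<in> ass_l B ((+>) \<aa> ` X)" for r
    using that saturated_B_Den[OF X] B_eq_zero saturated_den(2)[OF X] by (simp add: Den_l_def)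
  show "\<exists>v\<in>carrier B. \<exists>s\<in>X. \<exists>r\<in>carrier R. v \<otimes>\<^bsub>B\<^esub> s' = \<aa> +> s \<and> v \<otimes>\<^bsub>B\<^esub> r' = \<aa> +> r"
    if s': "s' \<in> (+>) \<aa> ` X" and r': "r' \<in> carrier B" for s' r'
  proof -
    obtain s where s: "s \<in> X" "s' = \<aa> +> s" using s' by (rule imageE)
    obtain r where r: "r \<in> carrier R" "r' = \<aa> +> r"
      using factor_algebra_cases[OF \<aa>.ideal_axioms r'] .
    note sr = s r
    have "s \<in> carrier R" using saturatedD(1)[OF X] s(1) by (rule subsetD)
    then show ?thesis using sr by (intro bexI[of _ "\<one>\<^bsub>B\<^esub>"] bexI[of _ s] bexI[of _ r]) auto
  qed
qed auto

lemma saturated_B_iso_Q: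
  assumes "saturated X"
  shows "localization B ((+>) \<aa> ` X) \<simeq>\<^sub>K Q"
proof -
  interpret X: left_localization R X by (rule saturated_localization[OF assms])
  show ?thesis
    using algebra_iso_trans X.algebra_iso_localization_sym saturated_B_iso saturated_Den(2) assms
    by blast
qed

lemma saturated_B_iso_B:
  assumes "saturated X" "saturated Y"
  shows "localization B ((+>) \<aa> ` X) \<simeq>\<^sub>K localization B ((+>) \<aa> ` Y)"
proof -
  interpret X: left_localization R X by (rule saturated_localization[OF assms(1)])
  show ?thesis
    using algebra_iso_trans[OF X.algebra_iso_localization_sym[OF saturated_B_iso[OF assms(1)]]
      algebra_iso_trans[OF saturated_iso[OF assms] saturated_B_iso[OF assms(2)]]] .
qed

section \<open>The saturated sets of the theorem\<close>

text \<open>The cross terms of a product fall into the ideal, and the added element of the ideal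
  disappears when an element of T is applied.\<close>

lemma saturated_add:
  assumes X: "saturated X"
  shows "saturated (X <+>\<^bsub>R\<^esub> \<aa>)"
  unfolding saturated_def
proof (intro conjI ballI)
  have X_carrier: "x \<in> carrier R" if "x \<in> X" for x using X that unfolding saturated_def by blast
  show "X <+>\<^bsub>R\<^esub> \<aa> \<subseteq> carrier R" using X_carrier \<aa>.Icarr by (auto simp: set_add_iff)
  show "D' \<subseteq> X <+>\<^bsub>R\<^esub> \<aa>"
  proof
    fix x assume "x \<in> D'"
    then have "x \<in> X" "x = x \<oplus> \<zero>" using X by (auto simp: saturated_def)
    then show "x \<in> X <+>\<^bsub>R\<^esub> \<aa>" using \<aa>.zero_closed unfolding set_add_iff by blast
  qed
  fix z assume z_mem: "z \<in> X <+>\<^bsub>R\<^esub> \<aa>"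
  then obtain x a where z: "x \<in> X" "a \<in> \<aa>" "z = x \<oplus> a" by (auto simp: set_add_iff)
  show "z \<otimes> z' \<in> X <+>\<^bsub>R\<^esub> \<aa>" if "z' \<in> X <+>\<^bsub>R\<^esub> \<aa>" for z'
  proof -
    from that obtain y b where z': "y \<in> X" "b \<in> \<aa>" "z' = y \<oplus> b" by (auto simp: set_add_iff)
    note c = X_carrier[OF z(1)] X_carrier[OF z'(1)] \<aa>.Icarr[OF z(2)] \<aa>.Icarr[OF z'(2)]
    have "z \<otimes> z' = x \<otimes> y \<oplus> (x \<otimes> b \<oplus> (a \<otimes> y \<oplus> a \<otimes> b))"
      using c z(3) z'(3) by (simp add: l_distr r_distr a_ac)
    moreover have "x \<otimes> b \<oplus> (a \<otimes> y \<oplus> a \<otimes> b) \<in> \<aa>"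
      using c z(2) z'(2) \<aa>.I_l_closed \<aa>.I_r_closed \<aa>.a_closed by simp
    moreover have "x \<otimes> y \<in> X" using X z z' unfolding saturated_def by blast
    ultimately show ?thesis unfolding set_add_iff by blast
  qed
  obtain t where t: "t \<in> T" "t \<otimes> x \<in> S" using X z unfolding saturated_def by blast
  moreover have "t \<otimes> z = t \<otimes> x \<oplus> t \<otimes> a" using t z X_carrier \<aa>.Icarr by (simp add: r_distr)
  moreover have "t \<otimes> a \<in> \<aa>" using t z \<aa>.I_l_closed by simp
  ultimately obtain u where "u \<in> T" "u \<otimes> (t \<otimes> z) \<in> D'" using S_add_reduce by metis
  then show "\<exists>t\<in>T. t \<otimes> z \<in> D'"
    using t z X_carrier \<aa>.Icarr by (intro bexI[of _ "u \<otimes> t"]) (auto simp: m_assoc)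
qed

lemma saturated_tilde: "saturated {c \<in> D. \<exists>t\<in>T. t \<otimes> c \<in> S}" (is "saturated ?X")
  unfolding saturated_def
proof (intro conjI ballI)
  show "D' \<subseteq> ?X" using one_S by (auto intro!: bexI[of _ \<one>])
  fix c assume "c \<in> ?X"
  then obtain s where c: "c \<in> D" "s \<in> T" "s \<otimes> c \<in> S" by blast
  then show "\<exists>t\<in>T. t \<otimes> c \<in> D'" using D_mult T_sub_D by blast
  fix d assume "d \<in> ?X"
  then obtain t where d: "d \<in> D" "t \<in> T" "t \<otimes> d \<in> S" by blast
  \<comment> \<open>To reach a multiple of \<open>c \<otimes> d\<close> in S, the multiplier
    \<open>s\<close> of \<open>c\<close> must be made to meet the multiplier \<open>t\<close> of
    \<open>d\<close>. The Ore condition of T gives a quotient \<open>v\<close> known only to lie in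
    R; since \<open>v \<otimes> t\<close> and \<open>t\<close> lie in S, so does
    \<open>v\<close>.\<close>
  obtain u v where uv: "u \<in> T" "v \<in> carrier R" "u \<otimes> (s \<otimes> c) = v \<otimes> t"
    using ore[of "s \<otimes> c" t] c d by auto
  then have "v \<otimes> t \<in> S" using S.S_mult[OF T_S[OF uv(1)] c(3)] by simp
  then have "v \<in> S" using S_left_factor[OF uv(2) T_S[OF d(2)]] by simp
  then have "v \<otimes> (t \<otimes> d) \<in> S" using d by simp
  moreover have "(u \<otimes> s) \<otimes> (c \<otimes> d) = (u \<otimes> (s \<otimes> c)) \<otimes> d" using c d uv(1) by (simp add: m_assoc)
  then have "(u \<otimes> s) \<otimes> (c \<otimes> d) = v \<otimes> (t \<otimes> d)" unfolding uv(3) using uv(2) d by (simp add: m_assoc)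
  ultimately show "c \<otimes> d \<in> ?X"
    using c(1,2) d(1) uv(1) by (auto intro!: D_mult bexI[of _ "u \<otimes> s"])
qed auto

lemma saturated_pre_double_prime:
  "saturated (S \<inter> (left_regular (R\<lparr>carrier := D <+>\<^bsub>R\<^esub> \<aa>\<rparr>) <+>\<^bsub>R\<^esub> \<aa>))" (is "saturated (S \<inter> (?C <+>\<^bsub>R\<^esub> \<aa>))")
  unfolding saturated_def
proof (intro conjI ballI)
  have DA: "D <+>\<^bsub>R\<^esub> \<aa> \<subseteq> carrier R" using \<aa>.Icarr by (auto simp: set_add_iff)
  show "D' \<subseteq> S \<inter> (?C <+>\<^bsub>R\<^esub> \<aa>)"
  proof
    fix x assume x: "x \<in> D'"
    then have "x \<in> D <+>\<^bsub>R\<^esub> \<aa>" using \<aa>.zero_closed unfolding set_add_iff by (metis D_carrier IntE r_zero)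
    moreover have "\<forall>r\<in>carrier R. r \<otimes> x = \<zero> \<longrightarrow> r = \<zero>"
      using x S_regular unfolding left_regular_def by blast
    ultimately have "x \<in> ?C" using DA unfolding left_regular_def by auto
    then show "x \<in> S \<inter> (?C <+>\<^bsub>R\<^esub> \<aa>)"
      using x \<aa>.zero_closed unfolding set_add_iff by (metis D_carrier IntE IntI r_zero set_add_iff)
  qed
  fix x assume x: "x \<in> S \<inter> (?C <+>\<^bsub>R\<^esub> \<aa>)"
  then show "\<exists>t\<in>T. t \<otimes> x \<in> D'" using S_reduce by (metis IntE)
  fix y assume y: "y \<in> S \<inter> (?C <+>\<^bsub>R\<^esub> \<aa>)"
  from x y obtain c a d b where *: "c \<in> ?C" "a \<in> \<aa>" "x = c \<oplus> a" "d \<in> ?C" "b \<in> \<aa>" "y = d \<oplus> b"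
    by (auto simp: set_add_iff)
  have DA_mult: "p \<otimes> q \<in> D <+>\<^bsub>R\<^esub> \<aa>" if "p \<in> D <+>\<^bsub>R\<^esub> \<aa>" "q \<in> D <+>\<^bsub>R\<^esub> \<aa>" for p q
  proof -
    from that obtain p1 p2 q1 q2 where pq: "p1 \<in> D" "p2 \<in> \<aa>" "p = p1 \<oplus> p2" "q1 \<in> D" "q2 \<in> \<aa>" "q = q1 \<oplus> q2"
      by (auto simp: set_add_iff)
    have "p \<otimes> q = p1 \<otimes> q1 \<oplus> (p1 \<otimes> q2 \<oplus> (p2 \<otimes> q1 \<oplus> p2 \<otimes> q2))"
      using pq \<aa>.Icarr by (simp add: l_distr r_distr a_ac)
    moreover have "p1 \<otimes> q2 \<oplus> (p2 \<otimes> q1 \<oplus> p2 \<otimes> q2) \<in> \<aa>"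
      using pq \<aa>.Icarr \<aa>.I_l_closed \<aa>.I_r_closed \<aa>.a_closed by simp
    ultimately show ?thesis using D_mult pq unfolding set_add_iff by blast
  qed
  have c: "c \<in> carrier R" "d \<in> carrier R" "c \<in> D <+>\<^bsub>R\<^esub> \<aa>" "d \<in> D <+>\<^bsub>R\<^esub> \<aa>"
    using * DA by (auto simp: left_regular_def)
  have "r = \<zero>" if r: "r \<in> D <+>\<^bsub>R\<^esub> \<aa>" "r \<otimes> (c \<otimes> d) = \<zero>" for r
  proof -
    have "(r \<otimes> c) \<otimes> d = \<zero>" using r c DA by (auto simp: m_assoc)
    then have "r \<otimes> c = \<zero>" using *(4) DA_mult[OF r(1) c(3)] by (simp add: left_regular_def)
    then show ?thesis using *(1) r(1) by (simp add: left_regular_def)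
  qed
  then have "c \<otimes> d \<in> ?C" using DA_mult[OF c(3,4)] unfolding left_regular_def by simp
  moreover have "x \<otimes> y = c \<otimes> d \<oplus> (c \<otimes> b \<oplus> (a \<otimes> d \<oplus> a \<otimes> b))"
    using * c \<aa>.Icarr by (simp add: l_distr r_distr a_ac)
  moreover have "c \<otimes> b \<oplus> (a \<otimes> d \<oplus> a \<otimes> b) \<in> \<aa>"
    using * c \<aa>.Icarr \<aa>.I_l_closed \<aa>.I_r_closed \<aa>.a_closed by simp
  ultimately have "x \<otimes> y \<in> ?C <+>\<^bsub>R\<^esub> \<aa>" unfolding set_add_iff by blast
  then show "x \<otimes> y \<in> S \<inter> (?C <+>\<^bsub>R\<^esub> \<aa>)" using x y by simp
qed auto

section \<open>Localization of the subring D\<close>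

lemma D_scaled_ring: "scaled_ring (R\<lparr>carrier := D\<rparr>)"
  by (intro subalgebra_scaled_ring D_subring D_smult)

lemma D'_Den_D: "D' \<in> Den_l (R\<lparr>carrier := D\<rparr>) {\<zero>}"
proof -
  have "left_denominator_set (R\<lparr>carrier := D\<rparr>) D'"
  proof (rule left_denominator_setI)
    show "\<exists>u\<in>D'. \<exists>a\<in>carrier (R\<lparr>carrier := D\<rparr>). u \<otimes>\<^bsub>R\<lparr>carrier := D\<rparr>\<^esub> r = a \<otimes>\<^bsub>R\<lparr>carrier := D\<rparr>\<^esub> x"
      if r': "r \<in> carrier (R\<lparr>carrier := D\<rparr>)" and x: "x \<in> D'" for r x
    proof -
      have r: "r \<in> D" using r' by simp
      obtain u a where ua: "u \<in> D'" "a \<in> carrier R" "u \<otimes> r = a \<otimes> x"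
        using left_localization.ore[OF saturated_localization[OF saturated_D'] D_carrier[OF r] x] .
      \<comment> \<open>The Ore condition of R yields a multiplier \<open>a\<close> outside D in
        general; multiplying the whole equation by \<open>t\<close> brings it into D and keeps
        \<open>t \<otimes> u\<close> in \<open>D'\<close>.\<close>
      obtain t where t: "t \<in> T" "t \<otimes> a \<in> D" using reduce ua by blast
      have "(t \<otimes> u) \<otimes> r = (t \<otimes> a) \<otimes> x" using ua t(1) r x by (auto simp: m_assoc)
      then show ?thesis
        using ua t T_D'[OF t(1)] by (intro bexI[of _ "t \<otimes> u"] bexI[of _ "t \<otimes> a"]) (auto intro: D_mult)
    qed
    show "\<exists>t\<in>D'. t \<otimes>\<^bsub>R\<lparr>carrier := D\<rparr>\<^esub> r = \<zero>\<^bsub>R\<lparr>carrier := D\<rparr>\<^esub>"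
      if "r \<in> carrier (R\<lparr>carrier := D\<rparr>)" "x \<in> D'" "r \<otimes>\<^bsub>R\<lparr>carrier := D\<rparr>\<^esub> x = \<zero>\<^bsub>R\<lparr>carrier := D\<rparr>\<^esub>" for r x
    proof -
      have "x \<in> left_regular R" "r \<in> carrier R" "r \<otimes> x = \<zero>" using that S_regular by auto
      then have "r = \<zero>" unfolding left_regular_def by blast
      then show ?thesis using one_D by (auto intro!: bexI[of _ \<one>])
    qed
  qed (use one_D D_mult S.zero_notin_S in auto)
  moreover have "r = \<zero>" if "r \<in> D" "x \<in> D'" "x \<otimes> r = \<zero>" for r x
    using that D_domain S.zero_notin_S by blast
  then have "ass_l (R\<lparr>carrier := D\<rparr>) D' \<subseteq> {\<zero>}" unfolding ass_l_def by auto
  moreover have "\<one> \<otimes> \<zero> = \<zero>" "\<zero> \<in> D" "\<one> \<in> D'" using one_D subringE(2)[OF D_subring] by auto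
  then have "\<zero> \<in> ass_l (R\<lparr>carrier := D\<rparr>) D'" unfolding ass_l_def by auto
  ultimately show ?thesis unfolding Den_l_def by blast
qed

text \<open>The inclusion of D induces the map. A fraction over R is expanded by an element of T
  that moves its numerator into D while its denominator stays in \<open>D'\<close>.\<close>

lemma D'_localization_D: "localization (R\<lparr>carrier := D\<rparr>) D' \<simeq>\<^sub>K Q"
proof -
  have "localization (R\<lparr>carrier := D\<rparr>) D' \<simeq>\<^sub>K localization R D'"
  proof (rule localization_iso[where \<phi> = "\<lambda>x. x"])
    show "left_localization (R\<lparr>carrier := D\<rparr>) D'"
      using D_scaled_ring D'_Den_D
      by (simp add: left_localization_def left_localization_axioms_def Den_l_def)
    show "left_localization R D'" by (rule saturated_localization[OF saturated_D'])
    show "(\<lambda>x. x) \<in> ring_hom (R\<lparr>carrier := D\<rparr>) R" by (auto simp: ring_hom_def)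
    show "r \<in> ass_l (R\<lparr>carrier := D\<rparr>) D'"
      if "r \<in> carrier (R\<lparr>carrier := D\<rparr>)" "r \<in> ass_l R D'" for r
      using that unfolding ass_l_def by fastforce
    show "\<exists>v\<in>carrier R. \<exists>s\<in>D'. \<exists>r\<in>carrier (R\<lparr>carrier := D\<rparr>). v \<otimes> s' = s \<and> v \<otimes> r' = r"
      if s': "s' \<in> D'" and r': "r' \<in> carrier R" for s' r'
    proof -
      obtain t where t: "t \<in> T" "t \<otimes> r' \<in> D" using reduce r' by blast
      then have "t \<otimes> s' \<in> D'" using s' T_D'[OF t(1)] by (simp add: D_mult)
      moreover have "t \<in> carrier R" using t by simp
      ultimately show ?thesis using t(2) by auto
    qed
  qed auto
  then show ?thesis using saturated_Den(2)[OF saturated_D'] algebra_iso_trans by blast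
qed

text \<open>Justifies the identification of D with its image in the factor algebra.\<close>

lemma D_inj: "inj_on ((+>) \<aa>) D"
proof (rule inj_onI)
  fix x y assume xy: "x \<in> D" "y \<in> D" "\<aa> +> x = \<aa> +> y"
  then have "x \<ominus> y \<in> \<aa>" using quotient_eq_iff_same_a_r_cos[OF \<aa>.ideal_axioms] by simp
  moreover have "x \<ominus> y \<in> D" using xy subringE(5,7)[OF D_subring] by (simp add: minus_eq)
  ultimately show "x = y" using D_cap_ass xy by (metis D_carrier r_right_minus_eq)
qed

end

section \<open>Operators in the divided power basis\<close>

declare One_nat_def [simp del]

text \<open>
  The coefficients with respect to the divided power basis \<open>x\<^sup>\<alpha> / \<alpha>!\<close>. In this basis
  \<open>\<partial>\<^sub>i\<close> and \<open>\<integral>\<^sub>i\<close> are plain shifts and \<open>H\<^sub>i\<close> is diagonal.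
\<close>

definition dcoeff :: "('n::finite, 'k::field_char_0) polys \<Rightarrow> ('n \<Rightarrow>\<^sub>0 nat) \<Rightarrow> 'k" where
  "dcoeff p \<beta> = (\<Prod>i\<in>UNIV. fact (Poly_Mapping.lookup \<beta> i)) * Poly_Mapping.lookup p \<beta>"

text \<open>The recursion of the multi-index factorial. Its factor absorbs the coefficient of a
  derivative and cancels the one of an integration.\<close>

lemma prod_fact_unit_exp:
  "(\<Prod>j\<in>UNIV. fact (Poly_Mapping.lookup (\<beta> + unit_exp i) j) :: 'k::field_char_0) =
    of_nat (Poly_Mapping.lookup \<beta> i + 1) * (\<Prod>j\<in>UNIV. fact (Poly_Mapping.lookup \<beta> (j::'n::finite)))"
proof -
  have "(\<Prod>j\<in>UNIV. fact (Poly_Mapping.lookup (\<beta> + unit_exp i) j) :: 'k) =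
      fact (Poly_Mapping.lookup \<beta> i + 1) * (\<Prod>j\<in>UNIV - {i}. fact (Poly_Mapping.lookup \<beta> j))"
    by (subst prod.remove[of _ i]) (auto simp: lookup_add lookup_single when_def intro!: prod.cong)
  also have "\<dots> = of_nat (Poly_Mapping.lookup \<beta> i + 1) *
      (fact (Poly_Mapping.lookup \<beta> i) * (\<Prod>j\<in>UNIV - {i}. fact (Poly_Mapping.lookup \<beta> j)))"
    by (simp add: fact_reduce mult.assoc)
  also have "fact (Poly_Mapping.lookup \<beta> i) * (\<Prod>j\<in>UNIV - {i}. fact (Poly_Mapping.lookup \<beta> j)) =
      (\<Prod>j\<in>UNIV. fact (Poly_Mapping.lookup \<beta> j) :: 'k)"
    by (rule prod.remove[symmetric]) auto
  finally show ?thesis .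
qed

section \<open>Action of the generators on divided power coefficients\<close>

lemma dcoeff_eqI: "(\<And>\<beta>. dcoeff p \<beta> = dcoeff q \<beta>) \<Longrightarrow> p = q"
  by (rule poly_mapping_eqI) (simp add: dcoeff_def)

lemma dcoeff_add [simp]: "dcoeff (p + q) \<beta> = dcoeff p \<beta> + dcoeff q \<beta>"
  and dcoeff_minus [simp]: "dcoeff (- p) \<beta> = - dcoeff p \<beta>"
  and dcoeff_diff [simp]: "dcoeff (p - q) \<beta> = dcoeff p \<beta> - dcoeff q \<beta>"
  and dcoeff_zero [simp]: "dcoeff 0 \<beta> = 0"
  and dcoeff_scale [simp]: "dcoeff (scale_poly c p) \<beta> = c * dcoeff p \<beta>"
  by (simp_all add: dcoeff_def lookup_add lookup_minus algebra_simps)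

lemma exp_cases:
  fixes \<gamma> :: "'n \<Rightarrow>\<^sub>0 nat"
  obtains "Poly_Mapping.lookup \<gamma> i = 0" | \<beta> where "\<gamma> = \<beta> + unit_exp i"
proof (cases "Poly_Mapping.lookup \<gamma> i")
  case (Suc k)
  then have "\<gamma> = (\<gamma> - unit_exp i) + unit_exp i"
    by (intro poly_mapping_eqI) (auto simp: lookup_add lookup_minus lookup_single when_def)
  then show ?thesis by (rule that(2))
qed (use that in auto)

lemma dcoeff_partial [simp]: "dcoeff (partial_op i p) \<beta> = dcoeff p (\<beta> + unit_exp i)"
  unfolding dcoeff_def lookup_partial_op prod_fact_unit_exp by simp

lemma unit_exp_add_iff:
  fixes \<alpha> \<beta> :: "'n \<Rightarrow>\<^sub>0 nat"
  shows "unit_exp i + \<alpha> = \<beta> + unit_exp i \<longleftrightarrow> \<alpha> = \<beta>"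
  by (metis add.commute add_left_cancel)

lemma lookup_sum_single:
  "Poly_Mapping.lookup (\<Sum>\<alpha>\<in>A. Poly_Mapping.single (g \<alpha>) (c \<alpha>)) \<gamma> = (\<Sum>\<alpha>\<in>A. if g \<alpha> = \<gamma> then c \<alpha> else 0)"
  by (simp add: lookup_sum lookup_single when_def)

text \<open>Treats multiplication by a variable and integration together: both raise one exponent by
  one and differ only in the scalar \<open>c\<close>. An exponent outside the image of the shift has
  i-th entry 0.\<close>

lemma lookup_linear_ext_shift:
  fixes p :: "('n, 'k::field) polys"
  assumes g: "\<And>\<alpha>. g \<alpha> = scale_poly (c \<alpha>) (x_pow (unit_exp i + \<alpha>))"
  shows "Poly_Mapping.lookup (linear_ext g p) (\<beta> + unit_exp i) = c \<beta> * Poly_Mapping.lookup p \<beta>"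
    and "Poly_Mapping.lookup \<gamma> i = 0 \<Longrightarrow> Poly_Mapping.lookup (linear_ext g p) \<gamma> = 0"
proof -
  have *: "Poly_Mapping.lookup (linear_ext g p) \<gamma> =
      (\<Sum>\<alpha>\<in>Poly_Mapping.keys p. if unit_exp i + \<alpha> = \<gamma> then c \<alpha> * Poly_Mapping.lookup p \<alpha> else 0)" for \<gamma>
    by (auto simp: linear_ext_def g x_pow_def lookup_sum lookup_single when_def intro!: sum.cong)
  show "Poly_Mapping.lookup (linear_ext g p) (\<beta> + unit_exp i) = c \<beta> * Poly_Mapping.lookup p \<beta>"
    unfolding * unit_exp_add_iff by (simp add: in_keys_iff sum.delta)
  assume "Poly_Mapping.lookup \<gamma> i = 0"
  then have "unit_exp i + \<alpha> \<noteq> \<gamma>" for \<alpha> by (auto simp: lookup_add)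
  then show "Poly_Mapping.lookup (linear_ext g p) \<gamma> = 0" unfolding * by simp
qed

lemma x_op_linear_ext: "x_op i p = linear_ext (\<lambda>\<alpha>. scale_poly 1 (x_pow (unit_exp i + \<alpha>))) p"
proof -
  have "p = (\<Sum>\<alpha>\<in>Poly_Mapping.keys p. Poly_Mapping.single \<alpha> (Poly_Mapping.lookup p \<alpha>))"
    by (rule poly_mapping_eqI) (simp add: lookup_sum_single in_keys_iff sum.delta)
  then have "x_op i p = (\<Sum>\<alpha>\<in>Poly_Mapping.keys p. Poly_Mapping.single (unit_exp i + \<alpha>) (Poly_Mapping.lookup p \<alpha>))"
    unfolding x_op_def x_pow_def by (metis (no_types, lifting) mult_1 mult_single sum.cong sum_distrib_left)
  also have "\<dots> = linear_ext (\<lambda>\<alpha>. scale_poly 1 (x_pow (unit_exp i + \<alpha>))) p"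
    unfolding linear_ext_def x_pow_def
    by (intro sum.cong refl poly_mapping_eqI) (simp add: lookup_single when_def)
  finally show ?thesis .
qed

lemma dcoeff_int:
  "dcoeff (int_op i p) (\<beta> + unit_exp i) = dcoeff p \<beta>"
  "Poly_Mapping.lookup \<gamma> i = 0 \<Longrightarrow> dcoeff (int_op i p) \<gamma> = 0"
proof -
  have g: "scale_poly (inverse (of_nat (Poly_Mapping.lookup \<alpha> i + 1))) (x_pow (unit_exp i) * x_pow \<alpha>) =
      scale_poly (inverse (of_nat (Poly_Mapping.lookup \<alpha> i + 1))) (x_pow (unit_exp i + \<alpha>) :: ('b, 'a) polys)"
    for \<alpha>
    by (simp add: x_pow_def mult_single)
  show "dcoeff (int_op i p) (\<beta> + unit_exp i) = dcoeff p \<beta>"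
    unfolding dcoeff_def int_op_def prod_fact_unit_exp lookup_linear_ext_shift(1)[OF g]
    by (simp del: of_nat_Suc of_nat_add)
  show "Poly_Mapping.lookup \<gamma> i = 0 \<Longrightarrow> dcoeff (int_op i p) \<gamma> = 0"
    unfolding dcoeff_def int_op_def using lookup_linear_ext_shift(2)[OF g] by fastforce
qed

lemma dcoeff_x:
  "dcoeff (x_op i p) (\<beta> + unit_exp i) = of_nat (Poly_Mapping.lookup \<beta> i + 1) * dcoeff p \<beta>"
  "Poly_Mapping.lookup \<gamma> i = 0 \<Longrightarrow> dcoeff (x_op i p) \<gamma> = 0"
proof -
  show "dcoeff (x_op i p) (\<beta> + unit_exp i) = of_nat (Poly_Mapping.lookup \<beta> i + 1) * dcoeff p \<beta>"
    unfolding dcoeff_def x_op_linear_ext prod_fact_unit_exp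
    by (subst lookup_linear_ext_shift(1)[where c = "\<lambda>_. 1"]) auto
  show "Poly_Mapping.lookup \<gamma> i = 0 \<Longrightarrow> dcoeff (x_op i p) \<gamma> = 0"
    unfolding dcoeff_def x_op_linear_ext
    by (subst lookup_linear_ext_shift(2)[where c = "\<lambda>_. 1"]) auto
qed

lemma dcoeff_H [simp]:
  "dcoeff (H_op i p) \<beta> = of_nat (Poly_Mapping.lookup \<beta> i + 1) * dcoeff p \<beta>"
  by (simp add: H_op_def dcoeff_x)

lemma partial_int:
  fixes p :: "('n::finite, 'k::field_char_0) polys"
  shows "partial_op i (int_op i p) = p"
  by (rule dcoeff_eqI) (simp add: dcoeff_int)

section \<open>The commutative monoid of the \<partial>^\<alpha>\<close>

text \<open>Converts the exponents of \<open>partial_pow\<close>, which are plain functions, into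
  the exponents of monomials.\<close>

definition exp_of :: "('n::finite \<Rightarrow> nat) \<Rightarrow> 'n \<Rightarrow>\<^sub>0 nat" where
  "exp_of \<alpha> = (\<Sum>i\<in>UNIV. Poly_Mapping.single i (\<alpha> i))"

lemma lookup_exp_of [simp]: "Poly_Mapping.lookup (exp_of \<alpha>) i = \<alpha> i"
  by (simp add: exp_of_def lookup_sum lookup_single when_def)

lemma partial_pow_induct [case_names id step]:
  assumes "P id" "\<And>i f. P f \<Longrightarrow> P (partial_op i \<circ> f)"
  shows "P (partial_pow \<alpha>)"
proof -
  interpret comp_fun_commute "\<lambda>i f. (partial_op i ^^ \<alpha> i) \<circ> f" by (rule partial_op_pow_commute)
  have funpow: "P ((partial_op i ^^ k) \<circ> f)" if "P f" for i k f
  proof (induction k)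
    case (Suc k)
    have "(partial_op i ^^ Suc k) \<circ> f = partial_op i \<circ> ((partial_op i ^^ k) \<circ> f)" by (simp add: o_assoc)
    then show ?case using Suc assms(2) by metis
  qed (use that in simp)
  have "P (Finite_Set.fold (\<lambda>i f. (partial_op i ^^ \<alpha> i) \<circ> f) id A)" for A
  proof (use finite[of A] in \<open>induction A rule: finite_induct\<close>)
    case (insert i A)
    show ?case unfolding fold_insert[OF insert(1,2)] by (rule funpow[OF insert(3)])
  qed (simp_all only: fold_empty assms(1))
  then show ?thesis unfolding partial_pow_def by blast
qed

lemma dcoeff_partial_pow: "dcoeff (partial_pow \<alpha> p) \<beta> = dcoeff p (\<beta> + exp_of \<alpha>)"
proof -
  interpret comp_fun_commute "\<lambda>i f. (partial_op i ^^ \<alpha> i) \<circ> f" by (rule partial_op_pow_commute)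
  have funpow: "dcoeff ((partial_op i ^^ k) q) \<beta> = dcoeff q (\<beta> + Poly_Mapping.single i k)" for i k \<beta> q
  proof (induction k arbitrary: \<beta>)
    case (Suc k)
    have "Poly_Mapping.single i (Suc k) = unit_exp i + Poly_Mapping.single i k"
      by (simp add: single_add[symmetric] Suc_eq_plus1_left)
    then show ?case by (simp add: Suc add.assoc)
  qed simp
  have "dcoeff (Finite_Set.fold (\<lambda>i f. (partial_op i ^^ \<alpha> i) \<circ> f) id A p) \<beta> =
      dcoeff p (\<beta> + (\<Sum>i\<in>A. Poly_Mapping.single i (\<alpha> i)))" for A
  proof (use finite[of A] in \<open>induction A arbitrary: \<beta> rule: finite_induct\<close>)
    case (insert i A)
    then show ?case
      unfolding fold_insert[OF insert(1,2)] by (simp only: o_apply funpow insert(3) sum.insert[OF insert(1,2)] add.assoc)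
  qed (simp_all only: fold_empty sum.empty id_apply add_0_right)
  then show ?thesis unfolding partial_pow_def exp_of_def by blast
qed

lemma partial_pow_add:
  "(partial_pow \<alpha> :: ('n::finite, 'k::field_char_0) operator) \<circ> partial_pow \<beta> =
    partial_pow (\<lambda>i. \<alpha> i + \<beta> i)"
proof (intro ext dcoeff_eqI)
  have "exp_of \<alpha> + exp_of \<beta> = exp_of (\<lambda>i. \<alpha> i + \<beta> i)"
    by (rule poly_mapping_eqI) (simp add: lookup_add)
  then show "dcoeff ((partial_pow \<alpha> \<circ> partial_pow \<beta>) p) \<gamma> = dcoeff (partial_pow (\<lambda>i. \<alpha> i + \<beta> i) p) \<gamma>" for p :: "('n, 'k) polys" and \<gamma>
    by (simp add: dcoeff_partial_pow add.assoc)
qed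

lemma partial_pow_commute:
  "(partial_pow \<alpha> :: ('n::finite, 'k::field_char_0) operator) \<circ> partial_pow \<beta> = partial_pow \<beta> \<circ> partial_pow \<alpha>"
  by (simp add: partial_pow_add add.commute)

lemma partial_pow_zero: "(partial_pow (\<lambda>_. 0) :: ('n::finite, 'k::field_char_0) operator) = id"
proof (intro ext dcoeff_eqI)
  have "exp_of (\<lambda>_. 0) = (0 :: 'n \<Rightarrow>\<^sub>0 nat)" by (rule poly_mapping_eqI) simp
  then show "dcoeff (partial_pow (\<lambda>_. 0) p) \<gamma> = dcoeff (id p) \<gamma>" for p :: "('n, 'k) polys" and \<gamma>
    by (simp add: dcoeff_partial_pow)
qed

lemma partial_pow_unit:
  "(partial_pow (\<lambda>j. if j = i then 1 else 0) :: ('n::finite, 'k::field_char_0) operator) = partial_op i"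
proof (intro ext dcoeff_eqI)
  have "exp_of (\<lambda>j. if j = i then 1 else 0) = unit_exp i"
    by (rule poly_mapping_eqI) (simp add: lookup_single when_def)
  then show "dcoeff (partial_pow (\<lambda>j. if j = i then 1 else 0) p) \<gamma> = dcoeff (partial_op i p) \<gamma>" for p :: "('n, 'k) polys" and \<gamma>
    by (simp add: dcoeff_partial_pow)
qed

text \<open>Each \<partial>_i has the right inverse \<integral>_i. Surjectivity is what makes these
  operators left regular.\<close>

lemma surj_partial_pow: "surj (partial_pow \<alpha> :: ('n::finite, 'k::field_char_0) operator)"
proof (induction rule: partial_pow_induct)
  case (step i f)
  have "surj (partial_op i :: ('n, 'k) operator)" by (rule surjI[of _ "int_op i"]) (rule partial_int)
  then show ?case using step by (rule comp_surj[rotated])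
qed simp

text \<open>The commutation rule of the skew polynomial ring: H_i is diagonal with entry \<beta>_i +
  1, and the shift by \<alpha> raises this entry by \<alpha>_i.\<close>

lemma partial_pow_H:
  fixes p :: "('n::finite, 'k::field_char_0) polys"
  shows "partial_pow \<alpha> (H_op i p) =
    H_op i (partial_pow \<alpha> p) + scale_poly (of_nat (\<alpha> i)) (partial_pow \<alpha> p)"
  by (rule dcoeff_eqI) (simp add: dcoeff_partial_pow lookup_add algebra_simps)

section \<open>Functions that are polynomial in each variable\<close>

text \<open>One variable moves while the others are frozen, so univariate polynomials suffice. The
  general codomain admits both coefficients in the field and the integer-valued linear forms that
  produce a weight.\<close>

definition sep_poly :: "(('n \<Rightarrow>\<^sub>0 nat) \<Rightarrow> 'a::{idom, ring_char_0}) \<Rightarrow> bool" where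
  "sep_poly f \<longleftrightarrow> (\<forall>\<beta> i. \<exists>p. \<forall>k. f (Poly_Mapping.update i k \<beta>) = poly p (of_nat k))"

lemma sep_poly_const: "sep_poly (\<lambda>_. c)"
  unfolding sep_poly_def by (intro allI exI[of _ "[:c:]"]) simp

lemma sep_poly_lookup: "sep_poly (\<lambda>\<beta>. of_nat (Poly_Mapping.lookup \<beta> i))"
  unfolding sep_poly_def
proof (intro allI)
  fix \<beta> :: "'a \<Rightarrow>\<^sub>0 nat" and j
  show "\<exists>p. \<forall>k. of_nat (Poly_Mapping.lookup (Poly_Mapping.update j k \<beta>) i) = poly p (of_nat k :: 'b)"
    by (rule exI[of _ "if j = i then [:0, 1:] else [:of_nat (Poly_Mapping.lookup \<beta> i):]"])
      (simp add: lookup_update)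
qed

lemma sep_poly_add: "\<lbrakk>sep_poly f; sep_poly g\<rbrakk> \<Longrightarrow> sep_poly (\<lambda>\<beta>. f \<beta> + g \<beta>)"
  unfolding sep_poly_def by (metis poly_add)

lemma sep_poly_mult: "\<lbrakk>sep_poly f; sep_poly g\<rbrakk> \<Longrightarrow> sep_poly (\<lambda>\<beta>. f \<beta> * g \<beta>)"
  unfolding sep_poly_def by (metis poly_mult)

lemma sep_poly_sum: "(\<And>j. j \<in> A \<Longrightarrow> sep_poly (f j)) \<Longrightarrow> sep_poly (\<lambda>\<beta>. \<Sum>j\<in>A. f j \<beta>)"
  by (induction A rule: infinite_finite_induct) (simp_all add: sep_poly_const sep_poly_add)

lemma sep_poly_shift:
  assumes "sep_poly f"
  shows "sep_poly (\<lambda>\<beta>. f (\<beta> + \<gamma>))"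
  unfolding sep_poly_def
proof (intro allI)
  fix \<beta> i
  from assms obtain p where p: "\<forall>k. f (Poly_Mapping.update i k (\<beta> + \<gamma>)) = poly p (of_nat k)"
    unfolding sep_poly_def by blast
  \<comment> \<open>In the moving variable the shift becomes an argument shift, realized by
    composing with a linear polynomial; in all others it only moves the base point.\<close>
  have "Poly_Mapping.update i k \<beta> + \<gamma> = Poly_Mapping.update i (k + Poly_Mapping.lookup \<gamma> i) (\<beta> + \<gamma>)" for k
    by (rule poly_mapping_eqI) (simp add: lookup_add lookup_update)
  then show "\<exists>q. \<forall>k. f (Poly_Mapping.update i k \<beta> + \<gamma>) = poly q (of_nat k)"
    by (intro exI[of _ "p \<circ>\<^sub>p [:of_nat (Poly_Mapping.lookup \<gamma> i), 1:]"])
      (simp add: p poly_pcompose add.commute)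
qed

text \<open>
  Finitely many generic conditions can be
  satisfied simultaneously, which replaces a multivariate polynomial ring being a domain.
\<close>

primrec generic :: "'n list \<Rightarrow> (('n \<Rightarrow>\<^sub>0 nat) \<Rightarrow> bool) \<Rightarrow> ('n \<Rightarrow>\<^sub>0 nat) \<Rightarrow> bool" where
  "generic [] P \<alpha> = P \<alpha>"
| "generic (i # L) P \<alpha> = (\<forall>\<^sub>F k in sequentially. generic L P (Poly_Mapping.update i k \<alpha>))"

lemma generic_True: "generic L (\<lambda>_. True) \<alpha>"
  by (induction L arbitrary: \<alpha>) auto

lemma generic_conj: "\<lbrakk>generic L P \<alpha>; generic L Q \<alpha>\<rbrakk> \<Longrightarrow> generic L (\<lambda>\<beta>. P \<beta> \<and> Q \<beta>) \<alpha>"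
  by (induction L arbitrary: \<alpha>) (auto elim: eventually_elim2)

lemma generic_ball:
  "\<lbrakk>finite A; \<And>x. x \<in> A \<Longrightarrow> generic L (P x) \<alpha>\<rbrakk> \<Longrightarrow> generic L (\<lambda>\<beta>. \<forall>x\<in>A. P x \<beta>) \<alpha>"
  by (induction A rule: finite_induct) (auto simp: generic_True intro: generic_conj)

lemma generic_ex: "generic L P \<alpha> \<Longrightarrow> \<exists>\<beta>. P \<beta>"
proof (induction L arbitrary: \<alpha>)
  case (Cons i L)
  then have "\<exists>k. generic L P (Poly_Mapping.update i k \<alpha>)"
    by (auto dest: eventually_happens)
  with Cons.IH show ?case by blast
qed auto

text \<open>Two points are carried along: \<beta>, where f is nonzero, and \<alpha>, which is being
  filled in. Setting a variable to the same k in both keeps them equal outside the remaining list,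
  until they coincide. Only the finitely many roots of one polynomial are excluded for k.\<close>

lemma sep_poly_generic:
  assumes f: "sep_poly f" and "f \<beta> \<noteq> 0"
    and "\<And>j. j \<notin> set L \<Longrightarrow> Poly_Mapping.lookup \<beta> j = Poly_Mapping.lookup \<alpha> j"
  shows "generic L (\<lambda>\<gamma>. f \<gamma> \<noteq> 0) \<alpha>"
  using assms(2-)
proof (induction L arbitrary: \<alpha> \<beta>)
  case Nil
  then have "\<beta> = \<alpha>" by (intro poly_mapping_eqI) auto
  with Nil show ?case by simp
next
  case (Cons i L)
  obtain p where p: "\<And>k. f (Poly_Mapping.update i k \<beta>) = poly p (of_nat k)"
    using f unfolding sep_poly_def by blast
  have "Poly_Mapping.update i (Poly_Mapping.lookup \<beta> i) \<beta> = \<beta>"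
    by (rule poly_mapping_eqI) (simp add: lookup_update)
  then have "p \<noteq> 0" using Cons.prems(1) p by (metis poly_0)
  then have "finite {x. poly p x = 0}" by (rule poly_roots_finite)
  then have "finite (of_nat -` {x. poly p x = 0} :: nat set)"
    by (rule finite_vimageI) (simp add: inj_on_def)
  then have "\<forall>\<^sub>F k in sequentially. k \<notin> (of_nat -` {x. poly p x = 0} :: nat set)"
    by (simp add: cofinite_eq_sequentially[symmetric] eventually_cofinite)
  then have "\<forall>\<^sub>F k in sequentially. generic L (\<lambda>\<gamma>. f \<gamma> \<noteq> 0) (Poly_Mapping.update i k \<alpha>)"
  proof (rule eventually_mono)
    fix k assume "k \<notin> (of_nat -` {x. poly p x = 0} :: nat set)"
    then have "f (Poly_Mapping.update i k \<beta>) \<noteq> 0" using p by simp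
    then show "generic L (\<lambda>\<gamma>. f \<gamma> \<noteq> 0) (Poly_Mapping.update i k \<alpha>)"
      by (rule Cons.IH) (use Cons.prems(2) in \<open>auto simp: lookup_update\<close>)
  qed
  then show ?case by simp
qed

lemma sep_poly_common_nonzero:
  assumes "finite A" "\<And>f. f \<in> A \<Longrightarrow> sep_poly f" "\<And>f. f \<in> A \<Longrightarrow> \<exists>\<beta>. f \<beta> \<noteq> 0"
  shows "\<exists>\<beta> :: 'n::finite \<Rightarrow>\<^sub>0 nat. \<forall>f\<in>A. f \<beta> \<noteq> 0"
proof -
  \<comment> \<open>The list contains every variable, so each f may use its own nonvanishing point
    while all recursions start from the same point 0.\<close>
  obtain L where L: "set L = (UNIV :: 'n set)" using finite_list[OF finite[of "UNIV :: 'n set"]] by blast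
  have "generic L (\<lambda>\<gamma>. f \<gamma> \<noteq> 0) 0" if f: "f \<in> A" for f
  proof -
    obtain \<beta> where "f \<beta> \<noteq> 0" using assms(3)[OF f] by blast
    then show ?thesis by (rule sep_poly_generic[OF assms(2)[OF f]]) (simp add: L)
  qed
  then have "generic L (\<lambda>\<gamma>. \<forall>f\<in>A. f \<gamma> \<noteq> 0) 0" using assms(1) by (intro generic_ball) auto
  then show ?thesis by (rule generic_ex)
qed

lemma sep_poly_shift_nonzero:
  fixes f :: "('n::finite \<Rightarrow>\<^sub>0 nat) \<Rightarrow> 'a::{idom, ring_char_0}"
  assumes "sep_poly f" "f \<alpha> \<noteq> 0"
  shows "\<exists>\<beta>. f (\<beta> + \<gamma>) \<noteq> 0"
proof -
  \<comment> \<open>The values \<beta>_i - j for j < \<gamma>_i are added to the conditions: if none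
    of them vanishes, then \<beta>_i is at least \<gamma>_i, so that \<gamma> can be subtracted from
    \<beta>.\<close>
  define c where "c = (\<lambda>(i :: 'n, j) \<beta>. of_nat (Poly_Mapping.lookup \<beta> i) + (- of_nat j) :: 'a)"
  let ?A = "insert f (c ` (SIGMA i:UNIV. {..<Poly_Mapping.lookup \<gamma> i}))"
  have "\<exists>\<beta>. \<forall>g\<in>?A. g \<beta> \<noteq> 0"
  proof (rule sep_poly_common_nonzero)
    fix g assume g: "g \<in> ?A"
    show "sep_poly g"
    proof (cases "g = f")
      case False
      with g obtain i j where g: "g = c (i, j)" by auto
      show ?thesis
        unfolding g c_def prod.case by (rule sep_poly_add[OF sep_poly_lookup sep_poly_const])
    qed (use assms in simp)
    show "\<exists>\<beta>. g \<beta> \<noteq> 0"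
    proof (cases "g = f")
      case False
      with g obtain i j where "g = c (i, j)" by auto
      then have "g (Poly_Mapping.single i (Suc j)) = 1" by (simp add: c_def)
      then show ?thesis by (intro exI[of _ "Poly_Mapping.single i (Suc j)"]) simp
    qed (use assms in blast)
  qed simp
  then obtain \<beta> where "f \<beta> \<noteq> 0" and c: "\<And>i j. j < Poly_Mapping.lookup \<gamma> i \<Longrightarrow> c (i, j) \<beta> \<noteq> 0" by auto
  have "Poly_Mapping.lookup \<gamma> i \<le> Poly_Mapping.lookup \<beta> i" for i
    using c[of "Poly_Mapping.lookup \<beta> i" i] by (auto simp: c_def not_le[symmetric])
  then have "\<beta> = (\<beta> - \<gamma>) + \<gamma>" by (intro poly_mapping_eqI) (simp add: lookup_add lookup_minus)
  with \<open>f \<beta> \<noteq> 0\<close> show ?thesis by metis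
qed

lemma separating_weight:
  fixes G :: "('n::finite \<Rightarrow>\<^sub>0 nat) set"
  assumes "finite G"
  obtains w :: "('n \<Rightarrow>\<^sub>0 nat) \<Rightarrow> nat" where "inj_on w G" "\<And>\<gamma> \<gamma>'. w (\<gamma> + \<gamma>') = w \<gamma> + w \<gamma>'"
proof -
  \<comment> \<open>A weight vector v separates two exponents iff the linear form given by their
    difference does not vanish at v. Finitely many such nonzero forms have a common nonvanishing
    point, with natural number entries.\<close>
  define d where "d = (\<lambda>(\<gamma> :: 'n \<Rightarrow>\<^sub>0 nat, \<gamma>') v. \<Sum>i\<in>UNIV. of_nat (Poly_Mapping.lookup v i) *
    (int (Poly_Mapping.lookup \<gamma> i) - int (Poly_Mapping.lookup \<gamma>' i)))"
  let ?A = "d ` {(\<gamma>, \<gamma>') \<in> G \<times> G. \<gamma> \<noteq> \<gamma>'}"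
  have "finite {(\<gamma>, \<gamma>') \<in> G \<times> G. \<gamma> \<noteq> \<gamma>'}"
    by (rule finite_subset[of _ "G \<times> G"]) (use assms in auto)
  then have "\<exists>v. \<forall>f\<in>?A. f v \<noteq> 0"
  proof (intro sep_poly_common_nonzero finite_imageI)
    fix f assume "f \<in> ?A"
    then obtain \<gamma> \<gamma>' where f: "f = d (\<gamma>, \<gamma>')" "\<gamma> \<noteq> \<gamma>'" by auto
    show "sep_poly f"
      unfolding f d_def prod.case by (intro sep_poly_sum sep_poly_mult sep_poly_lookup sep_poly_const)
    from f obtain i where i: "Poly_Mapping.lookup \<gamma> i \<noteq> Poly_Mapping.lookup \<gamma>' i"
      by (metis poly_mapping_eqI)
    have "f (unit_exp i) = (\<Sum>j\<in>UNIV. if i = j then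
        int (Poly_Mapping.lookup \<gamma> j) - int (Poly_Mapping.lookup \<gamma>' j) else 0)"
      unfolding f d_def prod.case by (intro sum.cong) (auto simp: lookup_single when_def)
    then have "f (unit_exp i) \<noteq> 0" using i by simp
    then show "\<exists>v. f v \<noteq> 0" by blast
  qed
  then obtain v where v: "\<And>\<gamma> \<gamma>'. \<lbrakk>\<gamma> \<in> G; \<gamma>' \<in> G; \<gamma> \<noteq> \<gamma>'\<rbrakk> \<Longrightarrow> d (\<gamma>, \<gamma>') v \<noteq> 0" by auto
  define w where "w \<gamma> = (\<Sum>i\<in>UNIV. Poly_Mapping.lookup v i * Poly_Mapping.lookup \<gamma> i)" for \<gamma> :: "'n \<Rightarrow>\<^sub>0 nat"
  have "d (\<gamma>, \<gamma>') v = int (w \<gamma>) - int (w \<gamma>')" for \<gamma> \<gamma>'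
    by (simp add: d_def w_def sum_subtractf[symmetric] right_diff_distrib)
  then have "inj_on w G" using v by (intro inj_onI) fastforce
  moreover have "w (\<gamma> + \<gamma>') = w \<gamma> + w \<gamma>'" for \<gamma> \<gamma>'
    by (simp add: w_def lookup_add sum.distrib algebra_simps)
  ultimately show ?thesis by (rule that)
qed

section \<open>Difference operators\<close>

text \<open>The normal form \<Sum> h_\<gamma>(H) \<partial>^\<gamma> as seen on divided power
  coefficients. Requiring h to vanish off G allows two representations to be summed over the union
  of their supports.\<close>

definition diff_op_rep ::
  "('n \<Rightarrow>\<^sub>0 nat) set \<Rightarrow> (('n \<Rightarrow>\<^sub>0 nat) \<Rightarrow> ('n \<Rightarrow>\<^sub>0 nat) \<Rightarrow> 'k) \<Rightarrow> ('n::finite, 'k::field_char_0) operator \<Rightarrow> bool"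
  where
  "diff_op_rep G h \<delta> \<longleftrightarrow> finite G \<and> (\<forall>\<gamma>. sep_poly (h \<gamma>)) \<and> (\<forall>\<gamma>. \<gamma> \<notin> G \<longrightarrow> h \<gamma> = (\<lambda>_. 0)) \<and>
    (\<forall>p \<beta>. dcoeff (\<delta> p) \<beta> = (\<Sum>\<gamma>\<in>G. h \<gamma> \<beta> * dcoeff p (\<beta> + \<gamma>)))"

definition diff_op :: "('n::finite, 'k::field_char_0) operator \<Rightarrow> bool" where
  "diff_op \<delta> \<longleftrightarrow> (\<exists>G h. diff_op_rep G h \<delta>)"

lemma diff_op_shift:
  assumes "sep_poly h" "\<And>p \<beta>. dcoeff (\<delta> p) \<beta> = h \<beta> * dcoeff p (\<beta> + \<gamma>)"
  shows "diff_op \<delta>"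
proof -
  have "diff_op_rep {\<gamma>} (\<lambda>\<gamma>'. if \<gamma>' = \<gamma> then h else (\<lambda>_. 0)) \<delta>"
    using assms by (auto simp: diff_op_rep_def sep_poly_const)
  then show ?thesis unfolding diff_op_def by blast
qed

lemma diff_op_add:
  assumes "diff_op \<delta>" "diff_op \<epsilon>"
  shows "diff_op (\<lambda>p. \<delta> p + \<epsilon> p)"
proof -
  obtain G h G' h' where *: "diff_op_rep G h \<delta>" "diff_op_rep G' h' \<epsilon>"
    using assms unfolding diff_op_def by blast
  have "(\<Sum>\<gamma>\<in>G. h \<gamma> \<beta> * dcoeff p (\<beta> + \<gamma>)) = (\<Sum>\<gamma>\<in>G \<union> G'. h \<gamma> \<beta> * dcoeff p (\<beta> + \<gamma>))"
    "(\<Sum>\<gamma>\<in>G'. h' \<gamma> \<beta> * dcoeff p (\<beta> + \<gamma>)) = (\<Sum>\<gamma>\<in>G \<union> G'. h' \<gamma> \<beta> * dcoeff p (\<beta> + \<gamma>))" for p \<beta>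
    by (rule sum.mono_neutral_left; use * in \<open>auto simp: diff_op_rep_def\<close>)+
  then have "diff_op_rep (G \<union> G') (\<lambda>\<gamma> \<beta>. h \<gamma> \<beta> + h' \<gamma> \<beta>) (\<lambda>p. \<delta> p + \<epsilon> p)"
    using * by (auto simp: diff_op_rep_def sep_poly_add sum.distrib distrib_right)
  then show ?thesis unfolding diff_op_def by blast
qed

lemma diff_op_scale:
  assumes "diff_op \<delta>"
  shows "diff_op (\<lambda>p. scale_poly c (\<delta> p))"
proof -
  obtain G h where *: "diff_op_rep G h \<delta>" using assms unfolding diff_op_def by blast
  then have "diff_op_rep G (\<lambda>\<gamma> \<beta>. c * h \<gamma> \<beta>) (\<lambda>p. scale_poly c (\<delta> p))"
    by (auto simp: diff_op_rep_def sep_poly_mult sep_poly_const sum_distrib_left mult.assoc)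
  then show ?thesis unfolding diff_op_def by blast
qed

text \<open>The argument \<open>\<beta> + \<gamma>\<close> of \<open>h'\<close> is the twist by the
  automorphism that accompanies moving \<partial>^\<gamma> past a coefficient.\<close>

lemma diff_op_rep_comp:
  assumes "diff_op_rep G h \<delta>" "diff_op_rep G' h' \<epsilon>"
  shows "dcoeff (\<delta> (\<epsilon> p)) \<beta> =
    (\<Sum>(\<gamma>, \<gamma>')\<in>G \<times> G'. h \<gamma> \<beta> * h' \<gamma>' (\<beta> + \<gamma>) * dcoeff p (\<beta> + (\<gamma> + \<gamma>')))"
  using assms
  by (simp add: diff_op_rep_def sum_distrib_left sum.cartesian_product mult.assoc add.assoc)

lemma diff_op_comp:
  assumes "diff_op \<delta>" "diff_op \<epsilon>"
  shows "diff_op (\<delta> \<circ> \<epsilon>)"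
proof -
  obtain G h G' h' where *: "diff_op_rep G h \<delta>" "diff_op_rep G' h' \<epsilon>"
    using assms unfolding diff_op_def by blast
  then have fin: "finite G" "finite G'" and sp: "\<And>\<gamma>. sep_poly (h \<gamma>)" "\<And>\<gamma>. sep_poly (h' \<gamma>)"
    by (auto simp: diff_op_rep_def)
  define K where "K = (\<lambda>(\<gamma>, \<gamma>'). \<gamma> + \<gamma>') ` (G \<times> G')"
  \<comment> \<open>Several pairs of shifts may have the same sum. The double sum is regrouped along
    these fibres, and each fibre yields one coefficient function of the product.\<close>
  define F where "F \<eta> = {x \<in> G \<times> G'. (case x of (\<gamma>, \<gamma>') \<Rightarrow> \<gamma> + \<gamma>') = \<eta>}" for \<eta>
  define k where "k \<eta> \<beta> = (\<Sum>(\<gamma>, \<gamma>')\<in>F \<eta>. h \<gamma> \<beta> * h' \<gamma>' (\<beta> + \<gamma>))" for \<eta> \<beta>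
  have "diff_op_rep K k (\<delta> \<circ> \<epsilon>)"
    unfolding diff_op_rep_def
  proof (intro conjI allI impI)
    show "finite K" using fin by (simp add: K_def)
    show "sep_poly (k \<eta>)" for \<eta>
      unfolding k_def case_prod_beta by (intro sep_poly_sum sep_poly_mult sep_poly_shift sp)
    show "k \<eta> = (\<lambda>_. 0)" if "\<eta> \<notin> K" for \<eta>
    proof -
      have "F \<eta> = {}" using that by (auto simp: F_def K_def)
      then show ?thesis by (simp add: k_def fun_eq_iff)
    qed
    fix p \<beta>
    let ?s = "\<lambda>(\<gamma>, \<gamma>'). h \<gamma> \<beta> * h' \<gamma>' (\<beta> + \<gamma>) * dcoeff p (\<beta> + (\<gamma> + \<gamma>'))"
    have "dcoeff ((\<delta> \<circ> \<epsilon>) p) \<beta> = sum ?s (G \<times> G')" using diff_op_rep_comp[OF *] by simp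
    also have "\<dots> = (\<Sum>\<eta>\<in>K. sum ?s (F \<eta>))"
      unfolding F_def by (rule sum.group[symmetric]) (use fin in \<open>auto simp: K_def\<close>)
    also have "\<dots> = (\<Sum>\<eta>\<in>K. k \<eta> \<beta> * dcoeff p (\<beta> + \<eta>))"
      unfolding k_def sum_distrib_right
      by (intro sum.cong refl) (auto simp: F_def)
    finally show "dcoeff ((\<delta> \<circ> \<epsilon>) p) \<beta> = (\<Sum>\<eta>\<in>K. k \<eta> \<beta> * dcoeff p (\<beta> + \<eta>))" .
  qed
  then show ?thesis unfolding diff_op_def by blast
qed

text \<open>
  With respect to a generic weight, the leading shifts \<open>\<gamma>1\<close> and \<open>\<gamma>2\<close> of the two factors
  contribute a term to the product that no other pair of shifts can cancel.
\<close>

lemma diff_op_domain: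
  assumes \<delta>: "diff_op \<delta>" "\<delta> \<noteq> (\<lambda>_. 0)" and \<epsilon>: "diff_op \<epsilon>" "\<epsilon> \<noteq> (\<lambda>_. 0)"
  shows "\<delta> \<circ> \<epsilon> \<noteq> (\<lambda>_. 0)"
proof -
  obtain G h G' h' where *: "diff_op_rep G h \<delta>" "diff_op_rep G' h' \<epsilon>"
    using assms unfolding diff_op_def by blast
  then have fin: "finite G" "finite G'" and sp: "\<And>\<gamma>. sep_poly (h \<gamma>)" "\<And>\<gamma>. sep_poly (h' \<gamma>)"
    by (auto simp: diff_op_rep_def)
  \<comment> \<open>G may contain shifts whose coefficient function is zero; a leading shift has to
    be chosen among the others.\<close>
  define A where "A = {\<gamma> \<in> G. h \<gamma> \<noteq> (\<lambda>_. 0)}"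
  define A' where "A' = {\<gamma> \<in> G'. h' \<gamma> \<noteq> (\<lambda>_. 0)}"
  have nonempty: "{\<gamma> \<in> G. h \<gamma> \<noteq> (\<lambda>_. 0)} \<noteq> {}"
    if "diff_op_rep G h \<delta>" "\<delta> \<noteq> (\<lambda>_. 0)" for G h and \<delta> :: "('a, 'b) operator"
  proof
    assume "{\<gamma> \<in> G. h \<gamma> \<noteq> (\<lambda>_. 0)} = {}"
    then have "dcoeff (\<delta> p) \<beta> = 0" for p \<beta> using that(1) by (simp add: diff_op_rep_def)
    then have "\<delta> p = 0" for p by (intro dcoeff_eqI) simp
    then show False using that(2) by auto
  qed
  have A: "finite A" "A \<noteq> {}" "finite A'" "A' \<noteq> {}"
    unfolding A_def A'_def
    by (use fin in simp, rule nonempty[OF *(1) \<delta>(2)], use fin in simp, rule nonempty[OF *(2) \<epsilon>(2)])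
  obtain w :: "('a \<Rightarrow>\<^sub>0 nat) \<Rightarrow> nat" where w: "inj_on w (A \<union> A')" "\<And>\<gamma> \<gamma>'. w (\<gamma> + \<gamma>') = w \<gamma> + w \<gamma>'"
    using separating_weight[OF finite_UnI[OF A(1,3)]] by metis
  have max: "\<exists>m\<in>X. \<forall>x\<in>X. w x \<le> w m" if "finite X" "X \<noteq> {}" for X
  proof -
    have "Max (w ` X) \<in> w ` X" using that by (intro Max_in) auto
    then obtain m where "m \<in> X" "w m = Max (w ` X)" by (metis imageE)
    then show ?thesis using that by (intro bexI[of _ m]) auto
  qed
  obtain \<gamma>1 where \<gamma>1: "\<gamma>1 \<in> A" "\<And>\<gamma>. \<gamma> \<in> A \<Longrightarrow> w \<gamma> \<le> w \<gamma>1" using max[OF A(1,2)] by blast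
  obtain \<gamma>2 where \<gamma>2: "\<gamma>2 \<in> A'" "\<And>\<gamma>. \<gamma> \<in> A' \<Longrightarrow> w \<gamma> \<le> w \<gamma>2" using max[OF A(3,4)] by blast
  have unique: "\<gamma> = \<gamma>1 \<and> \<gamma>' = \<gamma>2" if "\<gamma> \<in> A" "\<gamma>' \<in> A'" "\<gamma> + \<gamma>' = \<gamma>1 + \<gamma>2" for \<gamma> \<gamma>'
  proof -
    have "w \<gamma> + w \<gamma>' = w \<gamma>1 + w \<gamma>2" using w(2) that(3) by metis
    then have "w \<gamma> = w \<gamma>1" "w \<gamma>' = w \<gamma>2" using \<gamma>1(2)[OF that(1)] \<gamma>2(2)[OF that(2)] by auto
    then show ?thesis using w(1) that \<gamma>1(1) \<gamma>2(1) by (auto simp: inj_on_def)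
  qed
  \<comment> \<open>The second leading coefficient enters the product after a shift by
    \<open>\<gamma>1\<close>, so it must remain nonzero as a function of the shifted argument before
    a common point can be picked.\<close>
  have "\<exists>\<beta>. \<forall>f\<in>{h \<gamma>1, \<lambda>\<beta>. h' \<gamma>2 (\<beta> + \<gamma>1)}. f \<beta> \<noteq> 0"
  proof (rule sep_poly_common_nonzero)
    fix f assume f: "f \<in> {h \<gamma>1, \<lambda>\<beta>. h' \<gamma>2 (\<beta> + \<gamma>1)}"
    then show "sep_poly f" using sp sep_poly_shift by auto
    obtain \<alpha> \<alpha>' where "h \<gamma>1 \<alpha> \<noteq> 0" "h' \<gamma>2 \<alpha>' \<noteq> 0" using \<gamma>1(1) \<gamma>2(1) by (auto simp: A_def A'_def fun_eq_iff)
    then show "\<exists>\<beta>. f \<beta> \<noteq> 0" using f sep_poly_shift_nonzero[OF sp(2)] by auto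
  qed simp
  then obtain \<beta> where \<beta>: "h \<gamma>1 \<beta> \<noteq> 0" "h' \<gamma>2 (\<beta> + \<gamma>1) \<noteq> 0" by auto
  \<comment> \<open>A monomial at exactly this exponent, so that the coefficient at \<beta> only
    receives pairs of shifts with sum \<open>\<gamma>1 + \<gamma>2\<close>.\<close>
  define p :: "('a, 'b) polys" where "p = Poly_Mapping.single (\<beta> + (\<gamma>1 + \<gamma>2)) 1"
  have p: "dcoeff p \<eta> = 0 \<longleftrightarrow> \<eta> \<noteq> \<beta> + (\<gamma>1 + \<gamma>2)" for \<eta>
    by (auto simp: dcoeff_def p_def lookup_single when_def)
  let ?s = "\<lambda>(\<gamma>, \<gamma>'). h \<gamma> \<beta> * h' \<gamma>' (\<beta> + \<gamma>) * dcoeff p (\<beta> + (\<gamma> + \<gamma>'))"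
  have zero: "?s x = 0" if "x \<in> G \<times> G' - {(\<gamma>1, \<gamma>2)}" for x
  proof (rule ccontr)
    assume nz: "?s x \<noteq> 0"
    obtain \<gamma> \<gamma>' where x: "x = (\<gamma>, \<gamma>')" by (cases x)
    from nz have "h \<gamma> \<beta> \<noteq> 0" "h' \<gamma>' (\<beta> + \<gamma>) \<noteq> 0" "dcoeff p (\<beta> + (\<gamma> + \<gamma>')) \<noteq> 0" by (auto simp: x)
    then have "\<gamma> \<in> A" "\<gamma>' \<in> A'" "\<gamma> + \<gamma>' = \<gamma>1 + \<gamma>2"
      using that by (auto simp: A_def A'_def x p fun_eq_iff)
    then show False using unique that x by auto
  qed
  have "dcoeff ((\<delta> \<circ> \<epsilon>) p) \<beta> = sum ?s (G \<times> G')" using diff_op_rep_comp[OF *] by simp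
  also have "\<dots> = sum ?s {(\<gamma>1, \<gamma>2)}"
    by (rule sum.mono_neutral_right) (use zero fin \<gamma>1(1) \<gamma>2(1) in \<open>auto simp: A_def A'_def\<close>)
  also have "\<dots> \<noteq> 0" using \<beta> p by simp
  finally show ?thesis by (metis dcoeff_zero)
qed

section \<open>The algebra of integro-differential operators\<close>

lemma int_diff_alg_simps [simp]:
  "f \<otimes>\<^bsub>int_diff_alg\<^esub> g = f \<circ> g" "\<one>\<^bsub>int_diff_alg\<^esub> = id" "\<zero>\<^bsub>int_diff_alg\<^esub> = (\<lambda>_. 0)"
  "f \<oplus>\<^bsub>int_diff_alg\<^esub> g = (\<lambda>p. f p + g p)" "c \<odot>\<^bsub>int_diff_alg\<^esub> f = (\<lambda>p. scale_poly c (f p))"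
  by (simp_all add: int_diff_alg_def End_alg_def)

lemma End_alg_simps:
  "f \<otimes>\<^bsub>End_alg\<^esub> g = f \<circ> g" "\<one>\<^bsub>End_alg\<^esub> = id"
  "f \<oplus>\<^bsub>End_alg\<^esub> g = (\<lambda>p. f p + g p)" "c \<odot>\<^bsub>End_alg\<^esub> f = (\<lambda>p. scale_poly c (f p))"
  by (simp_all add: End_alg_def)

lemma End_alg_scaled_ring: "scaled_ring (End_alg :: ('k::field, ('n, 'k) operator) module)"
  by (intro scaled_ring.intro End_alg_ring scaled_ring_axioms.intro)
    (auto simp: End_alg_def linear_scale_poly_iff scale_poly.scale_right_distrib mult.commute)

lemma End_alg_minus:
  fixes f :: "('n, 'k::field) operator"
  assumes f: "f \<in> carrier End_alg"
  shows "\<ominus>\<^bsub>End_alg\<^esub> f = (\<lambda>p. - f p)"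
proof -
  interpret E: ring "End_alg :: ('k::field, ('n, 'k) operator) module" by (rule End_alg_ring)
  have "(\<lambda>p. - f p) \<in> carrier End_alg"
    using f by (auto simp: End_alg_def linear_scale_poly_iff scale_poly.scale_minus_right)
  then show ?thesis
    by (intro E.minus_equality f) (auto simp: End_alg_def)
qed

lemma int_diff_gens:
  "range x_op \<union> range partial_op \<union> range int_op \<subseteq> carrier (End_alg :: ('k::field, ('n, 'k) operator) module)"
  by (auto simp: End_alg_def partial_op_def int_op_def linear_ext_linear x_op_linear)

lemmas int_diff_generated = scaled_ring.generated_subalgebra[OF End_alg_scaled_ring int_diff_gens]

lemma carrier_int_diff_alg:
  "carrier int_diff_alg = generated_subalgebra End_alg (range x_op \<union> range partial_op \<union> range int_op)"
  by (simp add: int_diff_alg_def)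

lemma int_diff_alg_scaled_ring:
  "scaled_ring (int_diff_alg :: ('k::field_char_0, ('n::finite, 'k) operator) module)"
  unfolding int_diff_alg_def
  by (intro scaled_ring.subalgebra_scaled_ring End_alg_scaled_ring int_diff_generated)

lemma int_diff_linear:
  assumes "f \<in> carrier int_diff_alg"
  shows "f (p + q) = f p + f q" "f (scale_poly c p) = scale_poly c (f p)"
  using assms subringE(1)[OF int_diff_alg_subring]
  by (auto simp: End_alg_def linear_scale_poly_iff)

lemma int_diff_gens_mem [simp, intro]:
  "x_op i \<in> carrier int_diff_alg" "partial_op i \<in> carrier int_diff_alg" "int_op i \<in> carrier int_diff_alg"
  using int_diff_generated(3) by (auto simp: carrier_int_diff_alg)

lemma int_diff_closed:
  fixes f g :: "('n::finite, 'k::field_char_0) operator"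
  assumes f: "f \<in> carrier int_diff_alg"
  shows int_diff_comp: "g \<in> carrier int_diff_alg \<Longrightarrow> f \<circ> g \<in> carrier int_diff_alg"
    and int_diff_add: "g \<in> carrier int_diff_alg \<Longrightarrow> (\<lambda>p. f p + g p) \<in> carrier int_diff_alg"
    and int_diff_scale: "(\<lambda>p. scale_poly c (f p)) \<in> carrier int_diff_alg"
proof -
  interpret scaled_ring "int_diff_alg :: ('k, ('n, 'k) operator) module" by (rule int_diff_alg_scaled_ring)
  show "g \<in> carrier int_diff_alg \<Longrightarrow> f \<circ> g \<in> carrier int_diff_alg"
    using m_closed[OF f, of g] unfolding int_diff_alg_simps .
  show "g \<in> carrier int_diff_alg \<Longrightarrow> (\<lambda>p. f p + g p) \<in> carrier int_diff_alg"
    using a_closed[OF f, of g] unfolding int_diff_alg_simps .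
  show "(\<lambda>p. scale_poly c (f p)) \<in> carrier int_diff_alg"
    using smult_closed[OF f, of c] unfolding int_diff_alg_simps .
qed

lemma id_int_diff [simp, intro]: "id \<in> carrier (int_diff_alg :: ('k::field_char_0, ('n::finite, 'k) operator) module)"
  using monoid.one_closed[OF ring.is_monoid[OF int_diff_alg_ring]] by simp

lemma H_op_mem [simp, intro]: "H_op i \<in> carrier int_diff_alg"
  unfolding H_op_def by (intro int_diff_comp int_diff_gens_mem)

text \<open>Lets negation be handled by the scalar case, so that the induction rules for both
  algebras have no case for it.\<close>

lemma uminus_eq_scale: "(\<lambda>p. - f p) = (\<lambda>p. scale_poly (- 1) (f p))"
  by (simp add: scale_poly.scale_minus_left)

lemma int_diff_minus:
  fixes f :: "('n::finite, 'k::field_char_0) operator"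
  assumes f: "f \<in> carrier int_diff_alg"
  shows "\<ominus>\<^bsub>int_diff_alg\<^esub> f = (\<lambda>p. - f p)"
proof -
  interpret ring "int_diff_alg :: ('k, ('n, 'k) operator) module" by (rule int_diff_alg_ring)
  have "(\<lambda>p. - f p) \<in> carrier int_diff_alg" unfolding uminus_eq_scale by (rule int_diff_scale[OF f])
  then show ?thesis by (intro minus_equality f) auto
qed

lemma int_diff_induct [consumes 1, case_names x partial int id add scale comp]:
  fixes f :: "('n::finite, 'k::field_char_0) operator"
  assumes f: "f \<in> carrier int_diff_alg"
    and gens: "\<And>i. P (x_op i)" "\<And>i. P (partial_op i)" "\<And>i. P (int_op i)" and id: "P id"
    and add: "\<And>f g. \<lbrakk>f \<in> carrier int_diff_alg; g \<in> carrier int_diff_alg; P f; P g\<rbrakk> \<Longrightarrow> P (\<lambda>p. f p + g p)"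
    and scale: "\<And>c f. \<lbrakk>f \<in> carrier int_diff_alg; P f\<rbrakk> \<Longrightarrow> P (\<lambda>p. scale_poly c (f p))"
    and comp: "\<And>f g. \<lbrakk>f \<in> carrier int_diff_alg; g \<in> carrier int_diff_alg; P f; P g\<rbrakk> \<Longrightarrow> P (f \<circ> g)"
  shows "P f"
  using f unfolding carrier_int_diff_alg
proof (induction rule: scaled_ring.generated_subalgebra_induct[OF End_alg_scaled_ring _ int_diff_gens,
    consumes 1, case_names gen one add minus mult smult])
  case (gen u)
  then show ?case using gens by auto
next
  case one
  show ?case unfolding End_alg_simps by (rule id)
next
  case (add u v)
  show ?case unfolding End_alg_simps
    by (rule assms(6)) (use add in \<open>simp_all only: carrier_int_diff_alg\<close>)
next
  case (minus u)
  then have u: "u \<in> carrier int_diff_alg" by (simp only: carrier_int_diff_alg)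
  then have "u \<in> carrier End_alg" using subringE(1)[OF int_diff_alg_subring] by blast
  then show ?case
    unfolding End_alg_minus[OF \<open>u \<in> carrier End_alg\<close>] uminus_eq_scale by (intro scale u minus(2))
next
  case (mult u v)
  show ?case unfolding End_alg_simps
    by (rule comp) (use mult in \<open>simp_all only: carrier_int_diff_alg\<close>)
next
  case (smult c u)
  show ?case unfolding End_alg_simps
    by (rule scale) (use smult in \<open>simp_all only: carrier_int_diff_alg\<close>)
qed

section \<open>The subalgebra Delta and reduction into it\<close>

lemma Delta_gens:
  "range H_op \<union> range partial_op \<subseteq> carrier (int_diff_alg :: ('k::field_char_0, ('n::finite, 'k) operator) module)"
  by auto

lemmas Delta_generated =
  scaled_ring.generated_subalgebra[OF int_diff_alg_scaled_ring Delta_gens, folded Delta_def]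

lemma Delta_carrier: "f \<in> Delta \<Longrightarrow> f \<in> carrier int_diff_alg"
  using subringE(1)[OF Delta_generated(1)] by blast

lemma Delta_closed:
  fixes f g :: "('n::finite, 'k::field_char_0) operator"
  shows H_Delta: "H_op i \<in> Delta" and partial_Delta: "partial_op i \<in> Delta" and id_Delta: "id \<in> Delta"
    and comp_Delta: "\<lbrakk>f \<in> Delta; g \<in> Delta\<rbrakk> \<Longrightarrow> f \<circ> g \<in> Delta"
    and add_Delta: "\<lbrakk>f \<in> Delta; g \<in> Delta\<rbrakk> \<Longrightarrow> (\<lambda>p. f p + g p) \<in> Delta"
    and scale_Delta: "f \<in> Delta \<Longrightarrow> (\<lambda>p. scale_poly c (f p)) \<in> Delta"
  using Delta_generated(2)[of f c] Delta_generated(3) subringE(3)[OF Delta_generated(1)]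
    subringE(6,7)[OF Delta_generated(1), of f g]
  unfolding int_diff_alg_simps by blast+

lemma Delta_induct [consumes 1, case_names H partial id add scale comp]:
  fixes f :: "('n::finite, 'k::field_char_0) operator"
  assumes f: "f \<in> Delta"
    and gens: "\<And>i. P (H_op i)" "\<And>i. P (partial_op i)" and id: "P id"
    and add: "\<And>f g. \<lbrakk>f \<in> Delta; g \<in> Delta; P f; P g\<rbrakk> \<Longrightarrow> P (\<lambda>p. f p + g p)"
    and scale: "\<And>c f. \<lbrakk>f \<in> Delta; P f\<rbrakk> \<Longrightarrow> P (\<lambda>p. scale_poly c (f p))"
    and comp: "\<And>f g. \<lbrakk>f \<in> Delta; g \<in> Delta; P f; P g\<rbrakk> \<Longrightarrow> P (f \<circ> g)"
  shows "P f"
  using f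
proof (induction rule: scaled_ring.generated_subalgebra_induct[OF int_diff_alg_scaled_ring _ Delta_gens,
    folded Delta_def, consumes 1, case_names gen one add minus mult smult])
  case (gen u)
  then show ?case using gens by auto
next
  case one
  show ?case unfolding int_diff_alg_simps by (rule id)
next
  case (add u v)
  then show ?case unfolding int_diff_alg_simps by (rule assms(5))
next
  case (minus u)
  show ?case
    unfolding int_diff_minus[OF Delta_carrier[OF minus(1)]] uminus_eq_scale by (rule scale[OF minus])
next
  case (mult u v)
  then show ?case unfolding int_diff_alg_simps by (rule comp)
next
  case (smult c u)
  then show ?case unfolding int_diff_alg_simps by (rule scale)
qed

lemma Delta_diff_op: "f \<in> Delta \<Longrightarrow> diff_op f"
proof (induction rule: Delta_induct)
  case (H i)
  show ?case
    by (rule diff_op_shift[where h = "\<lambda>\<beta>. of_nat (Poly_Mapping.lookup \<beta> i) + 1" and \<gamma> = 0])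
      (simp_all add: sep_poly_add sep_poly_lookup sep_poly_const)
next
  case (partial i)
  show ?case by (rule diff_op_shift[where h = "\<lambda>_. 1" and \<gamma> = "unit_exp i"]) (simp_all add: sep_poly_const)
next
  case id
  show ?case by (rule diff_op_shift[where h = "\<lambda>_. 1" and \<gamma> = 0]) (simp_all add: sep_poly_const)
qed (rule diff_op_add diff_op_scale diff_op_comp; assumption)+

lemma partial_pow_Delta: "partial_pow \<alpha> \<in> Delta"
  by (rule partial_pow_induct) (intro Delta_closed)+

lemma partial_pow_carrier [simp, intro]: "partial_pow \<alpha> \<in> carrier int_diff_alg"
  by (rule Delta_carrier[OF partial_pow_Delta])

text \<open>The same \<partial>^\<alpha> appears on both sides, because it commutes with each
  \<partial>_i and passes H_i at the cost of the scalar \<alpha>_i.\<close>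

lemma Delta_ore:
  "f \<in> Delta \<Longrightarrow> \<exists>g\<in>Delta. partial_pow \<alpha> \<circ> f = g \<circ> partial_pow \<alpha>"
proof (induction rule: Delta_induct)
  case (H i)
  show ?case
    by (intro bexI[of _ "\<lambda>p. H_op i p + scale_poly (of_nat (\<alpha> i)) (id p)"] Delta_closed)
      (simp add: fun_eq_iff partial_pow_H)
next
  case (partial i)
  show ?case
    using partial_pow_commute[of \<alpha> "\<lambda>j. if j = i then 1 else 0"] partial_Delta[of i]
    unfolding partial_pow_unit by (rule bexI)
next
  case id
  show ?case by (intro bexI[of _ id] id_Delta) simp
next
  case (add f g)
  then obtain f' g' where "f' \<in> Delta" "g' \<in> Delta"
    "partial_pow \<alpha> \<circ> f = f' \<circ> partial_pow \<alpha>" "partial_pow \<alpha> \<circ> g = g' \<circ> partial_pow \<alpha>" by blast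
  then show ?case
    by (intro bexI[of _ "\<lambda>p. f' p + g' p"] Delta_closed)
      (simp_all add: fun_eq_iff int_diff_linear)
next
  case (scale c f)
  then obtain f' where "f' \<in> Delta" "partial_pow \<alpha> \<circ> f = f' \<circ> partial_pow \<alpha>" by blast
  then show ?case
    by (intro bexI[of _ "\<lambda>p. scale_poly c (f' p)"] Delta_closed)
      (simp_all add: fun_eq_iff int_diff_linear)
next
  case (comp f g)
  then obtain f' g' where "f' \<in> Delta" "g' \<in> Delta"
    "partial_pow \<alpha> \<circ> f = f' \<circ> partial_pow \<alpha>" "partial_pow \<alpha> \<circ> g = g' \<circ> partial_pow \<alpha>" by blast
  then show ?case
    by (intro bexI[of _ "f' \<circ> g'"] Delta_closed) (simp_all add: fun_eq_iff)
qed

text \<open>For the generators, \<partial>_i x_i = H_i and \<partial>_i \<integral>_i = 1. A sum is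
  reduced by the product of the two powers, which commute.\<close>

lemma int_diff_reduce:
  fixes f :: "('n::finite, 'k::field_char_0) operator"
  shows "f \<in> carrier int_diff_alg \<Longrightarrow> \<exists>\<alpha>. partial_pow \<alpha> \<circ> f \<in> Delta"
proof (induction rule: int_diff_induct)
  case (x i)
  have "(partial_op i :: ('n, 'k) operator) \<circ> x_op i \<in> Delta" by (simp only: H_op_def[symmetric] H_Delta)
  then show ?case using partial_pow_unit by metis
next
  case (partial i)
  show ?case
    by (rule exI[of _ "\<lambda>_. 0"]) (simp only: partial_pow_zero id_comp Delta_closed)
next
  case (int i)
  have "(partial_op i :: ('n, 'k) operator) \<circ> int_op i = id" by (intro ext) (simp only: o_apply id_apply partial_int)
  then have "(partial_op i :: ('n, 'k) operator) \<circ> int_op i \<in> Delta" by (simp only: id_Delta)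
  then show ?case using partial_pow_unit by metis
next
  case id
  show ?case
    by (rule exI[of _ "\<lambda>_. 0"]) (simp only: partial_pow_zero id_comp Delta_closed)
next
  case (add f g)
  then obtain \<alpha> \<beta> where \<alpha>: "partial_pow \<alpha> \<circ> f \<in> Delta" and \<beta>: "partial_pow \<beta> \<circ> g \<in> Delta" by blast
  have "partial_pow (\<lambda>i. \<beta> i + \<alpha> i) \<circ> (\<lambda>p. f p + g p) =
      (\<lambda>p. (partial_pow \<beta> \<circ> (partial_pow \<alpha> \<circ> f)) p + (partial_pow \<alpha> \<circ> (partial_pow \<beta> \<circ> g)) p)"
    using fun_cong[OF partial_pow_commute, of \<alpha> \<beta> "g p" for p] by (simp add: fun_eq_iff int_diff_linear partial_pow_add[symmetric])
  also have "\<dots> \<in> Delta" by (intro add_Delta comp_Delta partial_pow_Delta \<alpha> \<beta>)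
  finally show ?case by blast
next
  case (scale c f)
  then obtain \<alpha> where "partial_pow \<alpha> \<circ> f \<in> Delta" by blast
  then have "(\<lambda>p. scale_poly c ((partial_pow \<alpha> \<circ> f) p)) \<in> Delta" by (rule scale_Delta)
  moreover have "(\<lambda>p. scale_poly c ((partial_pow \<alpha> \<circ> f) p)) = partial_pow \<alpha> \<circ> (\<lambda>p. scale_poly c (f p))"
    by (simp add: fun_eq_iff int_diff_linear)
  ultimately show ?case by metis
next
  case (comp f g)
  then obtain \<alpha> \<beta> where \<alpha>: "partial_pow \<alpha> \<circ> f \<in> Delta" and \<beta>: "partial_pow \<beta> \<circ> g \<in> Delta" by blast
  \<comment> \<open>In a product, the power that reduces g must first be carried past the already
    reduced f, which is possible inside Delta.\<close>
  obtain h where h: "h \<in> Delta" "partial_pow \<beta> \<circ> (partial_pow \<alpha> \<circ> f) = h \<circ> partial_pow \<beta>"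
    using Delta_ore[OF \<alpha>] by blast
  have "partial_pow (\<lambda>i. \<beta> i + \<alpha> i) \<circ> (f \<circ> g) = (partial_pow \<beta> \<circ> (partial_pow \<alpha> \<circ> f)) \<circ> g"
    by (simp add: partial_pow_add[symmetric] o_assoc)
  also have "\<dots> = h \<circ> (partial_pow \<beta> \<circ> g)" unfolding h(2) by (rule o_assoc[symmetric])
  also have "\<dots> \<in> Delta" by (intro comp_Delta h \<beta>)
  finally show ?case by blast
qed

text \<open>One extra \<partial>_i turns x_i into H_i and \<integral>_i into 1, which reduces these
  generators to Delta. The exponent \<alpha> has to be arbitrary in the induction, because in a
  product the power found for the right factor becomes the one prescribed for the left
  factor.\<close>

lemma int_diff_ore:
  fixes f :: "('n::finite, 'k::field_char_0) operator"
  shows "f \<in> carrier int_diff_alg \<Longrightarrow>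
    \<exists>\<beta>. \<exists>g\<in>carrier int_diff_alg. partial_pow \<beta> \<circ> f = g \<circ> partial_pow \<alpha>"
proof (induction arbitrary: \<alpha> rule: int_diff_induct)
  case (x i)
  obtain g :: "('n, 'k) operator" where g: "g \<in> Delta" "partial_pow \<alpha> \<circ> H_op i = g \<circ> partial_pow \<alpha>"
    using Delta_ore[OF H_Delta] by blast
  have "partial_pow (\<lambda>j. \<alpha> j + (if j = i then 1 else 0)) \<circ> (x_op i :: ('n, 'k) operator) = partial_pow \<alpha> \<circ> H_op i"
    by (simp only: partial_pow_add[symmetric] partial_pow_unit H_op_def o_assoc)
  with g(2) have "partial_pow (\<lambda>j. \<alpha> j + (if j = i then 1 else 0)) \<circ> x_op i = g \<circ> partial_pow \<alpha>"
    by (rule trans[rotated])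
  then show ?case using Delta_carrier[OF g(1)] by blast
next
  case (partial i)
  show ?case using Delta_ore[OF partial_Delta] Delta_carrier by blast
next
  case (int i)
  have "partial_pow (\<lambda>j. \<alpha> j + (if j = i then 1 else 0)) \<circ> (int_op i :: ('n, 'k) operator) = id \<circ> partial_pow \<alpha>"
    by (simp add: partial_pow_add[symmetric] partial_pow_unit fun_eq_iff partial_int)
  then show ?case by blast
next
  case id
  show ?case by (intro exI[of _ \<alpha>] bexI[of _ id]) auto
next
  case (add f g)
  then obtain \<beta> f' \<beta>' g' where *: "f' \<in> carrier int_diff_alg" "partial_pow \<beta> \<circ> f = f' \<circ> partial_pow \<alpha>"
    "g' \<in> carrier int_diff_alg" "partial_pow \<beta>' \<circ> g = g' \<circ> partial_pow \<alpha>" by metis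
  have "partial_pow (\<lambda>i. \<beta>' i + \<beta> i) \<circ> (\<lambda>p. f p + g p) =
      (\<lambda>p. (partial_pow \<beta>' \<circ> (partial_pow \<beta> \<circ> f)) p + (partial_pow \<beta> \<circ> (partial_pow \<beta>' \<circ> g)) p)"
    using fun_cong[OF partial_pow_commute, of \<beta> \<beta>' "g p" for p] by (simp add: fun_eq_iff int_diff_linear partial_pow_add[symmetric])
  also have "\<dots> = (\<lambda>p. (partial_pow \<beta>' \<circ> f') p + (partial_pow \<beta> \<circ> g') p) \<circ> partial_pow \<alpha>"
    unfolding * by (simp add: fun_eq_iff)
  finally show ?case using * by (blast intro: int_diff_closed partial_pow_carrier)
next
  case (scale c f)
  then obtain \<beta> f' where *: "f' \<in> carrier int_diff_alg" "partial_pow \<beta> \<circ> f = f' \<circ> partial_pow \<alpha>" by metis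
  then have "partial_pow \<beta> \<circ> (\<lambda>p. scale_poly c (f p)) = (\<lambda>p. scale_poly c (f' p)) \<circ> partial_pow \<alpha>"
    by (simp add: fun_eq_iff int_diff_linear)
  then show ?case using * by (blast intro: int_diff_closed)
next
  case (comp f g)
  obtain \<beta> g' where g: "g' \<in> carrier int_diff_alg" "partial_pow \<beta> \<circ> g = g' \<circ> partial_pow \<alpha>"
    using comp(4) by blast
  obtain \<gamma> f' where f: "f' \<in> carrier int_diff_alg" "partial_pow \<gamma> \<circ> f = f' \<circ> partial_pow \<beta>"
    using comp(3) by blast
  have "partial_pow \<gamma> \<circ> (f \<circ> g) = (f' \<circ> partial_pow \<beta>) \<circ> g" by (simp add: f(2)[symmetric] o_assoc)
  also have "\<dots> = (f' \<circ> g') \<circ> partial_pow \<alpha>" by (simp only: o_assoc[symmetric] g(2))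
  finally show ?case using f g by (blast intro: int_diff_closed)
qed

section \<open>The Ore set of the \<partial>^\<alpha>\<close>

lemma partial_pow_left_regular:
  fixes f :: "('n::finite, 'k::field_char_0) operator"
  assumes "f \<circ> partial_pow \<alpha> = (\<lambda>_. 0)"
  shows "f = (\<lambda>_. 0)"
proof
  fix p :: "('n, 'k) polys"
  obtain q where "p = partial_pow \<alpha> q" using surjD[OF surj_partial_pow[of \<alpha>], of p] by (rule exE)
  then show "f p = 0" using fun_cong[OF assms, of q] by simp
qed

lemma partial_pow_left_denominator:
  "left_denominator_set (int_diff_alg :: ('k::field_char_0, ('n::finite, 'k) operator) module) (range partial_pow)"
proof (rule left_denominator_setI)
  show "\<one>\<^bsub>int_diff_alg\<^esub> \<in> range (partial_pow :: _ \<Rightarrow> ('n, 'k) operator)"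
    using partial_pow_zero by (metis int_diff_alg_simps(2) rangeI)
  show "\<zero>\<^bsub>int_diff_alg\<^esub> \<notin> range (partial_pow :: _ \<Rightarrow> ('n, 'k) operator)"
  proof
    assume "\<zero>\<^bsub>int_diff_alg\<^esub> \<in> range (partial_pow :: _ \<Rightarrow> ('n, 'k) operator)"
    then obtain \<alpha> where "partial_pow \<alpha> = (\<lambda>_. 0 :: ('n, 'k) polys)" by auto
    then have "(1 :: ('n, 'k) polys) = 0" using surj_partial_pow[of \<alpha>] by (metis surjD)
    then show False by simp
  qed
  fix r x :: "('n, 'k) operator" assume r: "r \<in> carrier int_diff_alg" and "x \<in> range partial_pow"
  then obtain \<alpha> where x: "x = partial_pow \<alpha>" by blast
  show "\<exists>u\<in>range partial_pow. \<exists>a\<in>carrier int_diff_alg. u \<otimes>\<^bsub>int_diff_alg\<^esub> r = a \<otimes>\<^bsub>int_diff_alg\<^esub> x"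
    using int_diff_ore[OF r, of \<alpha>] by (auto simp: x)
  show "\<exists>t\<in>range partial_pow. t \<otimes>\<^bsub>int_diff_alg\<^esub> r = \<zero>\<^bsub>int_diff_alg\<^esub>"
    if "r \<otimes>\<^bsub>int_diff_alg\<^esub> x = \<zero>\<^bsub>int_diff_alg\<^esub>"
  proof -
    have "r = (\<lambda>_. 0)" using that partial_pow_left_regular by (simp add: x)
    moreover have "id \<in> range (partial_pow :: _ \<Rightarrow> ('n, 'k) operator)"
      using partial_pow_zero by (metis rangeI)
    ultimately show ?thesis by (intro bexI[of _ id]) simp_all
  qed
qed (auto simp: partial_pow_add)

lemma int_diff_regular_ore_extension:
  "regular_ore_extension (int_diff_alg :: ('k::field_char_0, ('n::finite, 'k) operator) module)
    (range partial_pow) Delta"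
proof -
  show ?thesis
  proof (intro regular_ore_extension.intro regular_ore_extension_axioms.intro
      left_localization.intro left_localization_axioms.intro)
    show "scaled_ring (int_diff_alg :: ('k, ('n, 'k) operator) module)" by (rule int_diff_alg_scaled_ring)
    show "left_denominator_set (int_diff_alg :: ('k, ('n, 'k) operator) module) (range partial_pow)"
      by (rule partial_pow_left_denominator)
    show "range partial_pow \<subseteq> left_regular (int_diff_alg :: ('k, ('n, 'k) operator) module)"
      using partial_pow_left_regular by (auto simp: left_regular_def)
    show "subring Delta (int_diff_alg :: ('k, ('n, 'k) operator) module)" by (rule Delta_generated)
    show "range partial_pow \<subseteq> (Delta :: ('n, 'k) operator set)" using partial_pow_Delta by blast
    fix x y r :: "('n, 'k) operator" and c
    show "c \<odot>\<^bsub>int_diff_alg\<^esub> x \<in> Delta" if "x \<in> Delta" using scale_Delta[OF that] by simp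
    show "\<exists>t\<in>range partial_pow. t \<otimes>\<^bsub>int_diff_alg\<^esub> r \<in> Delta" if "r \<in> carrier int_diff_alg"
      using int_diff_reduce[OF that] by auto
    show "x = \<zero>\<^bsub>int_diff_alg\<^esub> \<or> y = \<zero>\<^bsub>int_diff_alg\<^esub>"
      if "x \<in> Delta" "y \<in> Delta" "x \<otimes>\<^bsub>int_diff_alg\<^esub> y = \<zero>\<^bsub>int_diff_alg\<^esub>"
      using that diff_op_domain[OF Delta_diff_op _ Delta_diff_op] by auto
  qed
qed

section \<open>The ideal a_n as an annihilator\<close>

lemma (in ring) ideal_finsum_closed:
  assumes "ideal J R" "finite A" "\<And>i. i \<in> A \<Longrightarrow> f i \<in> J"
  shows "finsum R f A \<in> J"
proof -
  interpret J: ideal J R by fact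
  show ?thesis
    using assms(2,3)
  proof (induction A rule: finite_induct)
    case (insert i A)
    then have "f \<in> A \<rightarrow> carrier R" "f i \<in> carrier R" using J.Icarr by auto
    with insert show ?case by (simp add: finsum_insert J.a_closed)
  qed (simp add: J.zero_closed)
qed

context
  fixes I :: "('k::field_char_0, ('n::finite, 'k) operator) module"
  defines "I \<equiv> int_diff_alg"
begin

interpretation I: scaled_ring I
  unfolding I_def by (rule int_diff_alg_scaled_ring)

lemma projection_mem: "(\<lambda>p. p - int_op i (partial_op i p)) \<in> carrier I"
proof -
  have "(\<lambda>p. id p + scale_poly (- 1) ((int_op i \<circ> partial_op i) p)) \<in> carrier I"
    unfolding I_def by (intro int_diff_closed id_int_diff int_diff_gens_mem)
  then show ?thesis by (simp add: scale_poly.scale_minus_left)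
qed

lemma p_ideal_ideal: "ideal (p_ideal i) I"
  using I.genideal_ideal[of "{\<lambda>p. p - int_op i (partial_op i p)}"] projection_mem
  by (simp add: p_ideal_def I_def)

lemma p_ideal_sub_a_ideal: "f \<in> p_ideal i \<Longrightarrow> f \<in> (a_ideal :: ('n, 'k) operator set)"
proof -
  assume f: "f \<in> p_ideal i"
  interpret J: ideal "p_ideal i" I by (rule p_ideal_ideal)
  have "(\<Oplus>\<^bsub>I\<^esub>j\<in>UNIV. if i = j then f else \<zero>\<^bsub>I\<^esub>) = f"
    using I.finsum_singleton[of i UNIV "\<lambda>_. f"] J.Icarr[OF f] by simp
  moreover have "\<forall>j. (if i = j then f else \<zero>\<^bsub>I\<^esub>) \<in> p_ideal j"
    using f additive_subgroup.zero_closed[OF ideal.axioms(1)[OF p_ideal_ideal]] by auto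
  ultimately show ?thesis
    unfolding a_ideal_def I_def[symmetric] by (intro CollectI exI[of _ "\<lambda>j. if i = j then f else \<zero>\<^bsub>I\<^esub>"]) simp
qed

lemma a_ideal_add:
  fixes f g :: "('n, 'k) operator"
  assumes "f \<in> a_ideal" "g \<in> a_ideal"
  shows "f \<oplus>\<^bsub>I\<^esub> g \<in> a_ideal"
proof -
  from assms obtain u v where uv: "f = (\<Oplus>\<^bsub>I\<^esub>i\<in>UNIV. u i)" "g = (\<Oplus>\<^bsub>I\<^esub>i\<in>UNIV. v i)"
    "\<forall>i. u i \<in> p_ideal i" "\<forall>i. v i \<in> p_ideal i"
    unfolding a_ideal_def I_def[symmetric] by blast
  have c: "u \<in> UNIV \<rightarrow> carrier I" "v \<in> UNIV \<rightarrow> carrier I"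
    using uv(3,4) ideal.Icarr[OF p_ideal_ideal] by blast+
  have "f \<oplus>\<^bsub>I\<^esub> g = (\<Oplus>\<^bsub>I\<^esub>i\<in>UNIV. u i \<oplus>\<^bsub>I\<^esub> v i)" unfolding uv by (rule I.finsum_addf[OF c, symmetric])
  moreover have "\<forall>i. u i \<oplus>\<^bsub>I\<^esub> v i \<in> p_ideal i"
    using uv(3,4) additive_subgroup.a_closed[OF ideal.axioms(1)[OF p_ideal_ideal]] by blast
  ultimately show ?thesis unfolding a_ideal_def I_def[symmetric] by blast
qed

lemma a_ideal_left_mult:
  fixes f g :: "('n, 'k) operator"
  assumes "f \<in> carrier I" "g \<in> a_ideal"
  shows "f \<otimes>\<^bsub>I\<^esub> g \<in> a_ideal"
proof -
  from assms obtain v where v: "g = (\<Oplus>\<^bsub>I\<^esub>i\<in>UNIV. v i)" "\<forall>i. v i \<in> p_ideal i"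
    unfolding a_ideal_def I_def[symmetric] by blast
  have c: "v \<in> UNIV \<rightarrow> carrier I" using v(2) ideal.Icarr[OF p_ideal_ideal] by blast
  have "f \<otimes>\<^bsub>I\<^esub> g = (\<Oplus>\<^bsub>I\<^esub>i\<in>UNIV. f \<otimes>\<^bsub>I\<^esub> v i)" unfolding v by (rule I.finsum_rdistr[OF _ assms(1) c]) simp
  moreover have "\<forall>i. f \<otimes>\<^bsub>I\<^esub> v i \<in> p_ideal i"
    using v(2) assms(1) ideal.I_l_closed[OF p_ideal_ideal] by blast
  ultimately show ?thesis unfolding a_ideal_def I_def[symmetric] by blast
qed

text \<open>The outermost derivative is stripped off by writing y = (1 - \<integral>_i \<partial>_i)
  y + \<integral>_i (\<partial>_i y). The first term lies in p_i, the second is a left multiple of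
  \<partial>_i y.\<close>

lemma a_ideal_cancel:
  assumes "s \<in> carrier I" "partial_pow \<alpha> \<circ> s \<in> a_ideal"
  shows "s \<in> a_ideal"
proof -
  have "\<forall>s\<in>carrier I. partial_pow \<alpha> \<circ> s \<in> a_ideal \<longrightarrow> s \<in> (a_ideal :: ('n, 'k) operator set)"
  proof (rule conjunct2, rule partial_pow_induct[where P = "\<lambda>f. f \<in> carrier I \<and> (\<forall>s\<in>carrier I. f \<circ> s \<in> a_ideal \<longrightarrow> s \<in> a_ideal)"])
    fix i and f :: "('n, 'k) operator"
    assume f: "f \<in> carrier I \<and> (\<forall>s\<in>carrier I. f \<circ> s \<in> a_ideal \<longrightarrow> s \<in> a_ideal)"
    have "s \<in> a_ideal" if s: "s \<in> carrier I" "(partial_op i \<circ> f) \<circ> s \<in> a_ideal" for s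
    proof -
      let ?e = "\<lambda>p. p - int_op i (partial_op i p) :: ('n, 'k) polys"
      have y: "f \<circ> s \<in> carrier I" using f s unfolding I_def by (blast intro: int_diff_comp)
      have "?e \<in> p_ideal i"
        using I.genideal_self'[OF projection_mem] by (simp add: p_ideal_def I_def)
      then have "?e \<otimes>\<^bsub>I\<^esub> (f \<circ> s) \<in> a_ideal"
        using y ideal.I_r_closed[OF p_ideal_ideal] p_ideal_sub_a_ideal by blast
      moreover have "int_op i \<otimes>\<^bsub>I\<^esub> ((partial_op i \<circ> f) \<circ> s) \<in> a_ideal"
        by (rule a_ideal_left_mult[OF _ s(2)]) (simp add: I_def)
      ultimately have "?e \<otimes>\<^bsub>I\<^esub> (f \<circ> s) \<oplus>\<^bsub>I\<^esub> int_op i \<otimes>\<^bsub>I\<^esub> ((partial_op i \<circ> f) \<circ> s) \<in> a_ideal"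
        by (rule a_ideal_add)
      then have "f \<circ> s \<in> a_ideal" by (simp add: I_def comp_def)
      then show ?thesis using f s by blast
    qed
    moreover have "partial_op i \<circ> f \<in> carrier I" using f unfolding I_def by (blast intro: int_diff_comp int_diff_gens_mem)
    ultimately show "partial_op i \<circ> f \<in> carrier I \<and>
        (\<forall>s\<in>carrier I. (partial_op i \<circ> f) \<circ> s \<in> a_ideal \<longrightarrow> s \<in> a_ideal)" by blast
  qed (simp add: I_def)
  then show ?thesis using assms by blast
qed

text \<open>An operator killed by some \<partial>^\<alpha> lies in a_n by cancellation. Conversely,
  \<partial>_i \<integral>_i = 1 shows that \<partial>_i annihilates the generator of p_i from the
  left, and the annihilator is an ideal. This also gives the ideal property of
  \<open>a_ideal\<close>.\<close>

lemma a_ideal_eq_ass: "a_ideal = ass_l I (range partial_pow)"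
proof (intro equalityI subsetI)
  fix f assume "f \<in> ass_l I (range partial_pow)"
  then obtain \<alpha> where f: "f \<in> carrier I" "partial_pow \<alpha> \<circ> f = (\<lambda>_. 0)"
    by (auto simp: ass_l_def I_def)
  \<comment> \<open>Any index serves, since zero lies in every p_i; it is only needed that zero
    belongs to \<open>a_ideal\<close>.\<close>
  have "\<zero>\<^bsub>I\<^esub> \<in> p_ideal undefined" using additive_subgroup.zero_closed[OF ideal.axioms(1)[OF p_ideal_ideal]] .
  then have "partial_pow \<alpha> \<circ> f \<in> a_ideal" using p_ideal_sub_a_ideal by (simp add: f(2) I_def)
  then show "f \<in> a_ideal" using f(1) a_ideal_cancel by blast
next
  fix f :: "('n, 'k) operator" assume "f \<in> a_ideal"
  interpret R: regular_ore_extension I "range partial_pow" Delta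
    unfolding I_def by (rule int_diff_regular_ore_extension)
  have "p_ideal i \<subseteq> ass_l I (range partial_pow)" for i
    unfolding p_ideal_def I_def[symmetric]
  proof (rule I.genideal_minimal[OF R.ass_ideal], clarify)
    have "partial_op i \<circ> (\<lambda>p. p - int_op i (partial_op i p) :: ('n, 'k) polys) = (\<lambda>_. 0)"
    proof
      fix p :: "('n, 'k) polys"
      show "(partial_op i \<circ> (\<lambda>p. p - int_op i (partial_op i p))) p = 0"
        by (rule dcoeff_eqI) (simp add: dcoeff_int del: One_nat_def)
    qed
    then have "partial_pow (\<lambda>j. if j = i then 1 else 0) \<otimes>\<^bsub>I\<^esub> (\<lambda>p. p - int_op i (partial_op i p)) = \<zero>\<^bsub>I\<^esub>"
      unfolding partial_pow_unit I_def int_diff_alg_simps .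
    then show "(\<lambda>p. p - int_op i (partial_op i p)) \<in> ass_l I (range partial_pow)"
      using projection_mem unfolding ass_l_def by blast
  qed
  moreover obtain v where v: "f = (\<Oplus>\<^bsub>I\<^esub>i\<in>UNIV. v i)" "\<forall>i. v i \<in> p_ideal i"
    using \<open>f \<in> a_ideal\<close> unfolding a_ideal_def I_def[symmetric] by blast
  ultimately show "f \<in> ass_l I (range partial_pow)"
    unfolding v(1) by (intro I.ideal_finsum_closed R.ass_ideal) auto
qed

end

text \<open>The clause \<open>inj_on \<pi> \<Delta>\<close> makes precise the identification of
  Delta with its image that underlies the third part.\<close>

theorem theorem4p4:
  fixes I :: "('k::field_char_0, ('n::finite, 'k) operator) module"
    and B :: "('k, ('n, 'k) operator set) module"
    and Q :: "('k, (('n, 'k) operator \<times> ('n, 'k) operator) set) module"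
    and \<aa> \<Delta> S \<Delta>' \<Delta>t \<Delta>'' :: "('n, 'k) operator set"
    and \<pi> :: "('n, 'k) operator \<Rightarrow> ('n, 'k) operator set"
  assumes I: "I = int_diff_alg"
    and a: "\<aa> = a_ideal"
    and B: "B = factor_algebra I \<aa>"
    and pi: "\<pi> = (\<lambda>r. \<aa> +>\<^bsub>I\<^esub> r)"
    and Delta: "\<Delta> = Delta"
    and S: "S = left_regular_den I"
    and Q: "Q = localization I S"
    and Delta': "\<Delta>' = \<Delta> \<inter> S"
    and Delta_tilde: "\<Delta>t = {c \<in> \<Delta>. \<exists>\<alpha>. partial_pow \<alpha> \<otimes>\<^bsub>I\<^esub> c \<in> S}"
    and Delta'': "\<Delta>'' = (S \<inter> (left_regular (I\<lparr>carrier := \<Delta> <+>\<^bsub>I\<^esub> \<aa>\<rparr>) <+>\<^bsub>I\<^esub> \<aa>)) <+>\<^bsub>I\<^esub> \<aa>"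
  shows
    \<comment> \<open>1\<close>
    "(\<Delta>' \<in> Den_l I \<aa> \<and> localization I \<Delta>' \<simeq>\<^sub>K Q \<and>
      multiplicative_set I (left_regular I \<inter> \<Delta>) \<and>
      left_denominator_set I \<Delta>' \<and> \<Delta>' \<subseteq> left_regular I \<inter> \<Delta> \<and>
      (\<forall>T. left_denominator_set I T \<and> T \<subseteq> left_regular I \<inter> \<Delta> \<longrightarrow> T \<subseteq> \<Delta>')) \<and>
    \<comment> \<open>2\<close>
     (\<Delta>' <+>\<^bsub>I\<^esub> \<aa> \<in> Den_l I \<aa> \<and> S <+>\<^bsub>I\<^esub> \<aa> \<in> Den_l I \<aa> \<and>
      localization I (\<Delta>' <+>\<^bsub>I\<^esub> \<aa>) \<simeq>\<^sub>K localization I (S <+>\<^bsub>I\<^esub> \<aa>) \<and>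
      localization I (S <+>\<^bsub>I\<^esub> \<aa>) \<simeq>\<^sub>K Q) \<and>
    \<comment> \<open>3\<close>
     (inj_on \<pi> \<Delta> \<and>
      \<pi> ` \<Delta>' \<in> Den_l B {\<zero>\<^bsub>B\<^esub>} \<and>
      \<pi> ` (\<Delta>' <+>\<^bsub>I\<^esub> \<aa>) \<in> Den_l B {\<zero>\<^bsub>B\<^esub>} \<and>
      \<pi> ` (S <+>\<^bsub>I\<^esub> \<aa>) \<in> Den_l B {\<zero>\<^bsub>B\<^esub>} \<and>
      localization B (\<pi> ` \<Delta>') \<simeq>\<^sub>K localization B (\<pi> ` (\<Delta>' <+>\<^bsub>I\<^esub> \<aa>)) \<and>
      localization B (\<pi> ` (\<Delta>' <+>\<^bsub>I\<^esub> \<aa>)) \<simeq>\<^sub>K localization B (\<pi> ` (S <+>\<^bsub>I\<^esub> \<aa>)) \<and>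
      localization B (\<pi> ` (S <+>\<^bsub>I\<^esub> \<aa>)) \<simeq>\<^sub>K Q) \<and>
    \<comment> \<open>4\<close>
     (\<Delta>t \<in> Den_l I \<aa> \<and> localization I \<Delta>t \<simeq>\<^sub>K Q \<and>
      \<pi> ` \<Delta>t \<in> Den_l B {\<zero>\<^bsub>B\<^esub>} \<and> localization B (\<pi> ` \<Delta>t) \<simeq>\<^sub>K Q) \<and>
    \<comment> \<open>5\<close>
     (\<Delta>t <+>\<^bsub>I\<^esub> \<aa> \<in> Den_l I \<aa> \<and> localization I (\<Delta>t <+>\<^bsub>I\<^esub> \<aa>) \<simeq>\<^sub>K Q) \<and>
    \<comment> \<open>6\<close>
     (\<Delta>' \<in> Den_l (I\<lparr>carrier := \<Delta>\<rparr>) {\<zero>\<^bsub>I\<^esub>} \<and> localization (I\<lparr>carrier := \<Delta>\<rparr>) \<Delta>' \<simeq>\<^sub>K Q) \<and>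
    \<comment> \<open>7\<close>
     (\<Delta>'' \<in> Den_l I \<aa> \<and> \<Delta>' \<subseteq> \<Delta>'' \<and> localization I \<Delta>'' \<simeq>\<^sub>K Q)"
proof -
  interpret regular_ore_extension I "range partial_pow" \<Delta>
    unfolding I Delta by (rule int_diff_regular_ore_extension)
  have a': "\<aa> = ass_l I (range partial_pow)" unfolding a I by (rule a_ideal_eq_ass)
  have S': "S = left_regular_den I" by (fact S)
  have D': "saturated \<Delta>'" unfolding Delta' S' by (rule saturated_D')
  have St: "saturated S" unfolding S' by (rule saturated_S)
  have "\<Delta>t = {c \<in> \<Delta>. \<exists>t\<in>range partial_pow. t \<otimes>\<^bsub>I\<^esub> c \<in> S}" unfolding Delta_tilde by auto
  then have Dt: "saturated \<Delta>t" using saturated_tilde unfolding S' by simp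
  have D'a: "saturated (\<Delta>' <+>\<^bsub>I\<^esub> \<aa>)" and Sa: "saturated (S <+>\<^bsub>I\<^esub> \<aa>)" and Dta: "saturated (\<Delta>t <+>\<^bsub>I\<^esub> \<aa>)"
    unfolding a' by (rule saturated_add, fact)+
  have D'': "saturated \<Delta>''"
    unfolding Delta'' a' S' by (intro saturated_add saturated_pre_double_prime)
  note Den = saturated_Den[folded a' S', folded Q]
  note B_Den = saturated_B_Den[folded a', folded B, folded pi]
  note B_iso_Q = saturated_B_iso_Q[folded a' S', folded B Q, folded pi]
  note B_iso_B = saturated_B_iso_B[folded a', folded B, folded pi]
  have 1: "left_denominator_set I \<Delta>'" by (rule saturated_den(1)[OF D'])
  have 2: "\<Delta>' \<subseteq> left_regular I \<inter> \<Delta>" unfolding Delta' S' using S_regular by blast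
  \<comment> \<open>Such a T consists of left regular elements, so it lies in S by maximality, and
    hence in the intersection with Delta.\<close>
  have 3: "T \<subseteq> \<Delta>'" if "left_denominator_set I T" "T \<subseteq> left_regular I \<inter> \<Delta>" for T
    using S_max[of T] that unfolding Delta' S' by blast
  have 4: "multiplicative_set I (left_regular I \<inter> \<Delta>)"
  proof -
    have "\<zero>\<^bsub>I\<^esub> \<notin> left_regular I"
    proof
      assume "\<zero>\<^bsub>I\<^esub> \<in> left_regular I"
      then have "\<one>\<^bsub>I\<^esub> = \<zero>\<^bsub>I\<^esub>" unfolding left_regular_def by auto
      then show False using zero_notin_S one_S by simp
    qed
    moreover have "\<one>\<^bsub>I\<^esub> \<in> left_regular I" by (simp add: left_regular_def)
    ultimately show ?thesis
      unfolding multiplicative_set_def using left_regular_mult D_mult one_D by auto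
  qed
  have 5: "inj_on \<pi> \<Delta>" unfolding pi a' by (rule D_inj)
  have 6: "\<Delta>' \<in> Den_l (I\<lparr>carrier := \<Delta>\<rparr>) {\<zero>\<^bsub>I\<^esub>}" "localization (I\<lparr>carrier := \<Delta>\<rparr>) \<Delta>' \<simeq>\<^sub>K Q"
    unfolding Delta' S' Q using D'_Den_D D'_localization_D by blast+
  have 7: "\<Delta>' \<subseteq> \<Delta>''" using saturatedD(2)[OF D''] unfolding Delta' S' .
  show ?thesis
    using 1 2 3 4 5 6 7 Den[OF D'] Den[OF D'a] Den[OF Sa] saturated_iso[OF D'a Sa]
      B_Den[OF D'] B_Den[OF D'a] B_Den[OF Sa] B_iso_B[OF D' D'a] B_iso_B[OF D'a Sa] B_iso_Q[OF Sa]
      Den[OF Dt] B_Den[OF Dt] B_iso_Q[OF Dt] Den[OF Dta] Den[OF D'']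
    by (intro conjI allI impI) simp_all
qed

end
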